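(* Let $\mathcal{E}$ be an exact category and write $\mathcal{Q}$ for $\operatorname{Proj}(\operatorname{mod}_{\mathsf{adm}}(\mathcal{E}))$. The following are equivalent: (1) The category $\mathcal{E}$ has enough projectives. (2) $(\operatorname{gen}(\mathcal{Q}\cap{}^{\perp}\operatorname{eff}(\mathcal{E})),\operatorname{eff}(\mathcal{E}))$ is a torsion pair in $\operatorname{mod}_{\mathsf{adm}}(\mathcal{E})$. (3) For all $P\in\mathcal{Q}$, there exists an exact sequence $0\to F'\to P\to F''\to 0$ in $\operatorname{mod}_{\mathsf{adm}}(\mathcal{E})$ with $F'\in\operatorname{gen}(\mathcal{Q}\cap{}^{\perp}\operatorname{eff}(\mathcal{E}))$ and $F''\in\operatorname{eff}(\mathcal{E})$.
   Context: All categories are essentially small and additive; subcategories are full and closed under isomorphisms. Exact categories are in the sense of Quillen, with conflations, inflations and deflations; no idempotent completeness is assumed. A morphism is admissible if it is a composite $m\circ p$ with $p$ a deflation and $m$ an inflation. $\operatorname{Mod}(\mathcal{E})$ is the category of additive contravariant functors $\mathcal{E}\to\mathsf{Ab}$, $\Upsilon(X)=\operatorname{Hom}_{\mathcal{E}}(-,X)$. $\operatorname{mod}_{\mathsf{adm}}(\mathcal{E})$ (resp. $\operatorname{eff}(\mathcal{E})$) is the full subcategory of $\operatorname{Mod}(\mathcal{E})$ of functors $F$ with an exact sequence $\Upsilon(X)\xrightarrow{\Upsilon(f)}\Upsilon(Y)\to F\to 0$ with $f$ an admissible morphism (resp. a deflation) in $\mathcal{E}$. $\operatorname{mod}_{\mathsf{adm}}(\mathcal{E})$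 is extension-closed in $\operatorname{Mod}(\mathcal{E})$ and carries the inherited exact structure. $\operatorname{Proj}$ denotes the subcategory of projective objects of an exact category. Inside $\operatorname{mod}_{\mathsf{adm}}(\mathcal{E})$: ${}^{\perp}\operatorname{eff}(\mathcal{E})$ is the subcategory of $F$ with $\operatorname{Hom}(F,G)=0$ for all $G\in\operatorname{eff}(\mathcal{E})$; $\operatorname{gen}(\mathcal{X})$ is the subcategory of objects $F$ admitting a deflation $X\twoheadrightarrow F$ with $X\in\mathcal{X}$. A torsion pair in an exact category is a pair $(\mathcal{T},\mathcal{F})$ of full isomorphism-closed subcategories with $\operatorname{Hom}(T,F)=0$ for $T\in\mathcal{T},F\in\mathcal{F}$, such that every object $M$ fits in a conflation $T\rightarrowtail M\twoheadrightarrow F$ with $T\in\mathcal{T},F\in\mathcal{F}$. *)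

theory Defs
  imports "HOL-Algebra.Coset"
begin

section \<open>Additive categories\<close>

text \<open>
  Categories are given by hom-sets indexed by pairs of objects. Every hom-set carries the structure
  of a group, written multiplicatively as usual in HOL-Algebra: \<open>f \<otimes>\<^bsub>Hom C X Y\<^esub> g\<close> is the sum
  of two morphisms, and \<open>\<one>\<^bsub>Hom C X Y\<^esub>\<close> is the zero morphism. Hom-sets need not be disjoint, so
  composition takes the objects involved: \<open>Comp C X Y Z g f\<close> is the composite of \<open>f : X \<rightarrow> Y\<close> and
  \<open>g : Y \<rightarrow> Z\<close>.
\<close>

record ('o, 'm) category =
  Obj :: "'o set"
  Hom :: "'o \<Rightarrow> 'o \<Rightarrow> 'm monoid"
  Comp :: "'o \<Rightarrow> 'o \<Rightarrow> 'o \<Rightarrow> 'm \<Rightarrow> 'm \<Rightarrow> 'm"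
  Ident :: "'o \<Rightarrow> 'm"

abbreviation homs :: "('o, 'm, 'z) category_scheme \<Rightarrow> 'o \<Rightarrow> 'o \<Rightarrow> 'm set" where
  "homs C X Y \<equiv> carrier (Hom C X Y)"

abbreviation zero_mor :: "('o, 'm, 'z) category_scheme \<Rightarrow> 'o \<Rightarrow> 'o \<Rightarrow> 'm" where
  "zero_mor C X Y \<equiv> \<one>\<^bsub>Hom C X Y\<^esub>"

locale preadditive_category =
  fixes C :: "('o, 'm, 'z) category_scheme"
  assumes hom_group: "\<lbrakk>X \<in> Obj C; Y \<in> Obj C\<rbrakk> \<Longrightarrow> comm_group (Hom C X Y)"
    and ident_closed: "X \<in> Obj C \<Longrightarrow> Ident C X \<in> homs C X X"
    and comp_closed: "\<lbrakk>X \<in> Obj C; Y \<in> Obj C; Z \<in> Obj C; f \<in> homs C X Y; g \<in> homs C Y Z\<rbrakk>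
      \<Longrightarrow> Comp C X Y Z g f \<in> homs C X Z"
    and comp_ident_right: "\<lbrakk>X \<in> Obj C; Y \<in> Obj C; f \<in> homs C X Y\<rbrakk>
      \<Longrightarrow> Comp C X X Y f (Ident C X) = f"
    and comp_ident_left: "\<lbrakk>X \<in> Obj C; Y \<in> Obj C; f \<in> homs C X Y\<rbrakk>
      \<Longrightarrow> Comp C X Y Y (Ident C Y) f = f"
    and comp_assoc: "\<lbrakk>W \<in> Obj C; X \<in> Obj C; Y \<in> Obj C; Z \<in> Obj C;
        f \<in> homs C W X; g \<in> homs C X Y; h \<in> homs C Y Z\<rbrakk>
      \<Longrightarrow> Comp C W X Z (Comp C X Y Z h g) f = Comp C W Y Z h (Comp C W X Y g f)"
    and comp_add_left: "\<lbrakk>X \<in> Obj C; Y \<in> Obj C; Z \<in> Obj C;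
        f \<in> homs C X Y; g \<in> homs C Y Z; g' \<in> homs C Y Z\<rbrakk>
      \<Longrightarrow> Comp C X Y Z (g \<otimes>\<^bsub>Hom C Y Z\<^esub> g') f
        = Comp C X Y Z g f \<otimes>\<^bsub>Hom C X Z\<^esub> Comp C X Y Z g' f"
    and comp_add_right: "\<lbrakk>X \<in> Obj C; Y \<in> Obj C; Z \<in> Obj C;
        f \<in> homs C X Y; f' \<in> homs C X Y; g \<in> homs C Y Z\<rbrakk>
      \<Longrightarrow> Comp C X Y Z g (f \<otimes>\<^bsub>Hom C X Y\<^esub> f')
        = Comp C X Y Z g f \<otimes>\<^bsub>Hom C X Z\<^esub> Comp C X Y Z g f'"

definition is_zero_object :: "('o, 'm, 'z) category_scheme \<Rightarrow> 'o \<Rightarrow> bool" where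
  "is_zero_object C N \<longleftrightarrow> N \<in> Obj C \<and>
     (\<forall>X\<in>Obj C. homs C X N = {zero_mor C X N} \<and> homs C N X = {zero_mor C N X})"

definition is_biproduct ::
    "('o, 'm, 'z) category_scheme \<Rightarrow> 'o \<Rightarrow> 'o \<Rightarrow> 'o \<Rightarrow> 'm \<Rightarrow> 'm \<Rightarrow> 'm \<Rightarrow> 'm \<Rightarrow> bool" where
  "is_biproduct C X Y B i j p q \<longleftrightarrow> B \<in> Obj C \<and>
     i \<in> homs C X B \<and> j \<in> homs C Y B \<and> p \<in> homs C B X \<and> q \<in> homs C B Y \<and>
     Comp C X B X p i = Ident C X \<and> Comp C Y B Y q j = Ident C Y \<and>
     Comp C Y B X p j = zero_mor C Y X \<and> Comp C X B Y q i = zero_mor C X Y \<and>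
     Comp C B X B i p \<otimes>\<^bsub>Hom C B B\<^esub> Comp C B Y B j q = Ident C B"

locale additive_category = preadditive_category +
  assumes ex_zero_object: "\<exists>N. is_zero_object C N"
    and ex_biproduct: "\<lbrakk>X \<in> Obj C; Y \<in> Obj C\<rbrakk> \<Longrightarrow> \<exists>B i j p q. is_biproduct C X Y B i j p q"

definition is_iso :: "('o, 'm, 'z) category_scheme \<Rightarrow> 'o \<Rightarrow> 'o \<Rightarrow> 'm \<Rightarrow> bool" where
  "is_iso C X Y f \<longleftrightarrow> X \<in> Obj C \<and> Y \<in> Obj C \<and> f \<in> homs C X Y \<and>
     (\<exists>g\<in>homs C Y X. Comp C X Y X g f = Ident C X \<and> Comp C Y X Y f g = Ident C Y)"

definition iso_closed :: "('o, 'm, 'z) category_scheme \<Rightarrow> 'o set \<Rightarrow> bool" where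
  "iso_closed C S \<longleftrightarrow> (\<forall>X\<in>S. \<forall>Y\<in>Obj C. (\<exists>f. is_iso C X Y f) \<longrightarrow> Y \<in> S)"

definition is_kernel ::
    "('o, 'm, 'z) category_scheme \<Rightarrow> 'o \<Rightarrow> 'm \<Rightarrow> 'o \<Rightarrow> 'm \<Rightarrow> 'o \<Rightarrow> bool" where
  "is_kernel C X i Y p Z \<longleftrightarrow>
     X \<in> Obj C \<and> Y \<in> Obj C \<and> Z \<in> Obj C \<and> i \<in> homs C X Y \<and> p \<in> homs C Y Z \<and>
     Comp C X Y Z p i = zero_mor C X Z \<and>
     (\<forall>W\<in>Obj C. \<forall>g\<in>homs C W Y. Comp C W Y Z p g = zero_mor C W Z \<longrightarrow>
        (\<exists>!h. h \<in> homs C W X \<and> Comp C W X Y i h = g))"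

definition is_cokernel ::
    "('o, 'm, 'z) category_scheme \<Rightarrow> 'o \<Rightarrow> 'm \<Rightarrow> 'o \<Rightarrow> 'm \<Rightarrow> 'o \<Rightarrow> bool" where
  "is_cokernel C X i Y p Z \<longleftrightarrow>
     X \<in> Obj C \<and> Y \<in> Obj C \<and> Z \<in> Obj C \<and> i \<in> homs C X Y \<and> p \<in> homs C Y Z \<and>
     Comp C X Y Z p i = zero_mor C X Z \<and>
     (\<forall>W\<in>Obj C. \<forall>g\<in>homs C Y W. Comp C X Y W g i = zero_mor C X W \<longrightarrow>
        (\<exists>!h. h \<in> homs C Z W \<and> Comp C Y Z W h p = g))"

text \<open>The square with sides \<open>f' : P \<rightarrow> Y\<close>, \<open>p' : P \<rightarrow> W\<close>, \<open>p : Y \<rightarrow> Z\<close>, \<open>f : W \<rightarrow> Z\<close>.\<close>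

definition is_pullback ::
    "('o, 'm, 'z) category_scheme \<Rightarrow> 'o \<Rightarrow> 'm \<Rightarrow> 'o \<Rightarrow> 'm \<Rightarrow> 'o \<Rightarrow> 'm \<Rightarrow> 'm \<Rightarrow> 'o \<Rightarrow> bool" where
  "is_pullback C P f' Y p' W p f Z \<longleftrightarrow>
     P \<in> Obj C \<and> Y \<in> Obj C \<and> W \<in> Obj C \<and> Z \<in> Obj C \<and>
     f' \<in> homs C P Y \<and> p' \<in> homs C P W \<and> p \<in> homs C Y Z \<and> f \<in> homs C W Z \<and>
     Comp C P Y Z p f' = Comp C P W Z f p' \<and>
     (\<forall>V\<in>Obj C. \<forall>a\<in>homs C V Y. \<forall>b\<in>homs C V W. Comp C V Y Z p a = Comp C V W Z f b \<longrightarrow>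
        (\<exists>!h. h \<in> homs C V P \<and> Comp C V P Y f' h = a \<and> Comp C V P W p' h = b))"

text \<open>The square with sides \<open>i : X \<rightarrow> Y\<close>, \<open>f : X \<rightarrow> W\<close>, \<open>f' : Y \<rightarrow> P\<close>, \<open>i' : W \<rightarrow> P\<close>.\<close>

definition is_pushout ::
    "('o, 'm, 'z) category_scheme \<Rightarrow> 'o \<Rightarrow> 'm \<Rightarrow> 'o \<Rightarrow> 'm \<Rightarrow> 'o \<Rightarrow> 'm \<Rightarrow> 'm \<Rightarrow> 'o \<Rightarrow> bool" where
  "is_pushout C X i Y f W f' i' P \<longleftrightarrow>
     X \<in> Obj C \<and> Y \<in> Obj C \<and> W \<in> Obj C \<and> P \<in> Obj C \<and>
     i \<in> homs C X Y \<and> f \<in> homs C X W \<and> f' \<in> homs C Y P \<and> i' \<in> homs C W P \<and>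
     Comp C X Y P f' i = Comp C X W P i' f \<and>
     (\<forall>V\<in>Obj C. \<forall>a\<in>homs C Y V. \<forall>b\<in>homs C W V. Comp C X Y V a i = Comp C X W V b f \<longrightarrow>
        (\<exists>!h. h \<in> homs C P V \<and> Comp C Y P V h f' = a \<and> Comp C W P V h i' = b))"


section \<open>Exact categories\<close>

text \<open>\<open>Conf E X i Y p Z\<close> says that \<open>i : X \<rightarrow> Y\<close> and \<open>p : Y \<rightarrow> Z\<close> form a conflation.\<close>

record ('o, 'm) exact_structure = "('o, 'm) category" +
  Conf :: "'o \<Rightarrow> 'm \<Rightarrow> 'o \<Rightarrow> 'm \<Rightarrow> 'o \<Rightarrow> bool"

definition inflation :: "('o, 'm, 'z) exact_structure_scheme \<Rightarrow> 'o \<Rightarrow> 'o \<Rightarrow> 'm \<Rightarrow> bool" where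
  "inflation E X Y i \<longleftrightarrow> (\<exists>p Z. Conf E X i Y p Z)"

definition deflation :: "('o, 'm, 'z) exact_structure_scheme \<Rightarrow> 'o \<Rightarrow> 'o \<Rightarrow> 'm \<Rightarrow> bool" where
  "deflation E Y Z p \<longleftrightarrow> (\<exists>X i. Conf E X i Y p Z)"

text \<open>
  Quillen's axioms, in the self-dual form without the redundant ``obscure axiom''.
\<close>

locale exact_category = additive_category E
  for E :: "('o, 'm, 'z) exact_structure_scheme" +
  assumes conf_kernel_cokernel:
      "Conf E X i Y p Z \<Longrightarrow> is_kernel E X i Y p Z \<and> is_cokernel E X i Y p Z"
    and conf_iso: "\<lbrakk>Conf E X i Y p Z; is_iso E X X' a; is_iso E Y Y' b; is_iso E Z Z' c;
        i' \<in> homs E X' Y'; p' \<in> homs E Y' Z';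
        Comp E X X' Y' i' a = Comp E X Y Y' b i; Comp E Y Y' Z' p' b = Comp E Y Z Z' c p\<rbrakk>
      \<Longrightarrow> Conf E X' i' Y' p' Z'"
    and ident_inflation: "X \<in> Obj E \<Longrightarrow> inflation E X X (Ident E X)"
    and ident_deflation: "X \<in> Obj E \<Longrightarrow> deflation E X X (Ident E X)"
    and inflation_comp: "\<lbrakk>inflation E X Y i; inflation E Y Z j\<rbrakk>
      \<Longrightarrow> inflation E X Z (Comp E X Y Z j i)"
    and deflation_comp: "\<lbrakk>deflation E X Y p; deflation E Y Z q\<rbrakk>
      \<Longrightarrow> deflation E X Z (Comp E X Y Z q p)"
    and inflation_pushout: "\<lbrakk>inflation E X Y i; W \<in> Obj E; f \<in> homs E X W\<rbrakk>
      \<Longrightarrow> \<exists>P f' i'. is_pushout E X i Y f W f' i' P \<and> inflation E W P i'"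
    and deflation_pullback: "\<lbrakk>deflation E Y Z p; W \<in> Obj E; f \<in> homs E W Z\<rbrakk>
      \<Longrightarrow> \<exists>P f' p'. is_pullback E P f' Y p' W p f Z \<and> deflation E P W p'"

definition admissible :: "('o, 'm, 'z) exact_structure_scheme \<Rightarrow> 'o \<Rightarrow> 'o \<Rightarrow> 'm \<Rightarrow> bool" where
  "admissible E X Y f \<longleftrightarrow>
     (\<exists>I p m. deflation E X I p \<and> inflation E I Y m \<and> f = Comp E X I Y m p)"

definition Proj :: "('o, 'm, 'z) exact_structure_scheme \<Rightarrow> 'o set" where
  "Proj E = {P \<in> Obj E. \<forall>Y Z p. deflation E Y Z p \<longrightarrow>
     (\<forall>f\<in>homs E P Z. \<exists>g\<in>homs E P Y. Comp E P Y Z p g = f)}"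

definition enough_projectives :: "('o, 'm, 'z) exact_structure_scheme \<Rightarrow> bool" where
  "enough_projectives E \<longleftrightarrow> (\<forall>X\<in>Obj E. \<exists>P\<in>Proj E. \<exists>p. deflation E P X p)"

definition gen :: "('o, 'm, 'z) exact_structure_scheme \<Rightarrow> 'o set \<Rightarrow> 'o set" where
  "gen E \<X> = {F \<in> Obj E. \<exists>X\<in>\<X>. \<exists>p. deflation E X F p}"

definition left_perp :: "('o, 'm, 'z) category_scheme \<Rightarrow> 'o set \<Rightarrow> 'o set" where
  "left_perp C \<G> = {F \<in> Obj C. \<forall>G\<in>\<G>. homs C F G = {zero_mor C F G}}"

definition torsion_pair :: "('o, 'm, 'z) exact_structure_scheme \<Rightarrow> 'o set \<Rightarrow> 'o set \<Rightarrow> bool" where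
  "torsion_pair E \<T> \<F> \<longleftrightarrow>
     \<T> \<subseteq> Obj E \<and> \<F> \<subseteq> Obj E \<and> iso_closed E \<T> \<and> iso_closed E \<F> \<and>
     (\<forall>T\<in>\<T>. \<forall>F\<in>\<F>. homs E T F = {zero_mor E T F}) \<and>
     (\<forall>M\<in>Obj E. \<exists>T\<in>\<T>. \<exists>F\<in>\<F>. \<exists>i p. Conf E T i M p F)"


section \<open>Functors to abelian groups\<close>

text \<open>
  A contravariant functor to abelian groups whose underlying sets are subsets of the type \<open>'g\<close>.
  The type \<open>'g\<close> plays the role of the universe in which abelian groups live; an injection from the
  type of morphisms into \<open>'g\<close> guarantees that every functor with a presentation by representable
  functors is isomorphic to one with values in \<open>'g\<close>.
  For \<open>f : X \<rightarrow> Y\<close>, the map \<open>FMor F X Y f\<close> goes from \<open>FObj F Y\<close> to \<open>FObj F X\<close>.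
\<close>

record ('o, 'm, 'g) cfunctor =
  FObj :: "'o \<Rightarrow> 'g monoid"
  FMor :: "'o \<Rightarrow> 'o \<Rightarrow> 'm \<Rightarrow> 'g \<Rightarrow> 'g"

definition additive_functor ::
    "('o, 'm, 'z) category_scheme \<Rightarrow> ('o, 'm, 'g) cfunctor \<Rightarrow> bool" where
  "additive_functor C F \<longleftrightarrow>
     (\<forall>X\<in>Obj C. comm_group (FObj F X)) \<and>
     (\<forall>X\<in>Obj C. \<forall>Y\<in>Obj C. \<forall>f\<in>homs C X Y. FMor F X Y f \<in> hom (FObj F Y) (FObj F X)) \<and>
     (\<forall>X\<in>Obj C. \<forall>x\<in>carrier (FObj F X). FMor F X X (Ident C X) x = x) \<and>
     (\<forall>X\<in>Obj C. \<forall>Y\<in>Obj C. \<forall>Z\<in>Obj C. \<forall>f\<in>homs C X Y. \<forall>g\<in>homs C Y Z.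
        \<forall>x\<in>carrier (FObj F Z). FMor F X Z (Comp C X Y Z g f) x = FMor F X Y f (FMor F Y Z g x)) \<and>
     (\<forall>X\<in>Obj C. \<forall>Y\<in>Obj C. \<forall>f\<in>homs C X Y. \<forall>g\<in>homs C X Y. \<forall>x\<in>carrier (FObj F Y).
        FMor F X Y (f \<otimes>\<^bsub>Hom C X Y\<^esub> g) x = FMor F X Y f x \<otimes>\<^bsub>FObj F X\<^esub> FMor F X Y g x)"

text \<open>
  Components are made extensional so that natural transformations are equal as soon as they agree
  on all elements. The two functors may take values in groups over different types.
\<close>

definition nat_trans :: "('o, 'm, 'z) category_scheme \<Rightarrow> ('o, 'm, 'a) cfunctor \<Rightarrow>
    ('o, 'm, 'b) cfunctor \<Rightarrow> ('o \<Rightarrow> 'a \<Rightarrow> 'b) set" where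
  "nat_trans C F G =
     {\<alpha> \<in> (\<Pi>\<^sub>E X\<in>Obj C. hom (FObj F X) (FObj G X) \<inter> extensional (carrier (FObj F X))).
        \<forall>X\<in>Obj C. \<forall>Y\<in>Obj C. \<forall>f\<in>homs C X Y. \<forall>y\<in>carrier (FObj F Y).
          \<alpha> X (FMor F X Y f y) = FMor G X Y f (\<alpha> Y y)}"

text \<open>Exactness of functors is pointwise.\<close>

definition short_exact :: "('o, 'm, 'z) category_scheme \<Rightarrow> ('o, 'm, 'g) cfunctor \<Rightarrow>
    ('o \<Rightarrow> 'g \<Rightarrow> 'g) \<Rightarrow> ('o, 'm, 'g) cfunctor \<Rightarrow> ('o \<Rightarrow> 'g \<Rightarrow> 'g) \<Rightarrow>
    ('o, 'm, 'g) cfunctor \<Rightarrow> bool" where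
  "short_exact C F \<alpha> G \<beta> H \<longleftrightarrow>
     additive_functor C F \<and> additive_functor C G \<and> additive_functor C H \<and>
     \<alpha> \<in> nat_trans C F G \<and> \<beta> \<in> nat_trans C G H \<and>
     (\<forall>X\<in>Obj C. inj_on (\<alpha> X) (carrier (FObj F X)) \<and>
        \<alpha> X ` carrier (FObj F X) = kernel (FObj G X) (FObj H X) (\<beta> X) \<and>
        \<beta> X ` carrier (FObj G X) = carrier (FObj H X))"

definition mod_category :: "('o, 'm, 'z) category_scheme \<Rightarrow>
    (('o, 'm, 'g) cfunctor, 'o \<Rightarrow> 'g \<Rightarrow> 'g) exact_structure" where
  "mod_category C = \<lparr>
     Obj = {F. additive_functor C F},
     Hom = (\<lambda>F G. \<lparr>
       carrier = nat_trans C F G,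
       mult = (\<lambda>\<alpha> \<beta>. \<lambda>X\<in>Obj C. \<lambda>x\<in>carrier (FObj F X). \<alpha> X x \<otimes>\<^bsub>FObj G X\<^esub> \<beta> X x),
       one = (\<lambda>X\<in>Obj C. \<lambda>x\<in>carrier (FObj F X). \<one>\<^bsub>FObj G X\<^esub>)\<rparr>),
     Comp = (\<lambda>F G H \<beta> \<alpha>. \<lambda>X\<in>Obj C. compose (carrier (FObj F X)) (\<beta> X) (\<alpha> X)),
     Ident = (\<lambda>F. \<lambda>X\<in>Obj C. \<lambda>x\<in>carrier (FObj F X). x),
     Conf = short_exact C\<rparr>"

definition yoneda :: "('o, 'm, 'z) category_scheme \<Rightarrow> 'o \<Rightarrow> ('o, 'm, 'm) cfunctor" where
  "yoneda C X = \<lparr>FObj = (\<lambda>Z. Hom C Z X), FMor = (\<lambda>Z W f g. Comp C Z W X g f)\<rparr>"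

definition yoneda_mor ::
    "('o, 'm, 'z) category_scheme \<Rightarrow> 'o \<Rightarrow> 'o \<Rightarrow> 'm \<Rightarrow> 'o \<Rightarrow> 'm \<Rightarrow> 'm" where
  "yoneda_mor C X Y f = (\<lambda>Z\<in>Obj C. \<lambda>g\<in>homs C Z X. Comp C Z X Y f g)"

text \<open>Exactness of \<open>\<Upsilon>(X) \<rightarrow> \<Upsilon>(Y) \<rightarrow> F \<rightarrow> 0\<close>, the first map being \<open>\<Upsilon>(f)\<close> and the second one \<open>\<pi>\<close>.\<close>

definition presents :: "('o, 'm, 'z) category_scheme \<Rightarrow> 'o \<Rightarrow> 'o \<Rightarrow> 'm \<Rightarrow>
    ('o \<Rightarrow> 'm \<Rightarrow> 'g) \<Rightarrow> ('o, 'm, 'g) cfunctor \<Rightarrow> bool" where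
  "presents C X Y f \<pi> F \<longleftrightarrow>
     \<pi> \<in> nat_trans C (yoneda C Y) F \<and>
     (\<forall>Z\<in>Obj C.
        yoneda_mor C X Y f Z ` carrier (FObj (yoneda C X) Z)
          = kernel (FObj (yoneda C Y) Z) (FObj F Z) (\<pi> Z) \<and>
        \<pi> Z ` carrier (FObj (yoneda C Y) Z) = carrier (FObj F Z))"

definition mod_adm :: "('o, 'm, 'z) exact_structure_scheme \<Rightarrow> ('o, 'm, 'g) cfunctor set" where
  "mod_adm E = {F \<in> Obj (mod_category E). \<exists>X Y f \<pi>. admissible E X Y f \<and> presents E X Y f \<pi> F}"

definition eff :: "('o, 'm, 'z) exact_structure_scheme \<Rightarrow> ('o, 'm, 'g) cfunctor set" where
  "eff E = {F \<in> Obj (mod_category E). \<exists>X Y f \<pi>. deflation E X Y f \<and> presents E X Y f \<pi> F}"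

definition full_exact_subcategory ::
    "('o, 'm, 'z) exact_structure_scheme \<Rightarrow> 'o set \<Rightarrow> ('o, 'm, 'z) exact_structure_scheme" where
  "full_exact_subcategory E S =
     E\<lparr>Obj := S, Conf := (\<lambda>X i Y p Z. X \<in> S \<and> Y \<in> S \<and> Z \<in> S \<and> Conf E X i Y p Z)\<rparr>"

definition mod_adm_category :: "('o, 'm, 'z) exact_structure_scheme \<Rightarrow>
    (('o, 'm, 'g) cfunctor, 'o \<Rightarrow> 'g \<Rightarrow> 'g) exact_structure" where
  "mod_adm_category E = full_exact_subcategory (mod_category E) (mod_adm E)"

end

theory Submission
  imports Defs
begin

text \<open>
  The projective objects of \<open>mod_adm\<close> are the representable functors: if \<open>F\<close> is projective and
  presented by an admissible \<open>f\<close>, then \<open>f = f u f\<close> for some \<open>u\<close>, and admissibility splits the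
  idempotent \<open>1 - f u\<close>. Moreover \<open>\<Upsilon>(C)\<close> is left orthogonal to \<open>eff\<close> iff \<open>C\<close> is projective in
  \<open>\<E>\<close>. If \<open>\<E>\<close> has enough projectives and \<open>F\<close> is a quotient of \<open>\<Upsilon>(Y)\<close>, choose a deflation
  \<open>Q \<rightarrow> Y\<close> with \<open>Q\<close> projective; the torsion part of \<open>F\<close> is the image of \<open>\<Upsilon>(Q) \<rightarrow> \<Upsilon>(Y) \<rightarrow> F\<close>.
  Conversely, the sequence in (3) for \<open>P = \<Upsilon>(X)\<close> gives a map \<open>b : C \<rightarrow> X\<close> from a projective
  object through which some deflation onto \<open>X\<close> factors; \<open>b\<close> has a kernel because the kernel of
  \<open>\<Upsilon>(b)\<close> lies in \<open>mod_adm\<close>, and so it is a deflation by the dual of the obscure axiom.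
\<close>

section \<open>Preadditive categories\<close>

text \<open>Idempotents of \<E> need not split and morphisms of \<E> need not have kernels. Both
  missing objects come from one source: for \<open>f = m p\<close> with \<open>p\<close> a deflation
  and \<open>m\<close> an inflation, the cokernel of \<open>m\<close>. It splits
  \<open>1 - f u\<close>, and it is the kernel object of \<open>b\<close> when \<Upsilon>(f)
  presents the kernel of \<Upsilon>(b). All arguments run on elements: a map \<Upsilon>(Y) -> F is
  an element of F(Y), and F is handled through one generator \<open>y\<close> whose relations are
  the morphisms that factor through \<open>f\<close>. As \<Upsilon>(X) has values in the type of
  morphisms, its place in \<open>mod_adm\<close> is taken by a copy with values in
  \<open>'g\<close>, presented by the zero endomorphism of X. For (1) ==> (2) the torsion part needs
  an admissible presentation and the quotient one by a deflation. The former is the pullback of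
  \<open>f\<close> along \<open>q : Q -> Y\<close>; the latter is the morphism with components
  \<open>f\<close> and \<open>q\<close> on the biproduct of X and Q, which is a deflation for every
  \<open>f\<close> because \<open>q\<close> is one. (2) ==> (3) is a special case, since (3) asks
  only about projective objects.\<close>

context preadditive_category
begin

declare ident_closed [simp] comp_closed [simp] comp_ident_left [simp] comp_ident_right [simp]

lemma hom_monoid [simp]: "\<lbrakk>X \<in> Obj C; Y \<in> Obj C\<rbrakk> \<Longrightarrow> Group.monoid (Hom C X Y)"
  and hom_grp [simp]: "\<lbrakk>X \<in> Obj C; Y \<in> Obj C\<rbrakk> \<Longrightarrow> group (Hom C X Y)"
  using hom_group[of X Y] unfolding comm_group_def group_def by auto

lemma zero_closed [simp]: "\<lbrakk>X \<in> Obj C; Y \<in> Obj C\<rbrakk> \<Longrightarrow> zero_mor C X Y \<in> homs C X Y"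
  by (simp add: monoid.one_closed)

lemma add_closed [simp]:
  "\<lbrakk>X \<in> Obj C; Y \<in> Obj C; f \<in> homs C X Y; g \<in> homs C X Y\<rbrakk> \<Longrightarrow> f \<otimes>\<^bsub>Hom C X Y\<^esub> g \<in> homs C X Y"
  by (simp add: monoid.m_closed)

lemma neg_closed [simp]:
  "\<lbrakk>X \<in> Obj C; Y \<in> Obj C; f \<in> homs C X Y\<rbrakk> \<Longrightarrow> inv\<^bsub>Hom C X Y\<^esub> f \<in> homs C X Y"
  by (simp add: group.inv_closed)

lemma add_zero [simp]:
  assumes "X \<in> Obj C" "Y \<in> Obj C" "f \<in> homs C X Y"
  shows "f \<otimes>\<^bsub>Hom C X Y\<^esub> zero_mor C X Y = f" "zero_mor C X Y \<otimes>\<^bsub>Hom C X Y\<^esub> f = f"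
  using assms by (simp_all add: monoid.r_one monoid.l_one)

lemma comp_zero_right [simp]:
  assumes "X \<in> Obj C" "Y \<in> Obj C" "Z \<in> Obj C" "g \<in> homs C Y Z"
  shows "Comp C X Y Z g (zero_mor C X Y) = zero_mor C X Z"
proof -
  interpret group "Hom C X Z" using assms by simp
  have "Comp C X Y Z g (zero_mor C X Y \<otimes>\<^bsub>Hom C X Y\<^esub> zero_mor C X Y)
      = Comp C X Y Z g (zero_mor C X Y) \<otimes>\<^bsub>Hom C X Z\<^esub> Comp C X Y Z g (zero_mor C X Y)"
    using assms by (intro comp_add_right) simp_all
  then show ?thesis using assms by simp
qed

lemma comp_zero_left [simp]:
  assumes "X \<in> Obj C" "Y \<in> Obj C" "Z \<in> Obj C" "f \<in> homs C X Y"
  shows "Comp C X Y Z (zero_mor C Y Z) f = zero_mor C X Z"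
proof -
  interpret group "Hom C X Z" using assms by simp
  have "Comp C X Y Z (zero_mor C Y Z \<otimes>\<^bsub>Hom C Y Z\<^esub> zero_mor C Y Z) f
      = Comp C X Y Z (zero_mor C Y Z) f \<otimes>\<^bsub>Hom C X Z\<^esub> Comp C X Y Z (zero_mor C Y Z) f"
    using assms by (intro comp_add_left) simp_all
  then show ?thesis using assms by simp
qed

lemma comp_neg_right:
  assumes "X \<in> Obj C" "Y \<in> Obj C" "Z \<in> Obj C" "f \<in> homs C X Y" "g \<in> homs C Y Z"
  shows "Comp C X Y Z g (inv\<^bsub>Hom C X Y\<^esub> f) = inv\<^bsub>Hom C X Z\<^esub> (Comp C X Y Z g f)"
proof -
  have "Comp C X Y Z g (inv\<^bsub>Hom C X Y\<^esub> f) \<otimes>\<^bsub>Hom C X Z\<^esub> Comp C X Y Z g f = zero_mor C X Z"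
    using assms by (simp add: comp_add_right[symmetric] group.l_inv)
  then show ?thesis using assms by (metis group.inv_equality hom_grp comp_closed neg_closed)
qed

lemma diff_eq_zero:
  assumes "X \<in> Obj C" "Y \<in> Obj C" "f \<in> homs C X Y" "g \<in> homs C X Y"
    and "f \<otimes>\<^bsub>Hom C X Y\<^esub> inv\<^bsub>Hom C X Y\<^esub> g = zero_mor C X Y"
  shows "f = g"
proof -
  interpret group "Hom C X Y" using assms by simp
  show ?thesis using assms by (metis inv_equality inv_inv inv_closed)
qed

lemma diff_add [simp]:
  assumes "X \<in> Obj C" "Y \<in> Obj C" "f \<in> homs C X Y" "g \<in> homs C X Y"
  shows "(f \<otimes>\<^bsub>Hom C X Y\<^esub> inv\<^bsub>Hom C X Y\<^esub> g) \<otimes>\<^bsub>Hom C X Y\<^esub> g = f"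
proof -
  interpret group "Hom C X Y" using assms by simp
  show ?thesis using assms by (simp add: m_assoc)
qed

lemma zero_object_zero:
  assumes "is_zero_object C N" "X \<in> Obj C"
  shows "f \<in> homs C X N \<longleftrightarrow> f = zero_mor C X N" "f \<in> homs C N X \<longleftrightarrow> f = zero_mor C N X"
  using assms unfolding is_zero_object_def by blast+

lemma is_iso_ident: "X \<in> Obj C \<Longrightarrow> is_iso C X X (Ident C X)"
  unfolding is_iso_def by auto

text \<open>Additivity reduces cancellation to the zero test: apply the first premise to
  \<open>g - h\<close>.\<close>

lemma monic_cancel:
  assumes "\<And>W g. \<lbrakk>W \<in> Obj C; g \<in> homs C W X; Comp C W X Y i g = zero_mor C W Y\<rbrakk> \<Longrightarrow> g = zero_mor C W X"
    and "X \<in> Obj C" "Y \<in> Obj C" "W \<in> Obj C" "i \<in> homs C X Y" "g \<in> homs C W X" "h \<in> homs C W X"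
    and "Comp C W X Y i g = Comp C W X Y i h"
  shows "g = h"
proof (rule diff_eq_zero)
  show "g \<otimes>\<^bsub>Hom C W X\<^esub> inv\<^bsub>Hom C W X\<^esub> h = zero_mor C W X"
    using assms by (intro assms(1)) (simp_all add: comp_add_right comp_neg_right group.r_inv)
qed (use assms in auto)

section \<open>Factorization and cancellation from universal properties\<close>

lemma kernel_monic:
  assumes "is_kernel C X i Y p Z" "W \<in> Obj C" "g \<in> homs C W X" "h \<in> homs C W X"
    and "Comp C W X Y i g = Comp C W X Y i h"
  shows "g = h"
proof -
  have o: "X \<in> Obj C" "Y \<in> Obj C" "Z \<in> Obj C" "i \<in> homs C X Y" "p \<in> homs C Y Z"
      "Comp C X Y Z p i = zero_mor C X Z" 
    using assms(1) unfolding is_kernel_def by auto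
  have "Comp C W Y Z p (Comp C W X Y i h) = zero_mor C W Z"
    using o assms by (simp flip: comp_assoc)
  then have "\<exists>!l. l \<in> homs C W X \<and> Comp C W X Y i l = Comp C W X Y i h"
    using assms o unfolding is_kernel_def by auto
  then show ?thesis using assms by blast
qed

lemma cokernel_epic:
  assumes "is_cokernel C X i Y p Z" "W \<in> Obj C" "g \<in> homs C Z W" "h \<in> homs C Z W"
    and "Comp C Y Z W g p = Comp C Y Z W h p"
  shows "g = h"
proof -
  have o: "X \<in> Obj C" "Y \<in> Obj C" "Z \<in> Obj C" "i \<in> homs C X Y" "p \<in> homs C Y Z"
      "Comp C X Y Z p i = zero_mor C X Z"
    using assms(1) unfolding is_cokernel_def by auto
  have "Comp C X Y W (Comp C Y Z W h p) i = zero_mor C X W"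
    using o assms by (simp add: comp_assoc)
  then have "\<exists>!l. l \<in> homs C Z W \<and> Comp C Y Z W l p = Comp C Y Z W h p"
    using assms o unfolding is_cokernel_def by auto
  then show ?thesis using assms by blast
qed

lemma kernel_factor:
  assumes "is_kernel C X i Y p Z" "W \<in> Obj C" "g \<in> homs C W Y" "Comp C W Y Z p g = zero_mor C W Z"
  obtains h where "h \<in> homs C W X" "Comp C W X Y i h = g"
  using assms unfolding is_kernel_def by meson

lemma cokernel_factor:
  assumes "is_cokernel C X i Y p Z" "W \<in> Obj C" "g \<in> homs C Y W" "Comp C X Y W g i = zero_mor C X W"
  obtains h where "h \<in> homs C Z W" "Comp C Y Z W h p = g"
  using assms unfolding is_cokernel_def by meson

lemma pullback_factor:
  assumes "is_pullback C P f' Y p' W p f Z" "V \<in> Obj C" "a \<in> homs C V Y" "b \<in> homs C V W"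
    and "Comp C V Y Z p a = Comp C V W Z f b"
  obtains h where "h \<in> homs C V P" "Comp C V P Y f' h = a" "Comp C V P W p' h = b"
  using assms unfolding is_pullback_def by meson

lemma pushout_factor:
  assumes "is_pushout C X i Y f W f' i' P" "V \<in> Obj C" "a \<in> homs C Y V" "b \<in> homs C W V"
    and "Comp C X Y V a i = Comp C X W V b f"
  obtains h where "h \<in> homs C P V" "Comp C Y P V h f' = a" "Comp C W P V h i' = b"
  using assms unfolding is_pushout_def by meson

lemma pullback_eqI:
  assumes "is_pullback C P f' Y p' W p f Z" "V \<in> Obj C" "g \<in> homs C V P" "h \<in> homs C V P"
    and "Comp C V P Y f' g = Comp C V P Y f' h" "Comp C V P W p' g = Comp C V P W p' h"
  shows "g = h"
proof -
  have o: "P \<in> Obj C" "Y \<in> Obj C" "W \<in> Obj C" "Z \<in> Obj C" "f' \<in> homs C P Y" "p' \<in> homs C P W"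
    "p \<in> homs C Y Z" "f \<in> homs C W Z" "Comp C P Y Z p f' = Comp C P W Z f p'"
    using assms(1) unfolding is_pullback_def by auto
  have "Comp C V Y Z p (Comp C V P Y f' h) = Comp C V W Z f (Comp C V P W p' h)"
    using o assms by (simp flip: comp_assoc)
  then have "\<exists>!l. l \<in> homs C V P \<and> Comp C V P Y f' l = Comp C V P Y f' h
      \<and> Comp C V P W p' l = Comp C V P W p' h"
    using assms o unfolding is_pullback_def by auto
  then show ?thesis using assms by blast
qed

lemma pushout_eqI:
  assumes "is_pushout C X i Y f W f' i' P" "V \<in> Obj C" "g \<in> homs C P V" "h \<in> homs C P V"
    and "Comp C Y P V g f' = Comp C Y P V h f'" "Comp C W P V g i' = Comp C W P V h i'"
  shows "g = h"
proof -
  have o: "X \<in> Obj C" "Y \<in> Obj C" "W \<in> Obj C" "P \<in> Obj C" "i \<in> homs C X Y" "f \<in> homs C X W"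
    "f' \<in> homs C Y P" "i' \<in> homs C W P" "Comp C X Y P f' i = Comp C X W P i' f"
    using assms(1) unfolding is_pushout_def by auto
  have "Comp C X Y V (Comp C Y P V h f') i = Comp C X W V (Comp C W P V h i') f"
    using o assms by (simp add: comp_assoc)
  then have "\<exists>!l. l \<in> homs C P V \<and> Comp C Y P V l f' = Comp C Y P V h f'
      \<and> Comp C W P V l i' = Comp C W P V h i'"
    using assms o unfolding is_pushout_def by auto
  then show ?thesis using assms by blast
qed

lemma biproduct_pair:
  assumes "is_biproduct C X Y B i j p q" "X \<in> Obj C" "Y \<in> Obj C" "V \<in> Obj C"
    and "a \<in> homs C V X" "b \<in> homs C V Y"
  obtains h where "h \<in> homs C V B" "Comp C V B X p h = a" "Comp C V B Y q h = b"
proof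
  note o = assms(1)[unfolded is_biproduct_def] assms(2-)
  let ?h = "Comp C V X B i a \<otimes>\<^bsub>Hom C V B\<^esub> Comp C V Y B j b"
  show "?h \<in> homs C V B" using o by simp
  show "Comp C V B X p ?h = a" "Comp C V B Y q ?h = b"
    using o by (simp_all add: comp_add_right flip: comp_assoc)
qed

lemma biproduct_eqI:
  assumes "is_biproduct C X Y B i j p q" "X \<in> Obj C" "Y \<in> Obj C" "V \<in> Obj C"
    and "g \<in> homs C V B" "h \<in> homs C V B"
    and "Comp C V B X p g = Comp C V B X p h" "Comp C V B Y q g = Comp C V B Y q h"
  shows "g = h"
proof -
  note o = assms(1)[unfolded is_biproduct_def] assms(2-6)
  then have B: "B \<in> Obj C" "i \<in> homs C X B" "j \<in> homs C Y B" "p \<in> homs C B X" "q \<in> homs C B Y"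
    by auto
  \<comment> \<open>The relation \<open>i p + j q = 1\<close> rebuilds a morphism into
    \<open>B\<close> from its two components.\<close>
  have "k = Comp C V X B i (Comp C V B X p k) \<otimes>\<^bsub>Hom C V B\<^esub> Comp C V Y B j (Comp C V B Y q k)"
    if "k \<in> homs C V B" for k
  proof -
    have "k = Comp C V B B (Comp C B X B i p \<otimes>\<^bsub>Hom C B B\<^esub> Comp C B Y B j q) k"
      using o that by simp
    also have "\<dots> = Comp C V X B i (Comp C V B X p k) \<otimes>\<^bsub>Hom C V B\<^esub> Comp C V Y B j (Comp C V B Y q k)"
      using o(2-) that B by (simp add: comp_add_left comp_assoc)
    finally show ?thesis .
  qed
  from this[of g] this[of h] show ?thesis using assms by metis
qed

end

section \<open>Exact categories\<close>

context exact_category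
begin

section \<open>Permanence properties of inflations and deflations\<close>

lemma deflation_typed:
  assumes "deflation E Y Z p"
  shows "Y \<in> Obj E" "Z \<in> Obj E" "p \<in> homs E Y Z"
  using assms conf_kernel_cokernel unfolding deflation_def is_cokernel_def by blast+

lemma inflation_typed:
  assumes "inflation E X Y i"
  shows "X \<in> Obj E" "Y \<in> Obj E" "i \<in> homs E X Y"
  using assms conf_kernel_cokernel unfolding inflation_def is_kernel_def by blast+

lemma deflation_epic:
  assumes "deflation E Y Z p" "W \<in> Obj E" "g \<in> homs E Z W" "h \<in> homs E Z W"
    and "Comp E Y Z W g p = Comp E Y Z W h p"
  shows "g = h"
  using assms conf_kernel_cokernel cokernel_epic unfolding deflation_def by metis

lemma inflation_monic:
  assumes "inflation E X Y i" "W \<in> Obj E" "g \<in> homs E W X" "h \<in> homs E W X"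
    and "Comp E W X Y i g = Comp E W X Y i h"
  shows "g = h"
  using assms conf_kernel_cokernel kernel_monic unfolding inflation_def by metis

text \<open>The kernel object stays fixed and its inflation becomes \<open>b i\<close>; this
  provides the remaining square that \<open>conf_iso\<close> asks for.\<close>

lemma deflation_iso:
  assumes "deflation E Y Z p" "is_iso E Y Y' b" "is_iso E Z Z' c" "p' \<in> homs E Y' Z'"
    and "Comp E Y Y' Z' p' b = Comp E Y Z Z' c p"
  shows "deflation E Y' Z' p'"
proof -
  from assms(1) obtain X i where c: "Conf E X i Y p Z" unfolding deflation_def by blast
  have "X \<in> Obj E" "Y \<in> Obj E" "Y' \<in> Obj E" "i \<in> homs E X Y" "b \<in> homs E Y Y'"
    using conf_kernel_cokernel[OF c] assms(2) unfolding is_kernel_def is_iso_def by auto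
  then have "Conf E X (Comp E X Y Y' b i) Y' p' Z'"
    by (intro conf_iso[OF c is_iso_ident assms(2,3) _ assms(4) _ assms(5)]) auto
  then show ?thesis unfolding deflation_def by blast
qed

lemma inflation_iso:
  assumes "inflation E X Y i" "is_iso E X X' a" "is_iso E Y Y' b" "i' \<in> homs E X' Y'"
    and "Comp E X X' Y' i' a = Comp E X Y Y' b i"
  shows "inflation E X' Y' i'"
proof -
  from assms(1) obtain Z p where c: "Conf E X i Y p Z" unfolding inflation_def by blast
  have o: "Z \<in> Obj E" "Y \<in> Obj E" "Y' \<in> Obj E" "p \<in> homs E Y Z" "b \<in> homs E Y Y'"
    using conf_kernel_cokernel[OF c] assms(3) unfolding is_kernel_def is_iso_def by auto
  from assms(3) obtain b' where b: "b' \<in> homs E Y' Y" "Comp E Y Y' Y b' b = Ident E Y"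
    unfolding is_iso_def by blast
  have "Conf E X' i' Y' (Comp E Y' Y Z p b') Z"
    using o b
    by (intro conf_iso[OF c assms(2,3) is_iso_ident assms(4) _ assms(5)]) (simp_all add: comp_assoc)
  then show ?thesis unfolding inflation_def by blast
qed

text \<open>The axiom supplies one pullback with this property. Universality identifies any other
  pullback with it, and \<open>deflation_iso\<close> transports the property.\<close>

lemma deflation_of_pullback:
  assumes P: "is_pullback E P f' Y p' W p f Z" and "deflation E Y Z p"
  shows "deflation E P W p'"
proof -
  have o: "P \<in> Obj E" "Y \<in> Obj E" "W \<in> Obj E" "Z \<in> Obj E" "f' \<in> homs E P Y" "p' \<in> homs E P W"
    "p \<in> homs E Y Z" "f \<in> homs E W Z" "Comp E P Y Z p f' = Comp E P W Z f p'"
    using P unfolding is_pullback_def by auto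
  obtain R f1 p1 where R: "is_pullback E R f1 Y p1 W p f Z" and d: "deflation E R W p1"
    using deflation_pullback assms(2) o by metis
  have r: "R \<in> Obj E" "f1 \<in> homs E R Y" "p1 \<in> homs E R W" "Comp E R Y Z p f1 = Comp E R W Z f p1"
    using R unfolding is_pullback_def by auto
  obtain h where h: "h \<in> homs E R P" "Comp E R P Y f' h = f1" "Comp E R P W p' h = p1"
    by (rule pullback_factor[OF P, of R f1 p1]) (use r in auto)
  obtain k where k: "k \<in> homs E P R" "Comp E P R Y f1 k = f'" "Comp E P R W p1 k = p'"
    by (rule pullback_factor[OF R, of P f' p']) (use o in auto)
  have "Comp E P R P h k = Ident E P"
    by (rule pullback_eqI[OF P, of P]) (use o r h k in \<open>simp_all flip: comp_assoc\<close>)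
  moreover have "Comp E R P R k h = Ident E R"
    by (rule pullback_eqI[OF R, of R]) (use o r h k in \<open>simp_all flip: comp_assoc\<close>)
  ultimately have "is_iso E R P h" unfolding is_iso_def using o r h k by blast
  then show ?thesis
    using deflation_iso[OF d _ is_iso_ident] o r h by simp
qed

lemma inflation_of_pushout:
  assumes P: "is_pushout E X i Y f W f' i' P" and "inflation E X Y i"
  shows "inflation E W P i'"
proof -
  have o: "X \<in> Obj E" "Y \<in> Obj E" "W \<in> Obj E" "P \<in> Obj E" "i \<in> homs E X Y" "f \<in> homs E X W"
    "f' \<in> homs E Y P" "i' \<in> homs E W P" "Comp E X Y P f' i = Comp E X W P i' f"
    using P unfolding is_pushout_def by auto
  obtain R f1 i1 where R: "is_pushout E X i Y f W f1 i1 R" and d: "inflation E W R i1"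
    using inflation_pushout assms(2) o by metis
  have r: "R \<in> Obj E" "f1 \<in> homs E Y R" "i1 \<in> homs E W R" "Comp E X Y R f1 i = Comp E X W R i1 f"
    using R unfolding is_pushout_def by auto
  obtain h where h: "h \<in> homs E R P" "Comp E Y R P h f1 = f'" "Comp E W R P h i1 = i'"
    by (rule pushout_factor[OF R, of P f' i']) (use o in auto)
  obtain k where k: "k \<in> homs E P R" "Comp E Y P R k f' = f1" "Comp E W P R k i' = i1"
    by (rule pushout_factor[OF P, of R f1 i1]) (use r in auto)
  have "Comp E P R P h k = Ident E P"
    by (rule pushout_eqI[OF P, of P]) (use o r h k in \<open>simp_all add: comp_assoc\<close>)
  moreover have "Comp E R P R k h = Ident E R"
    by (rule pushout_eqI[OF R, of R]) (use o r h k in \<open>simp_all add: comp_assoc\<close>)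
  ultimately have "is_iso E R P h" unfolding is_iso_def using o r h k by blast
  then show ?thesis
    using inflation_iso[OF d is_iso_ident, of P h] o r h by simp
qed

text \<open>Kernels of \<open>p\<close> are unique up to isomorphism, and one of them is part of a
  conflation.\<close>

lemma inflation_of_kernel:
  assumes K: "is_kernel E X i Y p Z" and "deflation E Y Z p"
  shows "inflation E X Y i"
proof -
  obtain X1 i1 where c: "Conf E X1 i1 Y p Z" using assms(2) unfolding deflation_def by blast
  note K1 = conjunct1[OF conf_kernel_cokernel[OF c]]
  have o: "X \<in> Obj E" "X1 \<in> Obj E" "Y \<in> Obj E" "i \<in> homs E X Y" "i1 \<in> homs E X1 Y"
    "Comp E X1 Y Z p i1 = zero_mor E X1 Z" "Comp E X Y Z p i = zero_mor E X Z"
    using K K1 unfolding is_kernel_def by auto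
  obtain a where a: "a \<in> homs E X1 X" "Comp E X1 X Y i a = i1"
    using kernel_factor[OF K o(2,5,6)] by blast
  obtain b where b: "b \<in> homs E X X1" "Comp E X X1 Y i1 b = i"
    using kernel_factor[OF K1 o(1,4,7)] by blast
  have "Comp E X1 X X1 b a = Ident E X1"
    by (rule kernel_monic[OF K1, of X1]) (use o a b in \<open>simp_all flip: comp_assoc\<close>)
  moreover have "Comp E X X1 X a b = Ident E X"
    by (rule kernel_monic[OF K, of X]) (use o a b in \<open>simp_all flip: comp_assoc\<close>)
  ultimately have "is_iso E X1 X a" unfolding is_iso_def using o a b by blast
  moreover have "inflation E X1 Y i1" using c unfolding inflation_def by blast
  ultimately show ?thesis
    using inflation_iso[of X1 Y i1 X a Y "Ident E Y" i] o a is_iso_ident by simp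
qed

lemma deflation_of_cokernel:
  assumes K: "is_cokernel E X i Y p Z" and "inflation E X Y i"
  shows "deflation E Y Z p"
proof -
  obtain Z1 p1 where c: "Conf E X i Y p1 Z1" using assms(2) unfolding inflation_def by blast
  note K1 = conjunct2[OF conf_kernel_cokernel[OF c]]
  have o: "Z \<in> Obj E" "Z1 \<in> Obj E" "Y \<in> Obj E" "p \<in> homs E Y Z" "p1 \<in> homs E Y Z1"
    "Comp E X Y Z p i = zero_mor E X Z" "Comp E X Y Z1 p1 i = zero_mor E X Z1"
    using K K1 unfolding is_cokernel_def by auto
  obtain a where a: "a \<in> homs E Z1 Z" "Comp E Y Z1 Z a p1 = p"
    using cokernel_factor[OF K1 o(1,4,6)] by blast
  obtain b where b: "b \<in> homs E Z Z1" "Comp E Y Z Z1 b p = p1"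
    using cokernel_factor[OF K o(2,5,7)] by blast
  have "Comp E Z1 Z Z1 b a = Ident E Z1"
    by (rule cokernel_epic[OF K1, of Z1]) (use o a b in \<open>simp_all add: comp_assoc\<close>)
  moreover have "Comp E Z Z1 Z a b = Ident E Z"
    by (rule cokernel_epic[OF K, of Z]) (use o a b in \<open>simp_all add: comp_assoc\<close>)
  ultimately have "is_iso E Z1 Z a" unfolding is_iso_def using o a b by blast
  moreover have "deflation E Y Z1 p1" using c unfolding deflation_def by blast
  ultimately show ?thesis
    using deflation_iso[of Y Z1 p1 Y "Ident E Y" Z a p] o a is_iso_ident by simp
qed

text \<open>The identity of \<open>X\<close> is an inflation with cokernel \<open>X -> N\<close> and
  a deflation with kernel \<open>N -> X\<close>.\<close>

lemma ex_zero_object_conf: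
  assumes "X \<in> Obj E"
  obtains N where "is_zero_object E N" "deflation E X N (zero_mor E X N)" "inflation E N X (zero_mor E N X)"
proof -
  obtain N where N: "is_zero_object E N" using ex_zero_object by blast
  have NO: "N \<in> Obj E" using N unfolding is_zero_object_def by blast
  have "is_cokernel E X (Ident E X) X (zero_mor E X N) N"
    unfolding is_cokernel_def using assms NO zero_object_zero[OF N] by auto
  moreover have "is_kernel E N (zero_mor E N X) X (Ident E X) X"
    unfolding is_kernel_def using assms NO zero_object_zero[OF N] by auto
  ultimately show ?thesis
    using that N assms ident_inflation ident_deflation deflation_of_cokernel inflation_of_kernel by blast
qed

text \<open>
  The map \<open>(f, f s + q)\<close> on a biproduct \<open>X \<oplus> W\<close> factors as \<open>(x, w) \<mapsto> (x + s w, q w)\<close>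
  followed by \<open>(f, 1)\<close>, and these are pullbacks of \<open>q\<close> and of \<open>X \<rightarrow> 0\<close>.
\<close>

lemma deflation_copair:
  assumes q: "deflation E W Y q" and X: "X \<in> Obj E" and f: "f \<in> homs E X Y" and s: "s \<in> homs E W X"
    and B: "is_biproduct E X W B i j u v"
  shows "deflation E B Y (Comp E B X Y f u \<otimes>\<^bsub>Hom E B Y\<^esub>
      Comp E B W Y (Comp E W X Y f s \<otimes>\<^bsub>Hom E W Y\<^esub> q) v)"
proof -
  note t = deflation_typed[OF q] X f s B[unfolded is_biproduct_def]
  obtain B' i' j' u' v' where B': "is_biproduct E X Y B' i' j' u' v'"
    using ex_biproduct X t by blast
  note t' = B'[unfolded is_biproduct_def]
  let ?f1 = "Comp E B' X Y f u' \<otimes>\<^bsub>Hom E B' Y\<^esub> v'"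
  obtain N where N: "is_zero_object E N" and dN: "deflation E X N (zero_mor E X N)"
    using ex_zero_object_conf[OF X] .
  have NO: "N \<in> Obj E" using N unfolding is_zero_object_def by blast
  \<comment> \<open>The shear \<open>(x, y) -> (x, f x + y)\<close> is invertible, so
    \<open>B'\<close> is also a product of \<open>X\<close> and \<open>Y\<close> with projections
    \<open>u'\<close> and \<open>?f1\<close>. A product is a pullback over the zero object.\<close>
  have pb1: "is_pullback E B' u' X ?f1 Y (zero_mor E X N) (zero_mor E Y N) N"
    unfolding is_pullback_def
  proof (intro conjI ballI impI)
    fix V a b assume V: "V \<in> Obj E" "a \<in> homs E V X" "b \<in> homs E V Y"
    let ?c = "b \<otimes>\<^bsub>Hom E V Y\<^esub> inv\<^bsub>Hom E V Y\<^esub> Comp E V X Y f a"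
    obtain h where h: "h \<in> homs E V B'" "Comp E V B' X u' h = a" "Comp E V B' Y v' h = ?c"
      by (rule biproduct_pair[OF B', of V a ?c]) (use V t in auto)
    have c: "Comp E V B' Y ?f1 h = b"
    proof -
      interpret comm_group "Hom E V Y" using hom_group V t by simp
      show ?thesis using V t t' h by (simp add: comp_add_left comp_assoc m_comm[of _ ?c])
    qed
    show "\<exists>!h. h \<in> homs E V B' \<and> Comp E V B' X u' h = a \<and> Comp E V B' Y ?f1 h = b"
    proof (rule ex1I[of _ h])
      fix h' assume "h' \<in> homs E V B' \<and> Comp E V B' X u' h' = a \<and> Comp E V B' Y ?f1 h' = b"
      then have h': "h' \<in> homs E V B'" "Comp E V B' X u' h' = a" "Comp E V B' Y ?f1 h' = b" by auto
      interpret group "Hom E V Y" using V t by simp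
      have "Comp E V X Y f a \<otimes>\<^bsub>Hom E V Y\<^esub> Comp E V B' Y v' h' = Comp E V B' Y ?f1 h'"
        using V t t' h'(1,2) by (simp add: comp_add_left comp_assoc)
      also have "\<dots> = Comp E V B' Y ?f1 h" using h' c by simp
      also have "\<dots> = Comp E V X Y f a \<otimes>\<^bsub>Hom E V Y\<^esub> Comp E V B' Y v' h"
        using V t t' h(1,2) by (simp add: comp_add_left comp_assoc)
      finally have "Comp E V B' Y v' h' = Comp E V B' Y v' h" using V t t' h(1) h' by simp
      then show "h' = h" using biproduct_eqI[OF B'] V t h h' by metis
    qed (use h c in auto)
  qed (use t t' NO in auto)
  let ?a = "u \<otimes>\<^bsub>Hom E B X\<^esub> Comp E B W X s v" and ?b = "Comp E B W Y q v"
  obtain g where g: "g \<in> homs E B B'" "Comp E B B' X u' g = ?a" "Comp E B B' Y v' g = ?b"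
    by (rule biproduct_pair[OF B', of B ?a ?b]) (use t in auto)
  have pb2: "is_pullback E B v W g B' q v' Y"
    unfolding is_pullback_def
  proof (intro conjI ballI impI)
    fix V a b assume V: "V \<in> Obj E" "a \<in> homs E V W" "b \<in> homs E V B'"
      and e: "Comp E V W Y q a = Comp E V B' Y v' b"
    \<comment> \<open>The first component of \<open>g\<close> is \<open>u + s v\<close>; subtracting
      \<open>s a\<close> recovers \<open>u\<close>.\<close>
    let ?c = "Comp E V B' X u' b \<otimes>\<^bsub>Hom E V X\<^esub> inv\<^bsub>Hom E V X\<^esub> Comp E V W X s a"
    obtain h where h: "h \<in> homs E V B" "Comp E V B X u h = ?c" "Comp E V B W v h = a"
      by (rule biproduct_pair[OF B, of V ?c a]) (use V t t' in auto)
    have ug: "Comp E V B' X u' (Comp E V B B' g k) = Comp E V B X u k \<otimes>\<^bsub>Hom E V X\<^esub> Comp E V W X s (Comp E V B W v k)"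
      if "k \<in> homs E V B" for k
      using that V t t' g(1) by (simp add: comp_add_left g(2) flip: comp_assoc)
    have c: "Comp E V B B' g h = b"
    proof (rule biproduct_eqI[OF B'])
      show "Comp E V B' X u' (Comp E V B B' g h) = Comp E V B' X u' b"
        using V t t' h ug by simp
      have "Comp E V B' Y v' (Comp E V B B' g h) = Comp E V W Y q (Comp E V B W v h)"
        using V t t' g h(1) by (simp flip: comp_assoc)
      then show "Comp E V B' Y v' (Comp E V B B' g h) = Comp E V B' Y v' b"
        using e h by simp
    qed (use V t t' g h(1) in auto)
    show "\<exists>!h. h \<in> homs E V B \<and> Comp E V B W v h = a \<and> Comp E V B B' g h = b"
    proof (rule ex1I[of _ h])
      fix h' assume h': "h' \<in> homs E V B \<and> Comp E V B W v h' = a \<and> Comp E V B B' g h' = b"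
      interpret group "Hom E V X" using V t by simp
      have "Comp E V B X u h' \<otimes>\<^bsub>Hom E V X\<^esub> Comp E V W X s a
          = Comp E V B X u h \<otimes>\<^bsub>Hom E V X\<^esub> Comp E V W X s a"
        using ug[of h] ug[of h'] h(1,3) c h' by simp
      then have "Comp E V B X u h' = Comp E V B X u h" using V t h' h(1) by simp
      then show "h' = h" using biproduct_eqI[OF B] V t h h' by metis
    qed (use h c in auto)
  qed (use t t' g in auto)
  have "deflation E B Y (Comp E B B' Y ?f1 g)"
    using deflation_comp deflation_of_pullback[OF pb2 q] deflation_of_pullback[OF pb1 dN] by blast
  also have "Comp E B B' Y ?f1 g = Comp E B X Y f u \<otimes>\<^bsub>Hom E B Y\<^esub>
      Comp E B W Y (Comp E W X Y f s \<otimes>\<^bsub>Hom E W Y\<^esub> q) v"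
  proof -
    interpret comm_group "Hom E B Y" using hom_group t by simp
    show ?thesis using t t' g(1) 
      by (simp add: comp_add_left comp_add_right comp_assoc g(2,3) m_assoc)
  qed
  finally show ?thesis .
qed

text \<open>The dual of Quillen's obscure axiom.\<close>

lemma deflation_of_factor:
  assumes q: "deflation E W X (Comp E W C X b t)" and K: "is_kernel E D k C b X"
    and W: "W \<in> Obj E" and t: "t \<in> homs E W C"
  shows "deflation E C X b"
proof -
  let ?q = "Comp E W C X b t"
  have o: "D \<in> Obj E" "C \<in> Obj E" "X \<in> Obj E" "k \<in> homs E D C" "b \<in> homs E C X"
    "Comp E D C X b k = zero_mor E D X" using K unfolding is_kernel_def by auto
  note o = o W t
  obtain A i j u v where A: "is_biproduct E C W A i j u v" using ex_biproduct o by blast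
  obtain B i' j' u' v' where B: "is_biproduct E D W B i' j' u' v'" using ex_biproduct o by blast
  note a = A[unfolded is_biproduct_def] B[unfolded is_biproduct_def]
  then have aT: "A \<in> Obj E" "i \<in> homs E C A" "j \<in> homs E W A" "u \<in> homs E A C" "v \<in> homs E A W"
    by auto
  \<comment> \<open>Take \<open>s = -t\<close> in \<open>deflation_copair\<close>: the second
    component \<open>b s + b t\<close> vanishes, and what remains is \<open>b u\<close>.\<close>
  have bu: "deflation E A X (Comp E A C X b u)"
  proof -
    interpret group "Hom E W X" using o by simp
    have "Comp E W C X b (inv\<^bsub>Hom E W C\<^esub> t) \<otimes>\<^bsub>Hom E W X\<^esub> ?q = zero_mor E W X"
      using o by (simp add: comp_neg_right)
    then show ?thesis
      using deflation_copair[OF q, of C b "inv\<^bsub>Hom E W C\<^esub> t" A i j u v] o A a by simp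
  qed
  \<comment> \<open>\<open>g\<close> is the direct sum of \<open>k\<close> and the identity of
    \<open>W\<close>. It is a kernel of \<open>b u\<close>, because \<open>b u\<close> ignores the
    component in \<open>W\<close> and \<open>k\<close> is a kernel of \<open>b\<close>.\<close>
  obtain g where g: "g \<in> homs E B A" "Comp E B A C u g = Comp E B D C k u'" "Comp E B A W v g = v'"
    by (rule biproduct_pair[OF A, of B "Comp E B D C k u'" v']) (use a o in auto)
  have "is_kernel E B g A (Comp E A C X b u) X"
    unfolding is_kernel_def
  proof (intro conjI ballI impI)
    have "Comp E B A X (Comp E A C X b u) g = Comp E B C X b (Comp E B D C k u')"
      using o a g(1) by (simp add: comp_assoc g(2))
    also have "\<dots> = zero_mor E B X" using o a by (simp flip: comp_assoc)
    finally show "Comp E B A X (Comp E A C X b u) g = zero_mor E B X" .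
    fix V h assume V: "V \<in> Obj E" "h \<in> homs E V A"
      and z: "Comp E V A X (Comp E A C X b u) h = zero_mor E V X"
    obtain h1 where h1: "h1 \<in> homs E V D" "Comp E V D C k h1 = Comp E V A C u h"
      by (rule kernel_factor[OF K, of V "Comp E V A C u h"]) (use V z o a in \<open>auto simp: comp_assoc\<close>)
    obtain l where l: "l \<in> homs E V B" "Comp E V B D u' l = h1" "Comp E V B W v' l = Comp E V A W v h"
      by (rule biproduct_pair[OF B, of V h1 "Comp E V A W v h"]) (use V h1 a o in auto)
    have ug: "Comp E V A C u (Comp E V B A g m) = Comp E V D C k (Comp E V B D u' m)"
      and vg: "Comp E V A W v (Comp E V B A g m) = Comp E V B W v' m" if "m \<in> homs E V B" for m
      using that V o(1-5,7-) a g(1) by (simp_all add: g(2,3) comp_assoc flip: comp_assoc[of _ _ A])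
    have c: "Comp E V B A g l = h"
      by (rule biproduct_eqI[OF A]) (use V o a g(1) l h1 ug vg in auto)
    show "\<exists>!l. l \<in> homs E V B \<and> Comp E V B A g l = h"
    proof (rule ex1I[of _ l])
      fix l' assume l': "l' \<in> homs E V B \<and> Comp E V B A g l' = h"
      have "Comp E V B D u' l' = Comp E V B D u' l"
        by (rule kernel_monic[OF K]) (use V o a l' l(1) c ug[of l] ug[of l'] in auto)
      moreover have "Comp E V B W v' l' = Comp E V B W v' l"
        using l' l(1) c vg[of l] vg[of l'] by simp
      ultimately show "l' = l" using biproduct_eqI[OF B] V o l' l by metis
    qed (use l c in auto)
  qed (use o a g in auto)
  then have g_infl: "inflation E B A g" using inflation_of_kernel bu by blast
  have gi: "Comp E D B A g i' = Comp E D C A i k"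
    by (rule biproduct_eqI[OF A, of D])
      (use o a g(1) in \<open>simp_all add: g(2,3) comp_assoc flip: comp_assoc[of _ _ A]\<close>)
  have gj: "Comp E W B C (Comp E B A C u g) j' = zero_mor E W C"
    using o a g by (simp add: comp_assoc)
  \<comment> \<open>Collapsing the summand \<open>W\<close> in the source and target of
    \<open>g\<close> yields \<open>k\<close>. This square is a pushout, so \<open>k\<close> inherits
    from \<open>g\<close> that it is an inflation.\<close>
  have "is_pushout E B g A u' D u k C"
    unfolding is_pushout_def
  proof (intro conjI ballI impI)
    fix V x y assume V: "V \<in> Obj E" "x \<in> homs E A V" "y \<in> homs E D V"
      and e: "Comp E B A V x g = Comp E B D V y u'"
    let ?h = "Comp E C A V x i"
    have gj: "Comp E W B A g j' = j"
      by (rule biproduct_eqI[OF A, of W])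
        (use o a g(1) gj in \<open>simp_all add: g(3) flip: comp_assoc\<close>)
    \<comment> \<open>On the summand \<open>W\<close> the compatibility of \<open>x\<close> and
      \<open>y\<close> reads \<open>x j = x g j' = y u' j' = 0\<close>, so \<open>x\<close> is
      determined by its restriction \<open>x i\<close> to \<open>C\<close>.\<close>
    have "Comp E W A V x (Comp E W B A g j') = Comp E W D V y (Comp E W B D u' j')"
      using e o a V g(1) by (metis comp_assoc)
    then have xj: "Comp E W A V x j = zero_mor E W V" using gj o a V by simp
    have "Comp E D A V x (Comp E D B A g i') = Comp E D D V y (Comp E D B D u' i')"
      using e o a V g(1) by (metis comp_assoc)
    then have hk: "Comp E D C V ?h k = y" using gi o a V by (simp add: comp_assoc)
    have "x = Comp E A A V x (Comp E A C A i u \<otimes>\<^bsub>Hom E A A\<^esub> Comp E A W A j v)" using V o a by simp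
    also have "\<dots> = Comp E A C V ?h u \<otimes>\<^bsub>Hom E A V\<^esub> Comp E A W V (Comp E W A V x j) v"
      using V o aT by (simp add: comp_add_right comp_assoc)
    finally have hu: "Comp E A C V ?h u = x" using V o a xj by simp
    show "\<exists>!h. h \<in> homs E C V \<and> Comp E A C V h u = x \<and> Comp E D C V h k = y"
    proof (rule ex1I[of _ ?h])
      fix h' assume h': "h' \<in> homs E C V \<and> Comp E A C V h' u = x \<and> Comp E D C V h' k = y"
      then have "Comp E C A V x i = Comp E C C V h' (Comp E C A C u i)"
        using V o a by (metis comp_assoc)
      then show "h' = ?h" using V o a h' by simp
    qed (use V o a hu hk in auto)
  qed (use o a g in auto)
  then have k_infl: "inflation E D C k" using inflation_of_pushout g_infl by blast
  have "is_cokernel E D k C b X"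
    unfolding is_cokernel_def
  proof (intro conjI ballI impI)
    fix V h assume V: "V \<in> Obj E" "h \<in> homs E C V" and hk: "Comp E D C V h k = zero_mor E D V"
    obtain Y m where c: "Conf E Y m A (Comp E A C X b u) X" using bu unfolding deflation_def by blast
    note KC = conf_kernel_cokernel[OF c]
    have Y: "Y \<in> Obj E" "m \<in> homs E Y A" "Comp E Y A X (Comp E A C X b u) m = zero_mor E Y X"
      using KC unfolding is_kernel_def by auto
    \<comment> \<open>\<open>b\<close> kills \<open>u m\<close>, so \<open>u m\<close> factors
      through \<open>k\<close> and is killed by \<open>h\<close>. Thus \<open>h u\<close> factors
      through the deflation \<open>b u\<close>, and composing with \<open>i\<close> gives the
      factorization of \<open>h\<close> through \<open>b\<close>.\<close>
    obtain n where n: "n \<in> homs E Y D" "Comp E Y D C k n = Comp E Y A C u m"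
      by (rule kernel_factor[OF K, of Y "Comp E Y A C u m"]) (use Y o a in \<open>auto simp: comp_assoc\<close>)
    have "Comp E Y A V (Comp E A C V h u) m = Comp E Y D V (Comp E D C V h k) n"
      using V o a Y n by (simp add: comp_assoc del: hk)
    then have "Comp E Y A V (Comp E A C V h u) m = zero_mor E Y V" using hk V o Y n by simp
    then obtain h' where h': "h' \<in> homs E X V" "Comp E A X V h' (Comp E A C X b u) = Comp E A C V h u"
      using cokernel_factor[OF conjunct2[OF KC], of V "Comp E A C V h u"] V o a by auto
    have e: "Comp E C X V h' b = h"
    proof -
      have "Comp E C A V (Comp E A X V h' (Comp E A C X b u)) i = Comp E C A V (Comp E A C V h u) i"
        using h' by simp
      then show ?thesis using V o a h'(1) by (simp add: comp_assoc)
    qed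
    show "\<exists>!l. l \<in> homs E X V \<and> Comp E C X V l b = h"
    proof (rule ex1I[of _ h'])
      fix l assume l: "l \<in> homs E X V \<and> Comp E C X V l b = h"
      show "l = h'"
        by (rule deflation_epic[OF q, of V]) (use V o h' e l in \<open>auto simp flip: comp_assoc\<close>)
    qed (use h' e in auto)
  qed (use o in auto)
  then show ?thesis using k_infl deflation_of_cokernel by blast
qed

text \<open>If \<open>c\<close> is the cokernel of \<open>m\<close>, then \<open>n\<close> is a
  kernel of \<open>c q\<close>, a composite of two deflations.\<close>

lemma inflation_pullback:
  assumes P: "is_pullback E R n Q r I q m Y" and q: "deflation E Q Y q" and m: "inflation E I Y m"
  shows "inflation E R Q n"
proof -
  obtain c C where conf: "Conf E I m Y c C" using m unfolding inflation_def by blast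
  note K = conjunct1[OF conf_kernel_cokernel[OF conf]]
  have c: "deflation E Y C c" using conf unfolding deflation_def by blast
  note o = P[unfolded is_pullback_def] deflation_typed[OF c] 
  have cm: "Comp E I Y C c m = zero_mor E I C" using K unfolding is_kernel_def by blast
  have "is_kernel E R n Q (Comp E Q Y C c q) C"
    unfolding is_kernel_def
  proof (intro conjI ballI impI)
    have "Comp E R Q C (Comp E Q Y C c q) n = Comp E R I C (Comp E I Y C c m) r"
      using o by (auto simp add: comp_assoc simp del: cm)
    then show "Comp E R Q C (Comp E Q Y C c q) n = zero_mor E R C" using o cm by auto
    fix V g assume V: "V \<in> Obj E" "g \<in> homs E V Q"
      and z: "Comp E V Q C (Comp E Q Y C c q) g = zero_mor E V C"
    obtain l where l: "l \<in> homs E V I" "Comp E V I Y m l = Comp E V Q Y q g"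
      by (rule kernel_factor[OF K, of V "Comp E V Q Y q g"]) (use V z o in \<open>auto simp: comp_assoc\<close>)
    obtain h where h: "h \<in> homs E V R" "Comp E V R Q n h = g" "Comp E V R I r h = l"
      by (rule pullback_factor[OF P, of V g l]) (use V l in auto)
    show "\<exists>!h. h \<in> homs E V R \<and> Comp E V R Q n h = g"
    proof (rule ex1I[of _ h])
      fix h' assume h': "h' \<in> homs E V R \<and> Comp E V R Q n h' = g"
      have sq: "Comp E R Q Y q n = Comp E R I Y m r" using o by blast
      have ty: "R \<in> Obj E" "Q \<in> Obj E" "I \<in> Obj E" "Y \<in> Obj E" "n \<in> homs E R Q" "r \<in> homs E R I"
        "q \<in> homs E Q Y" "m \<in> homs E I Y" using o by auto
      have mk: "Comp E V I Y m (Comp E V R I r k) = Comp E V Q Y q (Comp E V R Q n k)"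
        if "k \<in> homs E V R" for k
        using ty that V by (simp add: comp_assoc[symmetric] sq)
      have "Comp E V R I r h' = Comp E V R I r h"
        by (rule kernel_monic[OF K, of V]) (use ty V h' h(1,2) mk in auto)
      then show "h' = h" using pullback_eqI[OF P] V h' h by metis
    qed (use h in auto)
  qed (use o in auto)
  then show ?thesis using inflation_of_kernel deflation_comp[OF q c] by blast
qed

section \<open>Admissible morphisms\<close>

lemma admissible_typed:
  assumes "admissible E X Y f"
  shows "X \<in> Obj E" "Y \<in> Obj E" "f \<in> homs E X Y"
  using assms unfolding admissible_def by (auto dest: deflation_typed inflation_typed intro!: comp_closed[of X _ Y])

lemma admissible_deflation:
  assumes "deflation E X Y f"
  shows "admissible E X Y f"
  unfolding admissible_def
  using assms deflation_typed[OF assms] ident_inflation[of Y] by (metis comp_ident_left)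

lemma admissible_inflation:
  assumes "inflation E X Y f"
  shows "admissible E X Y f"
  unfolding admissible_def
  using assms inflation_typed[OF assms] ident_deflation[of X] by (metis comp_ident_right)

text \<open>The factorization runs through a zero object. Endomorphisms suffice: \<Upsilon>(X) is
  the cokernel of \<Upsilon>(0) for the zero morphism \<open>X -> X\<close>.\<close>

lemma admissible_zero:
  assumes "X \<in> Obj E"
  shows "admissible E X X (zero_mor E X X)"
proof -
  obtain N where N: "is_zero_object E N" "deflation E X N (zero_mor E X N)" "inflation E N X (zero_mor E N X)"
    using ex_zero_object_conf[OF assms] .
  moreover have "Comp E X N X (zero_mor E N X) (zero_mor E X N) = zero_mor E X X"
    using N assms unfolding is_zero_object_def by simp
  ultimately show ?thesis unfolding admissible_def by metis
qed

text \<open>Write \<open>f = m p\<close> and let \<open>c\<close> be the cokernel of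
  \<open>m\<close>. The endomorphism \<open>1 - f u\<close> kills \<open>m\<close>, hence equals
  \<open>n c\<close> for some \<open>n\<close>. Since \<open>c f = 0\<close>, it follows that
  \<open>c n c = c\<close>, and \<open>c\<close> is epic.\<close>

lemma admissible_regular_splits:
  assumes "admissible E X Y f" and u: "u \<in> homs E Y X"
    and fuf: "Comp E X Y Y (Comp E Y X Y f u) f = f"
  obtains C n c where "C \<in> Obj E" "n \<in> homs E C Y" "c \<in> homs E Y C" "Comp E C Y C c n = Ident E C"
    "Comp E Y C Y n c \<otimes>\<^bsub>Hom E Y Y\<^esub> Comp E Y X Y f u = Ident E Y"
    "Comp E X Y C c f = zero_mor E X C"
proof -
  obtain I p m where p: "deflation E X I p" and m: "inflation E I Y m" and f: "f = Comp E X I Y m p"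
    using assms(1) unfolding admissible_def by blast
  obtain c C where conf: "Conf E I m Y c C" using m unfolding inflation_def by blast
  note KC = conf_kernel_cokernel[OF conf]
  have c: "deflation E Y C c" using conf unfolding deflation_def by blast
  note o = deflation_typed[OF p] inflation_typed[OF m] deflation_typed[OF c] u
  have cm: "Comp E I Y C c m = zero_mor E I C" using KC unfolding is_kernel_def by blast
  let ?fu = "Comp E Y X Y f u"
  let ?e = "Ident E Y \<otimes>\<^bsub>Hom E Y Y\<^esub> inv\<^bsub>Hom E Y Y\<^esub> ?fu"
  \<comment> \<open>Cancel the epic \<open>p\<close> on the right in
    \<open>f u f = f\<close>.\<close>
  have fm: "Comp E I Y Y ?fu m = m"
    by (rule deflation_epic[OF p, of Y]) (use o fuf in \<open>auto simp: f comp_assoc\<close>)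
  have e: "?e \<in> homs E Y Y" "?e \<otimes>\<^bsub>Hom E Y Y\<^esub> ?fu = Ident E Y" using o f by simp_all
  have "Comp E I Y Y ?e m \<otimes>\<^bsub>Hom E I Y\<^esub> m = Comp E I Y Y (?e \<otimes>\<^bsub>Hom E Y Y\<^esub> ?fu) m"
    using o f fm e(1) by (simp add: comp_add_left del: diff_add)
  also have "\<dots> = zero_mor E I Y \<otimes>\<^bsub>Hom E I Y\<^esub> m" unfolding e(2) using o by simp
  finally have "Comp E I Y Y ?e m = zero_mor E I Y"
    using group.right_cancel[OF hom_grp[OF o(4,5)] o(6) _ zero_closed[OF o(4,5)]] o e(1)
    by (meson comp_closed)
  then obtain n where n: "n \<in> homs E C Y" "Comp E Y C Y n c = ?e"
    by (rule cokernel_factor[OF conjunct2[OF KC] o(5) e(1)])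
  have cf: "Comp E X Y C c f = zero_mor E X C"
    using o cm by (simp add: f flip: comp_assoc)
  have ft: "f \<in> homs E X Y" "?fu \<in> homs E Y Y" using o f by simp_all
  have "Comp E Y Y C c ?fu = zero_mor E Y C"
    using o(1,7-9) ft(1) u by (simp add: cf flip: comp_assoc)
  moreover have "c = Comp E Y Y C c (?e \<otimes>\<^bsub>Hom E Y Y\<^esub> ?fu)" using o(7-9) unfolding e(2) by simp
  moreover have "Comp E Y Y C c (?e \<otimes>\<^bsub>Hom E Y Y\<^esub> ?fu) = Comp E Y Y C c ?e \<otimes>\<^bsub>Hom E Y C\<^esub> Comp E Y Y C c ?fu"
    using o(7-9) e(1) ft(2) by (intro comp_add_right) auto
  ultimately have "Comp E Y Y C c ?e = c"
    using o(7-9) e(1) by simp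
  then have "Comp E Y C C (Comp E C Y C c n) c = Comp E Y C C (Ident E C) c"
    using o(7-9) n by (simp add: comp_assoc)
  then have "Comp E C Y C c n = Ident E C"
    using deflation_epic[OF c] o(7-9) n(1) by simp
  then show thesis using that[of C n c] o(7-9) n e(2) cf by simp
qed

text \<open>The last two hypotheses say that \<Upsilon>(A) -> \<Upsilon>(B) -> \<Upsilon>(C) ->
  \<Upsilon>(X) is exact, so \<open>z\<close> is a weak kernel of \<open>b\<close>. Dividing
  \<open>B\<close> by the inflation part of \<open>f\<close> removes the ambiguity:
  \<open>z = k c\<close> with \<open>c : B -> D\<close> the cokernel of \<open>m\<close>, and
  \<open>k\<close> is still a weak kernel but also monic.\<close>

lemma ex_kernel_of_presentation:
  assumes f: "admissible E A B f" and C: "C \<in> Obj E" and X: "X \<in> Obj E"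
    and z: "z \<in> homs E B C" and b: "b \<in> homs E C X"
    and ex_B: "\<And>Z g. \<lbrakk>Z \<in> Obj E; g \<in> homs E Z B\<rbrakk> \<Longrightarrow>
      Comp E Z B C z g = zero_mor E Z C \<longleftrightarrow> (\<exists>h\<in>homs E Z A. Comp E Z A B f h = g)"
    and ex_C: "\<And>Z g. \<lbrakk>Z \<in> Obj E; g \<in> homs E Z C\<rbrakk> \<Longrightarrow>
      Comp E Z C X b g = zero_mor E Z X \<longleftrightarrow> (\<exists>h\<in>homs E Z B. Comp E Z B C z h = g)"
  shows "\<exists>D k. is_kernel E D k C b X"
proof -
  obtain I p m where p: "deflation E A I p" and m: "inflation E I B m" and fmp: "f = Comp E A I B m p"
    using f unfolding admissible_def by blast
  obtain c D where conf: "Conf E I m B c D" using m unfolding inflation_def by blast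
  note KC = conf_kernel_cokernel[OF conf]
  have c: "deflation E B D c" using conf unfolding deflation_def by blast
  note o = deflation_typed[OF p] inflation_typed[OF m] deflation_typed[OF c] C X z b
  have cm: "Comp E I B D c m = zero_mor E I D" using KC unfolding is_kernel_def by blast
  have zf: "Comp E A B C z f = zero_mor E A C"
    by (rule iffD2[OF ex_B bexI[of _ "Ident E A"]]) (use admissible_typed[OF f] in auto)
  have "Comp E I B C z m = zero_mor E I C"
    by (rule deflation_epic[OF p, of C]) (use o zf in \<open>auto simp: fmp comp_assoc\<close>)
  then obtain k where k: "k \<in> homs E D C" "Comp E B D C k c = z"
    using cokernel_factor[OF conjunct2[OF KC], of C z] o by blast
  have bz: "Comp E B C X b z = zero_mor E B X"
    by (rule iffD2[OF ex_C bexI[of _ "Ident E B"]]) (use o in auto)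
  have bk: "Comp E D C X b k = zero_mor E D X"
    by (rule deflation_epic[OF c, of X]) (use o k bz in \<open>auto simp: comp_assoc\<close>)
  have cf: "Comp E A B D c f = zero_mor E A D"
    using o cm by (simp add: fmp flip: comp_assoc)
  \<comment> \<open>A morphism \<open>g\<close> into \<open>D\<close> need not lift along
    \<open>c\<close>, but it does after composition with the deflation \<open>c'\<close>. The lift
    \<open>g'\<close> is killed by \<open>z\<close>, so it factors through \<open>f\<close>, and
    \<open>c f = 0\<close> gives \<open>g c' = 0\<close>; finally \<open>c'\<close> is epic.\<close>
  have k_mono: "g = zero_mor E W D"
    if W: "W \<in> Obj E" "g \<in> homs E W D" "Comp E W D C k g = zero_mor E W C" for W g
  proof -
    obtain P g' c' where P: "is_pullback E P g' B c' W c g D" and c': "deflation E P W c'"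
      using deflation_pullback[OF c] W by blast
    have t: "P \<in> Obj E" "g' \<in> homs E P B" "c' \<in> homs E P W"
      and sq: "Comp E P B D c g' = Comp E P W D g c'"
      using P unfolding is_pullback_def by auto
    have "Comp E P B C z g' = Comp E P D C k (Comp E P B D c g')"
      unfolding k(2)[symmetric] using t o k(1) by (intro comp_assoc)
    also have "\<dots> = Comp E P W C (Comp E W D C k g) c'"
      unfolding sq using t o k(1) W by (intro comp_assoc[symmetric])
    also have "\<dots> = zero_mor E P C" using W t o by simp
    finally obtain h where h: "h \<in> homs E P A" "Comp E P A B f h = g'" using ex_B t by blast
    have "Comp E P W D g c' = Comp E P B D c (Comp E P A B f h)" using sq h by simp
    also have "\<dots> = Comp E P A D (Comp E A B D c f) h"
      using t o h(1) admissible_typed[OF f] by (intro comp_assoc[symmetric])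
    also have "\<dots> = Comp E P W D (zero_mor E W D) c'" using t o h W cf by simp
    finally show ?thesis using deflation_epic[OF c', of D] W o by auto
  qed
  have "is_kernel E D k C b X"
    unfolding is_kernel_def
  proof (intro conjI ballI impI)
    fix V g assume V: "V \<in> Obj E" "g \<in> homs E V C" "Comp E V C X b g = zero_mor E V X"
    then obtain h where h: "h \<in> homs E V B" "Comp E V B C z h = g" using ex_C by blast
    let ?h = "Comp E V B D c h"
    have h': "?h \<in> homs E V D" "Comp E V D C k ?h = g"
      using V h o k by (simp_all flip: comp_assoc)
    show "\<exists>!h. h \<in> homs E V D \<and> Comp E V D C k h = g"
    proof (rule ex1I[of _ ?h])
      fix l assume l: "l \<in> homs E V D \<and> Comp E V D C k l = g"
      show "l = ?h"
        by (rule monic_cancel[where i = k and X = D and Y = C and W = V]) (use k_mono V o k l h' in auto)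
    qed (use h' in auto)
  qed (use o k bk in auto)
  then show ?thesis by blast
qed

end

section \<open>Functors and presentations\<close>

context preadditive_category
begin

section \<open>Additive functors and natural transformations\<close>

context
  fixes F :: "('o, 'm, 'g) cfunctor"
  assumes F: "additive_functor C F"
begin

lemma functor_comm_group [simp]: "X \<in> Obj C \<Longrightarrow> comm_group (FObj F X)"
  using F unfolding additive_functor_def by blast

lemma functor_group [simp]: "X \<in> Obj C \<Longrightarrow> group (FObj F X)"
  using functor_comm_group unfolding comm_group_def by blast

lemma functor_hom:
  "\<lbrakk>X \<in> Obj C; Y \<in> Obj C; f \<in> homs C X Y\<rbrakk> \<Longrightarrow> FMor F X Y f \<in> hom (FObj F Y) (FObj F X)"
  using F unfolding additive_functor_def by blast

lemma functor_closed [simp]: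
  "\<lbrakk>X \<in> Obj C; Y \<in> Obj C; f \<in> homs C X Y; y \<in> carrier (FObj F Y)\<rbrakk>
    \<Longrightarrow> FMor F X Y f y \<in> carrier (FObj F X)"
  using hom_in_carrier[OF functor_hom] by simp

lemma functor_mult:
  "\<lbrakk>X \<in> Obj C; Y \<in> Obj C; f \<in> homs C X Y; y \<in> carrier (FObj F Y); z \<in> carrier (FObj F Y)\<rbrakk>
    \<Longrightarrow> FMor F X Y f (y \<otimes>\<^bsub>FObj F Y\<^esub> z) = FMor F X Y f y \<otimes>\<^bsub>FObj F X\<^esub> FMor F X Y f z"
  using hom_mult[OF functor_hom] by simp

lemma functor_one [simp]:
  "\<lbrakk>X \<in> Obj C; Y \<in> Obj C; f \<in> homs C X Y\<rbrakk> \<Longrightarrow> FMor F X Y f \<one>\<^bsub>FObj F Y\<^esub> = \<one>\<^bsub>FObj F X\<^esub>"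
  using hom_one[OF functor_hom] by simp

lemma functor_inv:
  assumes "X \<in> Obj C" "Y \<in> Obj C" "f \<in> homs C X Y" "y \<in> carrier (FObj F Y)"
  shows "FMor F X Y f (inv\<^bsub>FObj F Y\<^esub> y) = inv\<^bsub>FObj F X\<^esub> (FMor F X Y f y)"
proof -
  interpret group_hom "FObj F Y" "FObj F X" "FMor F X Y f"
    using assms functor_hom by (simp add: group_hom_def group_hom_axioms_def)
  show ?thesis using assms by simp
qed

lemma functor_ident [simp]:
  "\<lbrakk>X \<in> Obj C; x \<in> carrier (FObj F X)\<rbrakk> \<Longrightarrow> FMor F X X (Ident C X) x = x"
  using F unfolding additive_functor_def by blast

lemma functor_comp:
  "\<lbrakk>X \<in> Obj C; Y \<in> Obj C; Z \<in> Obj C; f \<in> homs C X Y; g \<in> homs C Y Z; x \<in> carrier (FObj F Z)\<rbrakk>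
    \<Longrightarrow> FMor F X Z (Comp C X Y Z g f) x = FMor F X Y f (FMor F Y Z g x)"
  using F unfolding additive_functor_def by blast

lemma functor_add:
  "\<lbrakk>X \<in> Obj C; Y \<in> Obj C; f \<in> homs C X Y; g \<in> homs C X Y; y \<in> carrier (FObj F Y)\<rbrakk>
    \<Longrightarrow> FMor F X Y (f \<otimes>\<^bsub>Hom C X Y\<^esub> g) y = FMor F X Y f y \<otimes>\<^bsub>FObj F X\<^esub> FMor F X Y g y"
  using F unfolding additive_functor_def by blast

text \<open>The map is the component at \<open>X\<close> of the transformation \<Upsilon>(Y) -> F
  that belongs to \<open>y\<close> under the Yoneda lemma. That it is a homomorphism yields the
  action of zero and negative morphisms.\<close>

lemma functor_element_hom:
  assumes "X \<in> Obj C" "Y \<in> Obj C" "y \<in> carrier (FObj F Y)"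
  shows "group_hom (Hom C X Y) (FObj F X) (\<lambda>g. FMor F X Y g y)"
  using assms functor_add by (simp add: group_hom_def group_hom_axioms_def hom_def)

lemma functor_zero [simp]:
  "\<lbrakk>X \<in> Obj C; Y \<in> Obj C; y \<in> carrier (FObj F Y)\<rbrakk>
    \<Longrightarrow> FMor F X Y (zero_mor C X Y) y = \<one>\<^bsub>FObj F X\<^esub>"
  using group_hom.hom_one[OF functor_element_hom] by simp

lemma functor_neg:
  "\<lbrakk>X \<in> Obj C; Y \<in> Obj C; f \<in> homs C X Y; y \<in> carrier (FObj F Y)\<rbrakk>
    \<Longrightarrow> FMor F X Y (inv\<^bsub>Hom C X Y\<^esub> f) y = inv\<^bsub>FObj F X\<^esub> (FMor F X Y f y)"
  using group_hom.hom_inv[OF functor_element_hom] by simp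

end

lemma nat_trans_hom:
  "\<lbrakk>\<alpha> \<in> nat_trans C F G; X \<in> Obj C\<rbrakk> \<Longrightarrow> \<alpha> X \<in> hom (FObj F X) (FObj G X)"
  unfolding nat_trans_def by blast

lemma nat_trans_closed:
  "\<lbrakk>\<alpha> \<in> nat_trans C F G; X \<in> Obj C; x \<in> carrier (FObj F X)\<rbrakk> \<Longrightarrow> \<alpha> X x \<in> carrier (FObj G X)"
  by (rule hom_in_carrier[OF nat_trans_hom])

lemma nat_trans_natural:
  "\<lbrakk>\<alpha> \<in> nat_trans C F G; X \<in> Obj C; Y \<in> Obj C; f \<in> homs C X Y; y \<in> carrier (FObj F Y)\<rbrakk>
    \<Longrightarrow> \<alpha> X (FMor F X Y f y) = FMor G X Y f (\<alpha> Y y)"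
  unfolding nat_trans_def by blast

lemma nat_trans_group_hom:
  assumes "\<alpha> \<in> nat_trans C F G" "additive_functor C F" "additive_functor C G" "X \<in> Obj C"
  shows "group_hom (FObj F X) (FObj G X) (\<alpha> X)"
  using assms by (simp add: group_hom_def group_hom_axioms_def nat_trans_hom)

lemma nat_trans_eqI:
  assumes "\<alpha> \<in> nat_trans C F G" "\<beta> \<in> nat_trans C F G"
    and "\<And>X x. \<lbrakk>X \<in> Obj C; x \<in> carrier (FObj F X)\<rbrakk> \<Longrightarrow> \<alpha> X x = \<beta> X x"
  shows "\<alpha> = \<beta>"
proof (rule PiE_ext)
  let ?P = "\<Pi>\<^sub>E X\<in>Obj C. hom (FObj F X) (FObj G X) \<inter> extensional (carrier (FObj F X))"
  show P: "\<alpha> \<in> ?P" "\<beta> \<in> ?P"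
    using assms(1,2) unfolding nat_trans_def by simp_all
  fix X assume X: "X \<in> Obj C"
  show "\<alpha> X = \<beta> X"
    using PiE_mem[OF P(1) X] PiE_mem[OF P(2) X] assms(3)[OF X]
    by (intro extensionalityI[where f = "\<alpha> X" and g = "\<beta> X" and A = "carrier (FObj F X)"]) auto
qed

text \<open>Members of \<open>nat_trans\<close> are extensional in the object and in the element;
  this truncation turns a transformation given by a formula into such a member.\<close>

definition restrict_components :: "('o, 'm, 'a) cfunctor \<Rightarrow> ('o \<Rightarrow> 'a \<Rightarrow> 'b) \<Rightarrow> 'o \<Rightarrow> 'a \<Rightarrow> 'b" where
  "restrict_components F \<alpha> = (\<lambda>X\<in>Obj C. \<lambda>x\<in>carrier (FObj F X). \<alpha> X x)"

lemma restrict_components_apply [simp]: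
  "\<lbrakk>X \<in> Obj C; x \<in> carrier (FObj F X)\<rbrakk> \<Longrightarrow> restrict_components F \<alpha> X x = \<alpha> X x"
  unfolding restrict_components_def by simp

lemma restrict_components_nat_trans:
  assumes "\<And>X x. \<lbrakk>X \<in> Obj C; x \<in> carrier (FObj F X)\<rbrakk> \<Longrightarrow> \<alpha> X x \<in> carrier (FObj G X)"
    and "\<And>X x y. \<lbrakk>X \<in> Obj C; x \<in> carrier (FObj F X); y \<in> carrier (FObj F X)\<rbrakk>
      \<Longrightarrow> \<alpha> X (x \<otimes>\<^bsub>FObj F X\<^esub> y) = \<alpha> X x \<otimes>\<^bsub>FObj G X\<^esub> \<alpha> X y"
    and "\<And>X Y f y. \<lbrakk>X \<in> Obj C; Y \<in> Obj C; f \<in> homs C X Y; y \<in> carrier (FObj F Y)\<rbrakk>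
      \<Longrightarrow> \<alpha> X (FMor F X Y f y) = FMor G X Y f (\<alpha> Y y)"
    and "\<And>X x y. \<lbrakk>X \<in> Obj C; x \<in> carrier (FObj F X); y \<in> carrier (FObj F X)\<rbrakk>
      \<Longrightarrow> x \<otimes>\<^bsub>FObj F X\<^esub> y \<in> carrier (FObj F X)"
    and "\<And>X Y f y. \<lbrakk>X \<in> Obj C; Y \<in> Obj C; f \<in> homs C X Y; y \<in> carrier (FObj F Y)\<rbrakk>
      \<Longrightarrow> FMor F X Y f y \<in> carrier (FObj F X)"
  shows "restrict_components F \<alpha> \<in> nat_trans C F G"
  using assms unfolding nat_trans_def restrict_components_def hom_def by auto

lemma functor_mult_closed:
  assumes "additive_functor C F" "X \<in> Obj C" "x \<in> carrier (FObj F X)" "y \<in> carrier (FObj F X)"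
  shows "x \<otimes>\<^bsub>FObj F X\<^esub> y \<in> carrier (FObj F X)"
  using functor_group[OF assms(1,2)] assms by (simp add: group_def monoid.m_closed)

lemma Comp_mod_category:
  "Comp (mod_category C) F G H \<beta> \<alpha> = restrict_components F (\<lambda>X x. \<beta> X (\<alpha> X x))"
  unfolding mod_category_def restrict_components_def by (simp add: compose_def)

lemma comp_nat_trans:
  assumes "additive_functor C F" "\<alpha> \<in> nat_trans C F G" "\<beta> \<in> nat_trans C G H"
  shows "restrict_components F (\<lambda>X x. \<beta> X (\<alpha> X x)) \<in> nat_trans C F H"
  using assms
  by (intro restrict_components_nat_trans)
    (auto simp: functor_mult_closed nat_trans_closed nat_trans_natural hom_mult[OF nat_trans_hom])

section \<open>Subfunctors and short exact sequences\<close>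

definition subfunctor :: "('o, 'm, 'g) cfunctor \<Rightarrow> ('o \<Rightarrow> 'g set) \<Rightarrow> bool" where
  "subfunctor F S \<longleftrightarrow> (\<forall>X\<in>Obj C. subgroup (S X) (FObj F X)) \<and>
     (\<forall>X\<in>Obj C. \<forall>Y\<in>Obj C. \<forall>f\<in>homs C X Y. FMor F X Y f ` S Y \<subseteq> S X)"

definition subfunctor_of :: "('o, 'm, 'g) cfunctor \<Rightarrow> ('o \<Rightarrow> 'g set) \<Rightarrow> ('o, 'm, 'g) cfunctor" where
  "subfunctor_of F S = \<lparr>FObj = (\<lambda>X. (FObj F X)\<lparr>carrier := S X\<rparr>), FMor = FMor F\<rparr>"

lemma subfunctor_of_simps [simp]:
  "carrier (FObj (subfunctor_of F S) X) = S X"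
  "mult (FObj (subfunctor_of F S) X) = mult (FObj F X)"
  "\<one>\<^bsub>FObj (subfunctor_of F S) X\<^esub> = \<one>\<^bsub>FObj F X\<^esub>"
  "FMor (subfunctor_of F S) = FMor F"
  unfolding subfunctor_of_def by simp_all

lemma subfunctor_subset: "\<lbrakk>subfunctor F S; X \<in> Obj C\<rbrakk> \<Longrightarrow> S X \<subseteq> carrier (FObj F X)"
  unfolding subfunctor_def by (blast dest: subgroup.subset)

lemma subfunctor_of_additive:
  assumes F: "additive_functor C F" and S: "subfunctor F S"
  shows "additive_functor C (subfunctor_of F S)"
proof -
  have sub: "x \<in> carrier (FObj F X)" if "X \<in> Obj C" "x \<in> S X" for X x
    using subfunctor_subset[OF S] that by blast
  have "comm_group (FObj (subfunctor_of F S) X)" if X: "X \<in> Obj C" for X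
  proof -
    interpret comm_group "FObj F X" using F X by simp
    have "group (FObj (subfunctor_of F S) X)"
      using S X subgroup.subgroup_is_group[OF _ is_group] unfolding subfunctor_def subfunctor_of_def
      by simp
    then show ?thesis by (rule group.group_comm_groupI) (use sub X m_comm in auto)
  qed
  moreover have "FMor F X Y f y \<in> S X"
    if "X \<in> Obj C" "Y \<in> Obj C" "f \<in> homs C X Y" "y \<in> S Y" for X Y f y
    using S that unfolding subfunctor_def by blast
  ultimately show ?thesis
    unfolding additive_functor_def subfunctor_of_simps hom_def
    by (intro conjI ballI CollectI funcsetI)
      (simp_all add: sub functor_mult[OF F] functor_add[OF F] functor_comp[OF F] functor_ident[OF F])
qed

text \<open>With the kernel realized as a subfunctor and its inclusion as left map, only the
  surjectivity of \<beta> and its kernel have to be checked.\<close>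

lemma short_exact_subfunctor:
  assumes F: "additive_functor C F" and H: "additive_functor C H"
    and S: "subfunctor F S" and \<beta>: "\<beta> \<in> nat_trans C F H"
    and "\<And>X. X \<in> Obj C \<Longrightarrow> \<beta> X ` carrier (FObj F X) = carrier (FObj H X)"
    and "\<And>X x. \<lbrakk>X \<in> Obj C; x \<in> carrier (FObj F X)\<rbrakk> \<Longrightarrow> \<beta> X x = \<one>\<^bsub>FObj H X\<^esub> \<longleftrightarrow> x \<in> S X"
  shows "short_exact C (subfunctor_of F S) (restrict_components (subfunctor_of F S) (\<lambda>X x. x)) F \<beta> H"
proof -
  note sub = subfunctor_subset[OF S]
  have "restrict_components (subfunctor_of F S) (\<lambda>X x. x) \<in> nat_trans C (subfunctor_of F S) F"
    using S sub unfolding subfunctor_def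
    by (intro restrict_components_nat_trans) (auto simp: subgroup.m_closed image_subset_iff)
  moreover have "kernel (FObj F X) (FObj H X) (\<beta> X) = S X" if "X \<in> Obj C" for X
    using assms(6)[OF that] sub[OF that] unfolding kernel_def by blast
  moreover have "restrict_components (subfunctor_of F S) (\<lambda>X x. x) X ` S X = S X"
    "inj_on (restrict_components (subfunctor_of F S) (\<lambda>X x. x) X) (S X)" if "X \<in> Obj C" for X
    using that by (simp_all add: inj_on_def)
  ultimately show ?thesis
    using assms subfunctor_of_additive[OF F S] unfolding short_exact_def by simp
qed

lemma kernel_subfunctor:
  assumes F: "additive_functor C F" and H: "additive_functor C H" and \<beta>: "\<beta> \<in> nat_trans C F H"
  shows "subfunctor F (\<lambda>X. kernel (FObj F X) (FObj H X) (\<beta> X))"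
  using assms group_hom.subgroup_kernel[OF nat_trans_group_hom[OF \<beta> F H]] nat_trans_natural[OF \<beta>]
  unfolding subfunctor_def by (auto simp: kernel_def)

text \<open>This is the image of the transformation \<Upsilon>(Y) -> F that corresponds to
  \<open>y\<close>.\<close>

lemma generated_subfunctor:
  assumes F: "additive_functor C F" and Y: "Y \<in> Obj C" and y: "y \<in> carrier (FObj F Y)"
  shows "subfunctor F (\<lambda>X. (\<lambda>g. FMor F X Y g y) ` homs C X Y)"
proof -
  have "subgroup ((\<lambda>g. FMor F X Y g y) ` homs C X Y) (FObj F X)" if "X \<in> Obj C" for X
    using group_hom.img_is_subgroup[OF functor_element_hom[OF F that Y y]] .
  moreover have "FMor F W X f (FMor F X Y g y) \<in> (\<lambda>g. FMor F W Y g y) ` homs C W Y"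
    if "W \<in> Obj C" "X \<in> Obj C" "f \<in> homs C W X" "g \<in> homs C X Y" for W X f g
    by (rule image_eqI[of _ _ "Comp C W X Y g f"]) (use that Y y in \<open>simp_all add: functor_comp[OF F]\<close>)
  ultimately show ?thesis unfolding subfunctor_def by blast
qed

text \<open>
  The exactness of \<open>\<Upsilon>(X) \<rightarrow> \<Upsilon>(Y) \<rightarrow> F \<rightarrow> 0\<close> in terms of the element \<open>y \<in> F(Y)\<close>
  that corresponds to the second map under the Yoneda lemma.
\<close>

definition presented :: "'o \<Rightarrow> 'o \<Rightarrow> 'm \<Rightarrow> 'g \<Rightarrow> ('o, 'm, 'g) cfunctor \<Rightarrow> bool" where
  "presented X Y f y F \<longleftrightarrow> y \<in> carrier (FObj F Y) \<and>
     (\<forall>Z\<in>Obj C. \<forall>z\<in>carrier (FObj F Z). \<exists>g\<in>homs C Z Y. FMor F Z Y g y = z) \<and>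
     (\<forall>Z\<in>Obj C. \<forall>g\<in>homs C Z Y.
        FMor F Z Y g y = \<one>\<^bsub>FObj F Z\<^esub> \<longleftrightarrow> (\<exists>h\<in>homs C Z X. Comp C Z X Y f h = g))"

section \<open>Presentations by a generating element\<close>

lemma presents_imp_presented:
  assumes F: "additive_functor C F" and Y: "Y \<in> Obj C" and \<pi>: "presents C X Y f \<pi> F"
  shows "presented X Y f (\<pi> Y (Ident C Y)) F"
proof -
  have nt: "\<pi> \<in> nat_trans C (yoneda C Y) F" using \<pi> unfolding presents_def by blast
  \<comment> \<open>The Yoneda lemma: naturality of \<pi> at \<open>g\<close>, evaluated at the
    identity of \<open>Y\<close>.\<close>
  have e: "\<pi> Z g = FMor F Z Y g (\<pi> Y (Ident C Y))" if "Z \<in> Obj C" "g \<in> homs C Z Y" for Z g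
    using nat_trans_natural[OF nt, of Z Y g "Ident C Y"] that Y by (simp add: yoneda_def)
  have "\<exists>g\<in>homs C Z Y. FMor F Z Y g (\<pi> Y (Ident C Y)) = z"
    if Z: "Z \<in> Obj C" and z: "z \<in> carrier (FObj F Z)" for Z z
  proof -
    have "z \<in> \<pi> Z ` homs C Z Y" using \<pi> Z z unfolding presents_def yoneda_def by simp
    then show ?thesis using e Z by auto
  qed
  moreover have "FMor F Z Y g (\<pi> Y (Ident C Y)) = \<one>\<^bsub>FObj F Z\<^esub> \<longleftrightarrow> (\<exists>h\<in>homs C Z X. Comp C Z X Y f h = g)"
    if Z: "Z \<in> Obj C" and g: "g \<in> homs C Z Y" for Z g
  proof -
    have "yoneda_mor C X Y f Z ` homs C Z X = kernel (Hom C Z Y) (FObj F Z) (\<pi> Z)"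
      using \<pi> Z unfolding presents_def yoneda_def by simp
    then have "Comp C Z X Y f ` homs C Z X = {g \<in> homs C Z Y. \<pi> Z g = \<one>\<^bsub>FObj F Z\<^esub>}"
      using Z unfolding kernel_def yoneda_mor_def by simp
    moreover have "(\<exists>h\<in>homs C Z X. Comp C Z X Y f h = g) \<longleftrightarrow> g \<in> Comp C Z X Y f ` homs C Z X" by blast
    ultimately show ?thesis using e[OF Z g] g by simp
  qed
  moreover have "\<pi> Y (Ident C Y) \<in> carrier (FObj F Y)"
    using nat_trans_closed[OF nt Y] Y by (simp add: yoneda_def)
  ultimately show ?thesis unfolding presented_def by blast
qed

lemma presented_imp_presents:
  assumes F: "additive_functor C F" and X: "X \<in> Obj C" and Y: "Y \<in> Obj C" and f: "f \<in> homs C X Y"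
    and y: "presented X Y f y F"
  shows "presents C X Y f (restrict_components (yoneda C Y) (\<lambda>Z g. FMor F Z Y g y)) F"
proof -
  have y1: "y \<in> carrier (FObj F Y)"
    and y2: "\<And>Z z. \<lbrakk>Z \<in> Obj C; z \<in> carrier (FObj F Z)\<rbrakk> \<Longrightarrow> \<exists>g\<in>homs C Z Y. FMor F Z Y g y = z"
    and y3: "\<And>Z g. \<lbrakk>Z \<in> Obj C; g \<in> homs C Z Y\<rbrakk> \<Longrightarrow>
        FMor F Z Y g y = \<one>\<^bsub>FObj F Z\<^esub> \<longleftrightarrow> (\<exists>h\<in>homs C Z X. Comp C Z X Y f h = g)"
    using y unfolding presented_def by auto
  let ?\<pi> = "restrict_components (yoneda C Y) (\<lambda>Z g. FMor F Z Y g y)"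
  have nt: "?\<pi> \<in> nat_trans C (yoneda C Y) F"
    by (rule restrict_components_nat_trans) (use Y y1 F in
      \<open>auto simp: yoneda_def functor_add[OF F] functor_comp[OF F]\<close>)
  have app: "?\<pi> Z g = FMor F Z Y g y" if "Z \<in> Obj C" "g \<in> homs C Z Y" for Z g
    using that by (simp add: yoneda_def)
  have "Comp C Z X Y f ` homs C Z X = {g \<in> homs C Z Y. FMor F Z Y g y = \<one>\<^bsub>FObj F Z\<^esub>}"
    if Z: "Z \<in> Obj C" for Z
    using y3[OF Z] X Y Z f by (auto simp: image_iff)
  then have "yoneda_mor C X Y f Z ` homs C Z X = kernel (Hom C Z Y) (FObj F Z) (?\<pi> Z)"
    if Z: "Z \<in> Obj C" for Z
    using that app[OF Z] by (auto simp: yoneda_mor_def kernel_def)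
  moreover have "?\<pi> Z ` homs C Z Y = carrier (FObj F Z)" if Z: "Z \<in> Obj C" for Z
  proof -
    have "FMor F Z Y g y \<in> carrier (FObj F Z)" if "g \<in> homs C Z Y" for g using that y1 Y Z F by simp
    then show ?thesis using y2[OF Z] app[OF Z] by (fastforce simp: image_iff)
  qed
  ultimately show ?thesis using nt unfolding presents_def by (simp add: yoneda_def)
qed

lemma presented_transport:
  assumes F: "additive_functor C F" and G: "additive_functor C G" and Y: "Y \<in> Obj C"
    and y: "presented X Y f y F" and \<alpha>: "\<alpha> \<in> nat_trans C F G"
    and bij: "\<And>Z. Z \<in> Obj C \<Longrightarrow> bij_betw (\<alpha> Z) (carrier (FObj F Z)) (carrier (FObj G Z))"
  shows "presented X Y f (\<alpha> Y y) G"
proof -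
  have y1: "y \<in> carrier (FObj F Y)" using y unfolding presented_def by blast
  have e: "FMor G Z Y g (\<alpha> Y y) = \<alpha> Z (FMor F Z Y g y)" if "Z \<in> Obj C" "g \<in> homs C Z Y" for Z g
    using nat_trans_natural[OF \<alpha>] that Y y1 by simp
  have "\<exists>g\<in>homs C Z Y. FMor G Z Y g (\<alpha> Y y) = z" if Z: "Z \<in> Obj C" "z \<in> carrier (FObj G Z)" for Z z
  proof -
    obtain x where "x \<in> carrier (FObj F Z)" "z = \<alpha> Z x"
      using bij Z unfolding bij_betw_def by blast
    moreover then obtain g where "g \<in> homs C Z Y" "FMor F Z Y g y = x"
      using y Z unfolding presented_def by blast
    ultimately show ?thesis using e Z by auto
  qed
  moreover have "FMor G Z Y g (\<alpha> Y y) = \<one>\<^bsub>FObj G Z\<^esub> \<longleftrightarrow> (\<exists>h\<in>homs C Z X. Comp C Z X Y f h = g)"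
    if Z: "Z \<in> Obj C" "g \<in> homs C Z Y" for Z g
  proof -
    interpret group_hom "FObj F Z" "FObj G Z" "\<alpha> Z" by (rule nat_trans_group_hom[OF \<alpha> F G Z(1)])
    have "FMor F Z Y g y \<in> carrier (FObj F Z)" using F Y Z y1 by simp
    then have "\<alpha> Z (FMor F Z Y g y) = \<one>\<^bsub>FObj G Z\<^esub> \<longleftrightarrow> FMor F Z Y g y = \<one>\<^bsub>FObj F Z\<^esub>"
      using bij[OF Z(1)] unfolding bij_betw_def by (metis G.one_closed hom_one inj_on_eq_iff)
    then show ?thesis using y e Z unfolding presented_def by simp
  qed
  ultimately show ?thesis using nat_trans_closed[OF \<alpha> Y y1] unfolding presented_def by blast
qed

text \<open>The universal property of a cokernel in terms of elements: \<open>F\<close> is generated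
  by \<open>y\<close>, its relations are the morphisms factoring through \<open>f\<close>, and
  \<open>h\<close> satisfies them because \<open>f\<close> kills it. So
  \<open>F(g)(y) -> H(g)(h)\<close> is well defined.\<close>

lemma presented_nat_trans:
  assumes F: "additive_functor C F" and H: "additive_functor C H"
    and X: "X \<in> Obj C" and Y: "Y \<in> Obj C" and f: "f \<in> homs C X Y"
    and y: "presented X Y f y F" and h: "h \<in> carrier (FObj H Y)" "FMor H X Y f h = \<one>\<^bsub>FObj H X\<^esub>"
  obtains \<tau> where "\<tau> \<in> nat_trans C F H"
    "\<And>Z g. \<lbrakk>Z \<in> Obj C; g \<in> homs C Z Y\<rbrakk> \<Longrightarrow> \<tau> Z (FMor F Z Y g y) = FMor H Z Y g h"
proof -
  have y1: "y \<in> carrier (FObj F Y)"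
    and y2: "\<And>Z z. \<lbrakk>Z \<in> Obj C; z \<in> carrier (FObj F Z)\<rbrakk> \<Longrightarrow> \<exists>g\<in>homs C Z Y. FMor F Z Y g y = z"
    and y3: "\<And>Z g. \<lbrakk>Z \<in> Obj C; g \<in> homs C Z Y\<rbrakk> \<Longrightarrow>
        FMor F Z Y g y = \<one>\<^bsub>FObj F Z\<^esub> \<longleftrightarrow> (\<exists>h\<in>homs C Z X. Comp C Z X Y f h = g)"
    using y unfolding presented_def by auto
  have kill: "FMor H Z Y g h = \<one>\<^bsub>FObj H Z\<^esub>"
    if "Z \<in> Obj C" "g \<in> homs C Z Y" "FMor F Z Y g y = \<one>\<^bsub>FObj F Z\<^esub>" for Z g
    using that y3[of Z g] X Y f h functor_comp[OF H] functor_one[OF H] by auto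
  have wd: "FMor H Z Y g h = FMor H Z Y g' h"
    if Z: "Z \<in> Obj C" "g \<in> homs C Z Y" "g' \<in> homs C Z Y" and e: "FMor F Z Y g y = FMor F Z Y g' y"
    for Z g g'
  proof -
    interpret FZ: group "FObj F Z" using F Z by simp
    interpret HZ: group "FObj H Z" using H Z by simp
    let ?d = "g \<otimes>\<^bsub>Hom C Z Y\<^esub> inv\<^bsub>Hom C Z Y\<^esub> g'"
    have "FMor F Z Y ?d y = \<one>\<^bsub>FObj F Z\<^esub>"
      using Z Y y1 e F by (simp add: functor_add[OF F] functor_neg[OF F])
    then have "FMor H Z Y ?d h = \<one>\<^bsub>FObj H Z\<^esub>" using kill Z Y by simp
    then have "FMor H Z Y g h \<otimes>\<^bsub>FObj H Z\<^esub> inv\<^bsub>FObj H Z\<^esub> (FMor H Z Y g' h) = \<one>\<^bsub>FObj H Z\<^esub>"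
      using Z Y h by (simp add: functor_add[OF H] functor_neg[OF H])
    then show ?thesis
      using Z Y h H HZ.inv_equality[of "FMor H Z Y g h" "inv\<^bsub>FObj H Z\<^esub> (FMor H Z Y g' h)"] by simp
  qed
  \<comment> \<open>An arbitrary way of writing \<open>z\<close> as \<open>F(g)(y)\<close>; by
    \<open>wd\<close> the result does not depend on it, and this is what gives additivity and
    naturality.\<close>
  define pick where "pick Z z = (SOME g. g \<in> homs C Z Y \<and> FMor F Z Y g y = z)" for Z z
  have pick: "pick Z z \<in> homs C Z Y" "FMor F Z Y (pick Z z) y = z"
    if "Z \<in> Obj C" "z \<in> carrier (FObj F Z)" for Z z
    using someI_ex[of "\<lambda>g. g \<in> homs C Z Y \<and> FMor F Z Y g y = z"] y2[OF that]
    unfolding pick_def by blast+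
  let ?\<tau> = "\<lambda>Z z. FMor H Z Y (pick Z z) h"
  have app: "?\<tau> Z (FMor F Z Y g y) = FMor H Z Y g h" if "Z \<in> Obj C" "g \<in> homs C Z Y" for Z g
    using that pick[of Z "FMor F Z Y g y"] Y y1 F by (intro wd) auto
  have "restrict_components F ?\<tau> \<in> nat_trans C F H"
  proof (rule restrict_components_nat_trans)
    fix Z x z assume Z: "Z \<in> Obj C" "x \<in> carrier (FObj F Z)" "z \<in> carrier (FObj F Z)"
    let ?s = "pick Z x \<otimes>\<^bsub>Hom C Z Y\<^esub> pick Z z"
    have "x \<otimes>\<^bsub>FObj F Z\<^esub> z = FMor F Z Y ?s y"
      using pick Z Y y1 by (simp add: functor_add[OF F])
    then have "?\<tau> Z (x \<otimes>\<^bsub>FObj F Z\<^esub> z) = FMor H Z Y ?s h" using app pick Z Y by simp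
    then show "?\<tau> Z (x \<otimes>\<^bsub>FObj F Z\<^esub> z) = ?\<tau> Z x \<otimes>\<^bsub>FObj H Z\<^esub> ?\<tau> Z z"
      using pick Z Y h by (simp add: functor_add[OF H])
  next
    fix W Z k z assume Z: "W \<in> Obj C" "Z \<in> Obj C" "k \<in> homs C W Z" "z \<in> carrier (FObj F Z)"
    let ?s = "Comp C W Z Y (pick Z z) k"
    have "FMor F W Z k z = FMor F W Y ?s y"
      using pick Z Y y1 by (simp add: functor_comp[OF F])
    then have "?\<tau> W (FMor F W Z k z) = FMor H W Y ?s h" using app pick Z Y by simp
    then show "?\<tau> W (FMor F W Z k z) = FMor H W Z k (?\<tau> Z z)"
      using pick Z Y h by (simp add: functor_comp[OF H])
  qed (use pick Y h F H in \<open>auto simp: functor_mult_closed\<close>)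
  moreover have "restrict_components F ?\<tau> Z (FMor F Z Y g y) = FMor H Z Y g h"
    if "Z \<in> Obj C" "g \<in> homs C Z Y" for Z g
    using that app F Y y1 by simp
  ultimately show thesis using that by blast
qed

text \<open>The element \<open>y\<close> generates \<open>F\<close>, so by naturality its image
  decides everything.\<close>

lemma presented_nat_trans_eqI:
  assumes F: "additive_functor C F" and Y: "Y \<in> Obj C"
    and y: "presented X Y f y F" and "\<sigma> \<in> nat_trans C F H" "\<tau> \<in> nat_trans C F H" "\<sigma> Y y = \<tau> Y y"
  shows "\<sigma> = \<tau>"
proof (rule nat_trans_eqI)
  fix Z z assume Z: "Z \<in> Obj C" "z \<in> carrier (FObj F Z)"
  have y1: "y \<in> carrier (FObj F Y)" using y unfolding presented_def by blast
  obtain g where g: "g \<in> homs C Z Y" "FMor F Z Y g y = z" using y Z unfolding presented_def by blast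
  have "\<sigma> Z z = FMor H Z Y g (\<sigma> Y y)"
    unfolding g(2)[symmetric] by (rule nat_trans_natural[OF assms(4) Z(1) Y g(1) y1])
  moreover have "\<tau> Z z = FMor H Z Y g (\<tau> Y y)"
    unfolding g(2)[symmetric] by (rule nat_trans_natural[OF assms(5) Z(1) Y g(1) y1])
  ultimately show "\<sigma> Z z = \<tau> Z z" using assms(6) by simp
qed (use assms in auto)

text \<open>Cosets are sets over \<open>'a\<close> and need not embed into \<open>'b\<close>; each
  coset is therefore encoded by the \<iota>-image of a chosen member. Two types are kept so that the
  lemma serves both for quotients of representable functors, with values moved from
  \<open>'m\<close> to \<open>'g\<close>, and for quotients inside \<open>'g\<close>, with the
  identity as \<iota>.\<close>

lemma ex_quotient_functor:
  fixes F :: "('o, 'm, 'a) cfunctor" and \<iota> :: "'a \<Rightarrow> 'b"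
  assumes F: "additive_functor C F" and S: "subfunctor F S" and \<iota>: "inj \<iota>"
  obtains G :: "('o, 'm, 'b) cfunctor" and \<pi> where
    "additive_functor C G" "\<pi> \<in> nat_trans C F G"
    "\<And>X. X \<in> Obj C \<Longrightarrow> \<pi> X ` carrier (FObj F X) = carrier (FObj G X)"
    "\<And>X x. \<lbrakk>X \<in> Obj C; x \<in> carrier (FObj F X)\<rbrakk> \<Longrightarrow> \<pi> X x = \<one>\<^bsub>FObj G X\<^esub> \<longleftrightarrow> x \<in> S X"
proof -
  define eqv where "eqv X x y \<longleftrightarrow> y \<in> carrier (FObj F X) \<and> x \<otimes>\<^bsub>FObj F X\<^esub> inv\<^bsub>FObj F X\<^esub> y \<in> S X" for X x y
  \<comment> \<open>Members of one coset have the same predicate \<open>eqv X x\<close>, so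
    \<open>SOME\<close> picks the same element for all of them.\<close>
  define rep where "rep X x = \<iota> (SOME y. eqv X x y)" for X x
  \<comment> \<open>A section of \<open>rep\<close>; the operations of \<open>G\<close> are those of
    \<open>F\<close> applied to lifts.\<close>
  define \<sigma> where "\<sigma> X = inv_into (carrier (FObj F X)) (rep X)" for X
  define G :: "('o, 'm, 'b) cfunctor" where "G = \<lparr>
     FObj = (\<lambda>X. \<lparr>carrier = rep X ` carrier (FObj F X),
       mult = (\<lambda>a b. rep X (\<sigma> X a \<otimes>\<^bsub>FObj F X\<^esub> \<sigma> X b)), one = rep X \<one>\<^bsub>FObj F X\<^esub>\<rparr>),
     FMor = (\<lambda>X Y f a. rep X (FMor F X Y f (\<sigma> Y a)))\<rparr>"
  have rep_eq: "rep X x = rep X y \<longleftrightarrow> x \<otimes>\<^bsub>FObj F X\<^esub> inv\<^bsub>FObj F X\<^esub> y \<in> S X"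
    if X: "X \<in> Obj C" and x: "x \<in> carrier (FObj F X)" and y: "y \<in> carrier (FObj F X)" for X x y
  proof -
    interpret comm_group "FObj F X" using F X by simp
    interpret S: subgroup "S X" "FObj F X" using S X unfolding subfunctor_def by blast
    have sym: "b \<otimes>\<^bsub>FObj F X\<^esub> inv\<^bsub>FObj F X\<^esub> a \<in> S X"
      if "a \<otimes>\<^bsub>FObj F X\<^esub> inv\<^bsub>FObj F X\<^esub> b \<in> S X" "a \<in> carrier (FObj F X)" "b \<in> carrier (FObj F X)" for a b
      using S.m_inv_closed[OF that(1)] that(2,3) by (simp add: inv_mult_group)
    have trans: "a \<otimes>\<^bsub>FObj F X\<^esub> inv\<^bsub>FObj F X\<^esub> c \<in> S X"
      if "a \<otimes>\<^bsub>FObj F X\<^esub> inv\<^bsub>FObj F X\<^esub> b \<in> S X" "b \<otimes>\<^bsub>FObj F X\<^esub> inv\<^bsub>FObj F X\<^esub> c \<in> S X"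
        "a \<in> carrier (FObj F X)" "b \<in> carrier (FObj F X)" "c \<in> carrier (FObj F X)" for a b c
    proof -
      have "a \<otimes>\<^bsub>FObj F X\<^esub> inv\<^bsub>FObj F X\<^esub> c = (a \<otimes>\<^bsub>FObj F X\<^esub> inv\<^bsub>FObj F X\<^esub> b) \<otimes>\<^bsub>FObj F X\<^esub> (b \<otimes>\<^bsub>FObj F X\<^esub> inv\<^bsub>FObj F X\<^esub> c)"
        using that(3-5) by (simp add: m_assoc inv_solve_left)
      then show ?thesis using S.m_closed[OF that(1,2)] by simp
    qed
    have ex: "eqv X a (SOME b. eqv X a b)" if "a \<in> carrier (FObj F X)" for a
      by (rule someI[of _ a]) (use that in \<open>simp add: eqv_def\<close>)
    show ?thesis
    proof
      assume "rep X x = rep X y"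
      then have e: "(SOME b. eqv X x b) = (SOME b. eqv X y b)"
        using \<iota> unfolding rep_def by (simp add: inj_eq)
      define y' where "y' = (SOME b. eqv X y b)"
      have "eqv X x y'" "eqv X y y'" using ex[OF x] ex[OF y] unfolding e y'_def by simp_all
      then show "x \<otimes>\<^bsub>FObj F X\<^esub> inv\<^bsub>FObj F X\<^esub> y \<in> S X"
        using trans[OF _ sym[of y y'] x _ y] y unfolding eqv_def by simp
    next
      assume xy: "x \<otimes>\<^bsub>FObj F X\<^esub> inv\<^bsub>FObj F X\<^esub> y \<in> S X"
      have "eqv X x b \<longleftrightarrow> eqv X y b" for b
        unfolding eqv_def using trans[OF xy _ x y, of b] trans[OF sym[OF xy x y] _ y x, of b] by blast
      then have "eqv X x = eqv X y" by blast
      then show "rep X x = rep X y" unfolding rep_def by simp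
    qed
  qed
  have \<sigma>: "\<sigma> X (rep X x) \<in> carrier (FObj F X)" "rep X (\<sigma> X (rep X x)) = rep X x"
    if "x \<in> carrier (FObj F X)" for X x
    using that unfolding \<sigma>_def by (auto intro: inv_into_into f_inv_into_f)
  have rep_mult: "rep X (a \<otimes>\<^bsub>FObj F X\<^esub> b) = rep X (x \<otimes>\<^bsub>FObj F X\<^esub> y)"
    if X: "X \<in> Obj C" and c: "x \<in> carrier (FObj F X)" "y \<in> carrier (FObj F X)"
      "a \<in> carrier (FObj F X)" "b \<in> carrier (FObj F X)"
      and e: "rep X a = rep X x" "rep X b = rep X y" for X x y a b
  proof -
    interpret comm_group "FObj F X" using F X by simp
    interpret S: subgroup "S X" "FObj F X" using S X unfolding subfunctor_def by blast
    have "(a \<otimes>\<^bsub>FObj F X\<^esub> inv\<^bsub>FObj F X\<^esub> x) \<otimes>\<^bsub>FObj F X\<^esub> (b \<otimes>\<^bsub>FObj F X\<^esub> inv\<^bsub>FObj F X\<^esub> y) \<in> S X"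
      using e rep_eq X c by (simp add: S.m_closed[of "a \<otimes>\<^bsub>FObj F X\<^esub> inv\<^bsub>FObj F X\<^esub> x" "b \<otimes>\<^bsub>FObj F X\<^esub> inv\<^bsub>FObj F X\<^esub> y"])
    moreover have "(a \<otimes>\<^bsub>FObj F X\<^esub> b) \<otimes>\<^bsub>FObj F X\<^esub> inv\<^bsub>FObj F X\<^esub> (x \<otimes>\<^bsub>FObj F X\<^esub> y)
        = (a \<otimes>\<^bsub>FObj F X\<^esub> inv\<^bsub>FObj F X\<^esub> x) \<otimes>\<^bsub>FObj F X\<^esub> (b \<otimes>\<^bsub>FObj F X\<^esub> inv\<^bsub>FObj F X\<^esub> y)"
      using c by (simp add: inv_mult m_ac)
    ultimately show ?thesis using rep_eq X c by simp
  qed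
  have mult_G: "rep X x \<otimes>\<^bsub>FObj G X\<^esub> rep X y = rep X (x \<otimes>\<^bsub>FObj F X\<^esub> y)"
    if "X \<in> Obj C" "x \<in> carrier (FObj F X)" "y \<in> carrier (FObj F X)" for X x y
    using that \<sigma> rep_mult[of X x y "\<sigma> X (rep X x)" "\<sigma> X (rep X y)"] by (simp add: G_def)
  have FMor_G: "FMor G X Y f (rep Y y) = rep X (FMor F X Y f y)"
    if t: "X \<in> Obj C" "Y \<in> Obj C" "f \<in> homs C X Y" "y \<in> carrier (FObj F Y)" for X Y f y
  proof -
    let ?y = "\<sigma> Y (rep Y y)"
    interpret FY: group "FObj F Y" using F t by simp
    have "?y \<otimes>\<^bsub>FObj F Y\<^esub> inv\<^bsub>FObj F Y\<^esub> y \<in> S Y"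
      using rep_eq[OF t(2) \<sigma>(1)[OF t(4)] t(4)] \<sigma>(2)[OF t(4)] by simp
    then have "FMor F X Y f (?y \<otimes>\<^bsub>FObj F Y\<^esub> inv\<^bsub>FObj F Y\<^esub> y) \<in> S X"
      using S t unfolding subfunctor_def by blast
    then have "rep X (FMor F X Y f ?y) = rep X (FMor F X Y f y)"
      using rep_eq[OF t(1), of "FMor F X Y f ?y" "FMor F X Y f y"] \<sigma>(1)[OF t(4)] t F
      by (simp add: functor_mult[OF F] functor_inv[OF F])
    then show ?thesis by (simp add: G_def)
  qed
  have G_carrier: "carrier (FObj G X) = rep X ` carrier (FObj F X)" for X by (simp add: G_def)
  have comm: "comm_group (FObj G X)" if X: "X \<in> Obj C" for X
  proof -
    interpret comm_group "FObj F X" using F X by simp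
    have "rep X \<in> hom (FObj F X) (FObj G X)" using mult_G X G_carrier unfolding hom_def by simp
    from hom_imp_img_comm_group[OF this] show ?thesis by (simp add: G_def)
  qed
  have "additive_functor C G"
    unfolding additive_functor_def hom_def G_carrier
    by (intro conjI ballI CollectI funcsetI; (elim imageE)?)
      (simp_all add: comm mult_G FMor_G F functor_mult_closed[OF F] functor_mult[OF F] functor_comp[OF F] functor_add[OF F])
  moreover have "restrict_components F rep \<in> nat_trans C F G"
    by (rule restrict_components_nat_trans)
      (simp_all add: G_carrier mult_G FMor_G F functor_mult_closed[OF F])
  moreover have "restrict_components F rep X ` carrier (FObj F X) = carrier (FObj G X)" if "X \<in> Obj C" for X
    using that by (simp add: G_carrier)
  moreover have "restrict_components F rep X x = \<one>\<^bsub>FObj G X\<^esub> \<longleftrightarrow> x \<in> S X"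
    if "X \<in> Obj C" "x \<in> carrier (FObj F X)" for X x
  proof -
    interpret group "FObj F X" using F that by simp
    show ?thesis using that rep_eq[of X x "\<one>\<^bsub>FObj F X\<^esub>"] by (simp add: G_def)
  qed
  ultimately show thesis using that by blast
qed

lemma yoneda_additive:
  assumes X: "X \<in> Obj C"
  shows "additive_functor C (yoneda C X)"
  unfolding additive_functor_def yoneda_def hom_def
  using X hom_group by (auto simp: comp_assoc comp_add_left comp_add_right)

text \<open>Divide \<Upsilon>(Y) by the image of \<Upsilon>(f). That image is the subfunctor
  generated by \<open>f\<close>, seen as an element of \<Upsilon>(Y) at \<open>X\<close>.\<close>

lemma ex_presented:
  fixes \<iota> :: "'m \<Rightarrow> 'g"
  assumes X: "X \<in> Obj C" and Y: "Y \<in> Obj C" and f: "f \<in> homs C X Y" and \<iota>: "inj \<iota>"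
  obtains F :: "('o, 'm, 'g) cfunctor" and y where "additive_functor C F" "presented X Y f y F"
proof -
  let ?S = "\<lambda>Z. (\<lambda>h. FMor (yoneda C Y) Z X h f) ` homs C Z X"
  have S: "subfunctor (yoneda C Y) ?S"
    by (rule generated_subfunctor[OF yoneda_additive[OF Y] X]) (use f in \<open>simp add: yoneda_def\<close>)
  obtain F :: "('o, 'm, 'g) cfunctor" and \<pi> where F: "additive_functor C F" and
    \<pi>: "\<pi> \<in> nat_trans C (yoneda C Y) F"
    "\<And>X. X \<in> Obj C \<Longrightarrow> \<pi> X ` carrier (FObj (yoneda C Y) X) = carrier (FObj F X)"
    "\<And>X x. \<lbrakk>X \<in> Obj C; x \<in> carrier (FObj (yoneda C Y) X)\<rbrakk> \<Longrightarrow> \<pi> X x = \<one>\<^bsub>FObj F X\<^esub> \<longleftrightarrow> x \<in> ?S X"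
    by (rule ex_quotient_functor[OF yoneda_additive[OF Y] S \<iota>]) (rule that; assumption)
  have "presents C X Y f \<pi> F"
    unfolding presents_def
  proof (intro conjI ballI)
    fix Z assume Z: "Z \<in> Obj C"
    show "\<pi> Z ` carrier (FObj (yoneda C Y) Z) = carrier (FObj F Z)" using \<pi>(2) Z .
    have "yoneda_mor C X Y f Z ` carrier (FObj (yoneda C X) Z) = ?S Z"
      using Z by (simp add: yoneda_mor_def yoneda_def)
    moreover have "?S Z \<subseteq> homs C Z Y" using X Y Z f by (auto simp: yoneda_def)
    ultimately show "yoneda_mor C X Y f Z ` carrier (FObj (yoneda C X) Z)
        = kernel (FObj (yoneda C Y) Z) (FObj F Z) (\<pi> Z)"
      using \<pi>(3)[OF Z] unfolding kernel_def by (auto simp: yoneda_def)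
  qed (use \<pi> in auto)
  then show thesis by (rule that[OF F presents_imp_presented[OF F Y]])
qed

end

section \<open>Admissibly presented and effaceable functors\<close>

context exact_category
begin

section \<open>Admissibly presented functors in terms of generators\<close>

lemma mod_adm_category_simps [simp]:
  "Obj (mod_adm_category E) = mod_adm E"
  "homs (mod_adm_category E) F G = nat_trans E F G"
  "Comp (mod_adm_category E) F G H \<beta> \<alpha> = restrict_components F (\<lambda>X x. \<beta> X (\<alpha> X x))"
  "Ident (mod_adm_category E) F = restrict_components F (\<lambda>X x. x)"
  "Conf (mod_adm_category E) F \<alpha> G \<beta> H \<longleftrightarrow>
    F \<in> mod_adm E \<and> G \<in> mod_adm E \<and> H \<in> mod_adm E \<and> short_exact E F \<alpha> G \<beta> H"
  unfolding mod_adm_category_def full_exact_subcategory_def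
  by (simp_all add: Comp_mod_category) (simp_all add: mod_category_def restrict_components_def)

lemma zero_mor_mod_adm:
  "zero_mor (mod_adm_category E) F G = restrict_components F (\<lambda>X x. \<one>\<^bsub>FObj G X\<^esub>)"
  unfolding mod_adm_category_def full_exact_subcategory_def mod_category_def restrict_components_def
  by simp

lemma homs_eq_zero_iff:
  assumes F: "additive_functor E F" and G: "additive_functor E G"
  shows "homs (mod_adm_category E) F G = {zero_mor (mod_adm_category E) F G} \<longleftrightarrow>
    (\<forall>\<alpha>\<in>nat_trans E F G. \<forall>X\<in>Obj E. \<forall>x\<in>carrier (FObj F X). \<alpha> X x = \<one>\<^bsub>FObj G X\<^esub>)"
    (is "?L \<longleftrightarrow> ?R")
proof
  assume L: ?L
  show ?R
  proof (intro ballI)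
    fix \<alpha> X x assume a: "\<alpha> \<in> nat_trans E F G" "X \<in> Obj E" "x \<in> carrier (FObj F X)"
    then have "\<alpha> = restrict_components F (\<lambda>X x. \<one>\<^bsub>FObj G X\<^esub>)" using L zero_mor_mod_adm by auto
    then show "\<alpha> X x = \<one>\<^bsub>FObj G X\<^esub>" using a by simp
  qed
next
  assume R: ?R
  have z: "restrict_components F (\<lambda>X x. \<one>\<^bsub>FObj G X\<^esub>) \<in> nat_trans E F G"
  proof (rule restrict_components_nat_trans)
    fix X assume X: "X \<in> Obj E"
    interpret group "FObj G X" using G X by simp
    show "\<one>\<^bsub>FObj G X\<^esub> \<in> carrier (FObj G X)" "\<one>\<^bsub>FObj G X\<^esub> = \<one>\<^bsub>FObj G X\<^esub> \<otimes>\<^bsub>FObj G X\<^esub> \<one>\<^bsub>FObj G X\<^esub>"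
      by simp_all
  qed (use F G in \<open>simp_all add: functor_mult_closed[OF F]\<close>)
  moreover have "\<alpha> = restrict_components F (\<lambda>X x. \<one>\<^bsub>FObj G X\<^esub>)" if "\<alpha> \<in> nat_trans E F G" for \<alpha>
    by (rule nat_trans_eqI[OF that z]) (use R that in simp)
  ultimately show ?L unfolding zero_mor_mod_adm mod_adm_category_simps by blast
qed

lemma mod_adm_iff:
  "F \<in> mod_adm E \<longleftrightarrow> additive_functor E F \<and> (\<exists>X Y f y. admissible E X Y f \<and> presented X Y f y F)"
proof -
  have "(\<exists>\<pi>. presents E X Y f \<pi> F) \<longleftrightarrow> (\<exists>y. presented X Y f y F)"
    if "additive_functor E F" "admissible E X Y f" for X Y f
    using presents_imp_presented[OF that(1)] presented_imp_presents[OF that(1)] admissible_typed[OF that(2)]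
    by blast
  then show ?thesis unfolding mod_adm_def mod_category_def by simp blast
qed

lemma eff_iff:
  "F \<in> eff E \<longleftrightarrow> additive_functor E F \<and> (\<exists>X Y f y. deflation E X Y f \<and> presented X Y f y F)"
proof -
  have "(\<exists>\<pi>. presents E X Y f \<pi> F) \<longleftrightarrow> (\<exists>y. presented X Y f y F)"
    if "additive_functor E F" "deflation E X Y f" for X Y f
    using presents_imp_presented[OF that(1)] presented_imp_presents[OF that(1)] deflation_typed[OF that(2)]
    by blast
  then show ?thesis unfolding eff_def mod_category_def by simp blast
qed

lemma eff_subset_mod_adm: "eff E \<subseteq> mod_adm E"
  unfolding subset_iff eff_iff mod_adm_iff using admissible_deflation by blast

lemma mod_adm_additive: "F \<in> mod_adm E \<Longrightarrow> additive_functor E F"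
  unfolding mod_adm_iff by blast

lemma presented_elim:
  assumes "presented X Y f y F"
  shows "y \<in> carrier (FObj F Y)"
    and "\<And>Z z. \<lbrakk>Z \<in> Obj E; z \<in> carrier (FObj F Z)\<rbrakk> \<Longrightarrow> \<exists>g\<in>homs E Z Y. FMor F Z Y g y = z"
    and "\<And>Z g. \<lbrakk>Z \<in> Obj E; g \<in> homs E Z Y\<rbrakk> \<Longrightarrow>
      FMor F Z Y g y = \<one>\<^bsub>FObj F Z\<^esub> \<longleftrightarrow> (\<exists>h\<in>homs E Z X. Comp E Z X Y f h = g)"
  using assms unfolding presented_def by auto

text \<open>
  A functor \<open>R\<close> with \<open>presented X X 0 x R\<close> is isomorphic to \<open>\<Upsilon>(X)\<close>, with universal element \<open>x\<close>.
\<close>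

lemma represented_zero_iff:
  assumes R: "presented X X (zero_mor E X X) x R" and o: "X \<in> Obj E" "Z \<in> Obj E" "g \<in> homs E Z X"
  shows "FMor R Z X g x = \<one>\<^bsub>FObj R Z\<^esub> \<longleftrightarrow> g = zero_mor E Z X"
  using presented_elim(3)[OF R o(2,3)] o zero_closed[OF o(2,1)] by auto

lemma represented_eq_iff:
  assumes R: "additive_functor E R" "presented X X (zero_mor E X X) x R"
    and o: "X \<in> Obj E" "Z \<in> Obj E" "g \<in> homs E Z X" "h \<in> homs E Z X"
  shows "FMor R Z X g x = FMor R Z X h x \<longleftrightarrow> g = h"
proof
  assume e: "FMor R Z X g x = FMor R Z X h x"
  interpret group "FObj R Z" using R o by simp
  note x = presented_elim(1)[OF R(2)]
  have "FMor R Z X (g \<otimes>\<^bsub>Hom E Z X\<^esub> inv\<^bsub>Hom E Z X\<^esub> h) x = \<one>\<^bsub>FObj R Z\<^esub>"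
    using e o x R(1) by (simp add: functor_add[OF R(1)] functor_neg[OF R(1)])
  then show "g = h"
    using represented_zero_iff[OF R(2) o(1,2)] diff_eq_zero[OF o(2,1,3,4)] o by simp
qed simp

lemma represented_mod_adm:
  assumes "additive_functor E R" "presented X X (zero_mor E X X) x R" "X \<in> Obj E"
  shows "R \<in> mod_adm E"
  unfolding mod_adm_iff using assms admissible_zero by blast

section \<open>Deflations onto functors and the role of representable functors\<close>

lemma deflation_mod_admD:
  assumes "deflation (mod_adm_category E) G H \<beta>"
  shows "G \<in> mod_adm E" "H \<in> mod_adm E" "\<beta> \<in> nat_trans E G H"
    "\<And>Z. Z \<in> Obj E \<Longrightarrow> \<beta> Z ` carrier (FObj G Z) = carrier (FObj H Z)"
proof -
  obtain F \<alpha> where "F \<in> mod_adm E \<and> G \<in> mod_adm E \<and> H \<in> mod_adm E \<and> short_exact E F \<alpha> G \<beta> H"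
    using assms unfolding deflation_def by auto
  then show "G \<in> mod_adm E" "H \<in> mod_adm E" "\<beta> \<in> nat_trans E G H"
    "\<And>Z. Z \<in> Obj E \<Longrightarrow> \<beta> Z ` carrier (FObj G Z) = carrier (FObj H Z)"
    unfolding short_exact_def by blast+
qed

text \<open>By Yoneda, a map \<phi> from \<open>R\<close> to \<open>H\<close> is the element
  \<open>\<phi> X x\<close> of \<open>H(X)\<close>, and such elements lift because deflations are
  pointwise surjective.\<close>

lemma represented_projective:
  assumes R: "additive_functor E R" "presented X X (zero_mor E X X) x R" and X: "X \<in> Obj E"
  shows "R \<in> Proj (mod_adm_category E)"
proof -
  note x = presented_elim(1)[OF R(2)]
  have "\<exists>\<gamma>\<in>nat_trans E R G. restrict_components R (\<lambda>Z z. \<beta> Z (\<gamma> Z z)) = \<phi>"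
    if d: "deflation (mod_adm_category E) G H \<beta>" and \<phi>: "\<phi> \<in> nat_trans E R H" for G H \<beta> \<phi>
  proof -
    note \<beta> = deflation_mod_admD[OF d]
    have G: "additive_functor E G" using mod_adm_additive[OF \<beta>(1)] .
    have "\<phi> X x \<in> \<beta> X ` carrier (FObj G X)" using \<beta>(4)[OF X] nat_trans_closed[OF \<phi> X x] by simp
    then obtain g where g: "g \<in> carrier (FObj G X)" "\<beta> X g = \<phi> X x" by auto
    obtain \<gamma> where \<gamma>: "\<gamma> \<in> nat_trans E R G"
      "\<And>Z h. \<lbrakk>Z \<in> Obj E; h \<in> homs E Z X\<rbrakk> \<Longrightarrow> \<gamma> Z (FMor R Z X h x) = FMor G Z X h g"
      by (rule presented_nat_trans[OF R(1) G X X zero_closed[OF X X] R(2) g(1)]) (use G X g in simp_all)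
    have "\<gamma> X x = g" using \<gamma>(2)[OF X, of "Ident E X"] R(1) G X x g by simp
    then have "restrict_components R (\<lambda>Z z. \<beta> Z (\<gamma> Z z)) = \<phi>"
      using x X g by (intro presented_nat_trans_eqI[OF R(1) X R(2) comp_nat_trans[OF R(1) \<gamma>(1) \<beta>(3)] \<phi>]) simp
    then show ?thesis using \<gamma> by blast
  qed
  then show ?thesis using represented_mod_adm[OF R X] unfolding Proj_def mod_adm_category_simps by blast
qed

text \<open>
  With \<open>f = m p\<close>, the kernel of \<open>\<Upsilon>(Y) \<rightarrow> F\<close> is the cokernel of \<open>\<Upsilon>\<close> of the kernel of \<open>p\<close>.
\<close>

lemma presentation_deflation:
  assumes F: "additive_functor E F" "presented X Y f y F" and f: "admissible E X Y f"
    and R: "additive_functor E R" "presented Y Y (zero_mor E Y Y) x R"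
    and \<tau>: "\<tau> \<in> nat_trans E R F" "\<tau> Y x = y"
  shows "deflation (mod_adm_category E) R F \<tau>"
proof -
  note ft = admissible_typed[OF f]
  note y = presented_elim[OF F(2)] and x = presented_elim[OF R(2)]
  have \<tau>_app: "\<tau> Z (FMor R Z Y g x) = FMor F Z Y g y" if "Z \<in> Obj E" "g \<in> homs E Z Y" for Z g
    using nat_trans_natural[OF \<tau>(1)] that ft(2) x(1) \<tau>(2) by simp
  let ?S = "\<lambda>Z. kernel (FObj R Z) (FObj F Z) (\<tau> Z)"
  have S: "subfunctor R ?S" by (rule kernel_subfunctor[OF R(1) F(1) \<tau>(1)])
  note K = subfunctor_of_additive[OF R(1) S]
  obtain I p m where p: "deflation E X I p" and m: "inflation E I Y m" and fmp: "f = Comp E X I Y m p"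
    using f unfolding admissible_def by blast
  obtain A k where c: "Conf E A k X p I" using p unfolding deflation_def by blast
  have k: "inflation E A X k" using c unfolding inflation_def by blast
  note ker = conjunct1[OF conf_kernel_cokernel[OF c]]
  have pk: "Comp E A X I p k = zero_mor E A I" using ker unfolding is_kernel_def by blast
  note o = deflation_typed[OF p] inflation_typed[OF m] inflation_typed[OF k]
  \<comment> \<open>Under the identification of \<open>R\<close> with \<Upsilon>(Y) this element is
    \<open>f\<close> itself, and it generates the kernel of \<tau>.\<close>
  let ?u = "FMor R X Y f x"
  have Ru: "FMor R Z X h ?u = FMor R Z Y (Comp E Z X Y f h) x" if "Z \<in> Obj E" "h \<in> homs E Z X" for Z h
    using functor_comp[OF R(1) that(1) ft(1,2) that(2) ft(3) x(1)] by simp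
  have "presented A X k ?u (subfunctor_of R ?S)"
    unfolding presented_def subfunctor_of_simps
  proof (intro conjI ballI)
    have "FMor F X Y f y = \<one>\<^bsub>FObj F X\<^esub>"
      using y(3)[OF ft(1,3)] ft by (auto intro: bexI[of _ "Ident E X"])
    then show "?u \<in> ?S X" using \<tau>_app ft x(1) R(1) by (simp add: kernel_def)
    fix Z assume Z: "Z \<in> Obj E"
    show "\<exists>h\<in>homs E Z X. FMor R Z X h ?u = z" if "z \<in> ?S Z" for z
    proof -
      have z: "z \<in> carrier (FObj R Z)" "\<tau> Z z = \<one>\<^bsub>FObj F Z\<^esub>" using that unfolding kernel_def by auto
      obtain g where g: "g \<in> homs E Z Y" "FMor R Z Y g x = z" using x(2)[OF Z z(1)] by blast
      then obtain h where "h \<in> homs E Z X" "Comp E Z X Y f h = g"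
        using y(3)[OF Z g(1)] \<tau>_app[OF Z g(1)] z(2) by auto
      then show ?thesis using Ru[OF Z] g by auto
    qed
    show "FMor R Z X h ?u = \<one>\<^bsub>FObj R Z\<^esub> \<longleftrightarrow> (\<exists>l\<in>homs E Z A. Comp E Z A X k l = h)"
      if h: "h \<in> homs E Z X" for h
    proof -
      \<comment> \<open>The relations on \<open>?u\<close>: \<open>f h = 0\<close> iff
        \<open>p h = 0\<close>, since \<open>m\<close> is monic, iff \<open>h\<close> factors
        through \<open>k\<close>.\<close>
      have "FMor R Z X h ?u = \<one>\<^bsub>FObj R Z\<^esub> \<longleftrightarrow> Comp E Z X Y f h = zero_mor E Z Y"
        using Ru[OF Z h] represented_zero_iff[OF R(2) ft(2) Z] h ft Z by simp
      also have "\<dots> \<longleftrightarrow> Comp E Z X I p h = zero_mor E Z I"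
      proof
        assume e: "Comp E Z X Y f h = zero_mor E Z Y"
        show "Comp E Z X I p h = zero_mor E Z I"
          by (rule inflation_monic[OF m Z]) (use e o h Z in \<open>simp_all add: fmp comp_assoc\<close>)
      qed (use o h Z in \<open>simp add: fmp comp_assoc\<close>)
      also have "\<dots> \<longleftrightarrow> (\<exists>l\<in>homs E Z A. Comp E Z A X k l = h)"
      proof
        assume e: "Comp E Z X I p h = zero_mor E Z I"
        show "\<exists>l\<in>homs E Z A. Comp E Z A X k l = h"
          using kernel_factor[OF ker Z h e] by blast
      next
        assume "\<exists>l\<in>homs E Z A. Comp E Z A X k l = h"
        then obtain l where l: "l \<in> homs E Z A" "h = Comp E Z A X k l" by blast
        have "Comp E Z X I p h = Comp E Z A I (Comp E A X I p k) l"
          unfolding l(2) using comp_assoc[of Z A X I l k p] o l(1) Z by simp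
        then show "Comp E Z X I p h = zero_mor E Z I" using o l(1) Z pk by simp
      qed
      finally show ?thesis .
    qed
  qed
  then have "subfunctor_of R ?S \<in> mod_adm E"
    unfolding mod_adm_iff using K admissible_inflation[OF k] by blast
  moreover have "\<tau> Z ` carrier (FObj R Z) = carrier (FObj F Z)" if Z: "Z \<in> Obj E" for Z
  proof
    show "\<tau> Z ` carrier (FObj R Z) \<subseteq> carrier (FObj F Z)" using nat_trans_closed[OF \<tau>(1) Z] by blast
    show "carrier (FObj F Z) \<subseteq> \<tau> Z ` carrier (FObj R Z)"
    proof
      fix z assume "z \<in> carrier (FObj F Z)"
      then obtain g where g: "g \<in> homs E Z Y" "FMor F Z Y g y = z" using y(2) Z by blast
      have "FMor R Z Y g x \<in> carrier (FObj R Z)" using R(1) Z ft g x(1) by simp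
      then show "z \<in> \<tau> Z ` carrier (FObj R Z)" using \<tau>_app[OF Z g(1)] g(2) by (intro image_eqI) simp_all
    qed
  qed
  moreover have "R \<in> mod_adm E" using represented_mod_adm[OF R ft(2)] .
  moreover have "F \<in> mod_adm E" unfolding mod_adm_iff using F f by blast
  ultimately have "Conf (mod_adm_category E) (subfunctor_of R ?S)
      (restrict_components (subfunctor_of R ?S) (\<lambda>X x. x)) R \<tau> F"
    using short_exact_subfunctor[OF R(1) F(1) S \<tau>(1)] by (simp add: kernel_def)
  then show ?thesis unfolding deflation_def by blast
qed

text \<open>A map from \<open>R\<close> to an effaceable \<open>G\<close> is an element of
  \<open>G(P)\<close>, given by some \<open>h : P -> B\<close>. Projectivity of \<open>P\<close>
  lifts \<open>h\<close> along the presenting deflation, which makes the element zero.\<close>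

lemma represented_left_perp:
  assumes P: "P \<in> Proj E" and R: "additive_functor E R" "presented P P (zero_mor E P P) x R"
  shows "R \<in> left_perp (mod_adm_category E) (eff E)"
proof -
  have PO: "P \<in> Obj E" using P unfolding Proj_def by blast
  have "homs (mod_adm_category E) R G = {zero_mor (mod_adm_category E) R G}" if G: "G \<in> eff E" for G
  proof -
    obtain A B d b where G: "additive_functor E G" and d: "deflation E A B d" and b: "presented A B d b G"
      using G unfolding eff_iff by blast
    note b = presented_elim[OF b] and dt = deflation_typed[OF d] and x = presented_elim[OF R(2)]
    show ?thesis
      unfolding homs_eq_zero_iff[OF R(1) G]
    proof (intro ballI)
      fix \<alpha> Z z assume \<alpha>: "\<alpha> \<in> nat_trans E R G" and Z: "Z \<in> Obj E" "z \<in> carrier (FObj R Z)"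
      obtain h where h: "h \<in> homs E P B" "FMor G P B h b = \<alpha> P x"
        using b(2)[OF PO] nat_trans_closed[OF \<alpha> PO x(1)] by blast
      have "\<exists>h'\<in>homs E P A. Comp E P A B d h' = h" using P d h unfolding Proj_def by blast
      then have "\<alpha> P x = \<one>\<^bsub>FObj G P\<^esub>" using b(3)[OF PO h(1)] h(2) by simp
      moreover obtain g where g: "g \<in> homs E Z P" "FMor R Z P g x = z" using x(2) Z by blast
      ultimately show "\<alpha> Z z = \<one>\<^bsub>FObj G Z\<^esub>"
        using nat_trans_natural[OF \<alpha> Z(1) PO g(1) x(1)] G Z PO by simp
    qed
  qed
  then show ?thesis
    using represented_mod_adm[OF R PO] unfolding left_perp_def by simp
qed

text \<open>The copy of \<Upsilon>(X) with values in \<open>'g\<close>, obtained as a cokernel of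
  zero so that it carries an admissible presentation.\<close>

lemma ex_represented:
  fixes \<iota> :: "'m \<Rightarrow> 'g"
  assumes "X \<in> Obj E" "inj \<iota>"
  obtains R :: "('o, 'm, 'g) cfunctor" and x where "additive_functor E R" "presented X X (zero_mor E X X) x R"
  by (rule ex_presented[OF assms(1,1) zero_closed assms(2)]) (use assms(1) in auto)

section \<open>Closure under isomorphism\<close>

lemma mod_adm_iso_bij:
  assumes \<theta>: "is_iso (mod_adm_category E) F G \<theta>" and X: "X \<in> Obj E"
  shows "bij_betw (\<theta> X) (carrier (FObj F X)) (carrier (FObj G X))"
proof -
  obtain \<psi> where t: "\<theta> \<in> nat_trans E F G" "\<psi> \<in> nat_trans E G F"
    and l: "restrict_components F (\<lambda>X x. \<psi> X (\<theta> X x)) = restrict_components F (\<lambda>X x. x)"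
    and r: "restrict_components G (\<lambda>X x. \<theta> X (\<psi> X x)) = restrict_components G (\<lambda>X x. x)"
    using \<theta> unfolding is_iso_def by auto
  show ?thesis
  proof (rule bij_betw_byWitness[where f' = "\<psi> X"])
    show "\<forall>x\<in>carrier (FObj F X). \<psi> X (\<theta> X x) = x"
    proof
      fix x assume "x \<in> carrier (FObj F X)"
      then show "\<psi> X (\<theta> X x) = x" using fun_cong[OF fun_cong[OF l], of X x] X by simp
    qed
    show "\<forall>x\<in>carrier (FObj G X). \<theta> X (\<psi> X x) = x"
    proof
      fix x assume "x \<in> carrier (FObj G X)"
      then show "\<theta> X (\<psi> X x) = x" using fun_cong[OF fun_cong[OF r], of X x] X by simp
    qed
  qed (use nat_trans_closed[OF t(1) X] nat_trans_closed[OF t(2) X] in blast)+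
qed

lemma eff_iso_closed: "iso_closed (mod_adm_category E) (eff E)"
  unfolding iso_closed_def
proof (intro ballI impI)
  fix F G assume F: "F \<in> eff E" and G: "G \<in> Obj (mod_adm_category E)"
    and "\<exists>\<theta>. is_iso (mod_adm_category E) F G \<theta>"
  then obtain \<theta> where \<theta>: "is_iso (mod_adm_category E) F G \<theta>" by blast
  then have nt: "\<theta> \<in> nat_trans E F G" unfolding is_iso_def by simp
  obtain X Y f y where d: "deflation E X Y f" and F: "additive_functor E F" "presented X Y f y F"
    using F unfolding eff_iff by blast
  have G: "additive_functor E G" using G mod_adm_additive by simp
  show "G \<in> eff E"
    unfolding eff_iff
    using d G presented_transport[OF F(1) G deflation_typed(2)[OF d] F(2) nt mod_adm_iso_bij[OF \<theta>]] by blast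
qed

text \<open>Following \<beta> by an isomorphism leaves its kernel unchanged, so \<open>K\<close> and
  \<kappa> complete the new conflation as well.\<close>

lemma gen_iso_closed: "iso_closed (mod_adm_category E) (gen (mod_adm_category E) \<X>)"
  unfolding iso_closed_def
proof (intro ballI impI)
  fix F G assume "F \<in> gen (mod_adm_category E) \<X>" and G: "G \<in> Obj (mod_adm_category E)"
    and "\<exists>\<theta>. is_iso (mod_adm_category E) F G \<theta>"
  then obtain \<theta> P K \<kappa> \<beta> where \<theta>: "is_iso (mod_adm_category E) F G \<theta>" and P: "P \<in> \<X>"
    and c: "Conf (mod_adm_category E) K \<kappa> P \<beta> F"
    unfolding gen_def deflation_def by blast
  have nt: "\<theta> \<in> nat_trans E F G" using \<theta> unfolding is_iso_def by simp
  have m: "K \<in> mod_adm E" "P \<in> mod_adm E" "F \<in> mod_adm E" "G \<in> mod_adm E" "\<kappa> \<in> nat_trans E K P"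
    and \<beta>: "\<beta> \<in> nat_trans E P F"
    and ex: "\<And>X. X \<in> Obj E \<Longrightarrow> inj_on (\<kappa> X) (carrier (FObj K X)) \<and>
        \<kappa> X ` carrier (FObj K X) = kernel (FObj P X) (FObj F X) (\<beta> X) \<and>
        \<beta> X ` carrier (FObj P X) = carrier (FObj F X)"
    using c G by (simp_all add: short_exact_def)
  note add = m(1-4)[THEN mod_adm_additive]
  let ?\<gamma> = "restrict_components P (\<lambda>X x. \<theta> X (\<beta> X x))"
  have \<gamma>: "?\<gamma> \<in> nat_trans E P G" by (rule comp_nat_trans[OF add(2) \<beta> nt])
  have "kernel (FObj P X) (FObj G X) (?\<gamma> X) = kernel (FObj P X) (FObj F X) (\<beta> X)" if X: "X \<in> Obj E" for X
  proof -
    interpret group_hom "FObj F X" "FObj G X" "\<theta> X" by (rule nat_trans_group_hom[OF nt add(3,4) X])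
    have inj: "inj_on (\<theta> X) (carrier (FObj F X))"
      using mod_adm_iso_bij[OF \<theta> X] bij_betw_imp_inj_on by blast
    have "\<theta> X (\<beta> X x) = \<one>\<^bsub>FObj G X\<^esub> \<longleftrightarrow> \<beta> X x = \<one>\<^bsub>FObj F X\<^esub>" if "x \<in> carrier (FObj P X)" for x
      using inj_on_eq_iff[OF inj nat_trans_closed[OF \<beta> X that] G.one_closed] by simp
    then show ?thesis using X by (auto simp: kernel_def)
  qed
  moreover have "?\<gamma> X ` carrier (FObj P X) = carrier (FObj G X)" if X: "X \<in> Obj E" for X
  proof -
    have "?\<gamma> X ` carrier (FObj P X) = \<theta> X ` \<beta> X ` carrier (FObj P X)" using X by (simp add: image_image)
    then show ?thesis using ex[OF X] mod_adm_iso_bij[OF \<theta> X] bij_betw_imp_surj_on by metis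
  qed
  ultimately have "short_exact E K \<kappa> P ?\<gamma> G"
    using add m(5) \<gamma> ex unfolding short_exact_def by simp
  then have "deflation (mod_adm_category E) P G ?\<gamma>" using m unfolding deflation_def by auto
  then show "G \<in> gen (mod_adm_category E) \<X>" using P G unfolding gen_def by blast
qed

text \<open>A morphism \<open>g\<close> kills the restriction of \<open>y\<close> to
  \<open>Q\<close> iff \<open>q g\<close> factors through \<open>f\<close>, so the relations are
  presented by the pullback of \<open>f\<close> along \<open>q\<close>. Pulling back along
  \<open>m\<close> and then along \<open>p\<close> exhibits it as a deflation followed by an
  inflation.\<close>

lemma generated_by_deflation_presented:
  assumes add: "additive_functor E F" and pr: "presented X Y f y F" and f: "admissible E X Y f"
    and q: "deflation E Q Y q"
  shows "\<exists>D k. admissible E D Q k \<and> presented D Q k (FMor F Q Y q y)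
    (subfunctor_of F (\<lambda>Z. (\<lambda>g. FMor F Z Q g (FMor F Q Y q y)) ` homs E Z Q))"
proof -
  note y = presented_elim[OF pr] and ft = admissible_typed[OF f]
  obtain I p m where p: "deflation E X I p" and m: "inflation E I Y m" and fmp: "f = Comp E X I Y m p"
    using f unfolding admissible_def by blast
  note o = deflation_typed[OF p] inflation_typed[OF m] deflation_typed[OF q]
  let ?t = "FMor F Q Y q y"
  let ?S = "\<lambda>Z. (\<lambda>g. FMor F Z Q g ?t) ` homs E Z Q"
  let ?T = "subfunctor_of F ?S"
  have t: "?t \<in> carrier (FObj F Q)" using add o y(1) by simp
  have Ft: "FMor F Z Q g ?t = FMor F Z Y (Comp E Z Q Y q g) y" if "Z \<in> Obj E" "g \<in> homs E Z Q" for Z g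
    using functor_comp[OF add that(1) o(7,8) that(2) o(9) y(1)] by simp
  obtain A n r where pb1: "is_pullback E A n Q r I q m Y" and r: "deflation E A I r"
    using deflation_pullback[OF q o(4,6)] by blast
  have n: "inflation E A Q n" by (rule inflation_pullback[OF pb1 q m])
  \<comment> \<open>\<open>D\<close> is the pullback of \<open>f\<close> and \<open>q\<close> by
    pasting the two squares; its projection to \<open>Q\<close> is \<open>n s\<close>.\<close>
  obtain D v s where pb2: "is_pullback E D v X s A p r I" and s: "deflation E D A s"
    using deflation_pullback[OF p deflation_typed(1,3)[OF r]] by blast
  note o' = deflation_typed[OF r] inflation_typed[OF n] deflation_typed[OF s]
  have v: "v \<in> homs E D X" and sq1: "Comp E A Q Y q n = Comp E A I Y m r"
    and sq2: "Comp E D X I p v = Comp E D A I r s"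
    using pb1 pb2 unfolding is_pullback_def by auto
  let ?k = "Comp E D A Q n s"
  have k: "admissible E D Q ?k" unfolding admissible_def using s n by blast
  have qk: "Comp E D Q Y q ?k = Comp E D X Y f v"
  proof -
    have "Comp E D Q Y q ?k = Comp E D A Y (Comp E A Q Y q n) s" using o o' by (simp add: comp_assoc)
    also have "\<dots> = Comp E D I Y m (Comp E D A I r s)" unfolding sq1 using o o' by (simp add: comp_assoc)
    also have "\<dots> = Comp E D X Y f v" unfolding fmp sq2[symmetric] using o o' v by (simp add: comp_assoc)
    finally show ?thesis .
  qed
  have "presented D Q ?k ?t ?T"
    unfolding presented_def subfunctor_of_simps
  proof (intro conjI ballI)
    show "?t \<in> ?S Q" by (rule image_eqI[of _ _ "Ident E Q"]) (use add o t in simp_all)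
    fix Z assume Z: "Z \<in> Obj E"
    show "\<exists>g\<in>homs E Z Q. FMor F Z Q g ?t = z" if "z \<in> ?S Z" for z using that by blast
    show "FMor F Z Q g ?t = \<one>\<^bsub>FObj F Z\<^esub> \<longleftrightarrow> (\<exists>l\<in>homs E Z D. Comp E Z D Q ?k l = g)"
      if g: "g \<in> homs E Z Q" for g
    proof -
      have "FMor F Z Q g ?t = \<one>\<^bsub>FObj F Z\<^esub> \<longleftrightarrow> (\<exists>h\<in>homs E Z X. Comp E Z X Y f h = Comp E Z Q Y q g)"
        using Ft[OF Z g] y(3)[OF Z, of "Comp E Z Q Y q g"] o g Z by simp
      also have "\<dots> \<longleftrightarrow> (\<exists>l\<in>homs E Z D. Comp E Z D Q ?k l = g)"
      proof
        assume "\<exists>h\<in>homs E Z X. Comp E Z X Y f h = Comp E Z Q Y q g"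
        then obtain h where h: "h \<in> homs E Z X" "Comp E Z X Y f h = Comp E Z Q Y q g" by blast
        have "Comp E Z Q Y q g = Comp E Z I Y m (Comp E Z X I p h)"
          using h o Z by (simp add: fmp comp_assoc)
        then obtain l where l: "l \<in> homs E Z A" "Comp E Z A Q n l = g" "Comp E Z A I r l = Comp E Z X I p h"
          using pullback_factor[OF pb1 Z g comp_closed[OF Z o(1,2) h(1) o(3)]] by blast
        obtain l' where l': "l' \<in> homs E Z D" "Comp E Z D A s l' = l"
          using pullback_factor[OF pb2 Z h(1) l(1) l(3)[symmetric]] by blast
        have "Comp E Z D Q ?k l' = g" using l l' o o' Z by (simp add: comp_assoc)
        then show "\<exists>l\<in>homs E Z D. Comp E Z D Q ?k l = g" using l' by blast
      next
        assume "\<exists>l\<in>homs E Z D. Comp E Z D Q ?k l = g"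
        then obtain l where l: "l \<in> homs E Z D" "g = Comp E Z D Q ?k l" by blast
        have "Comp E Z Q Y q g = Comp E Z D Y (Comp E D Q Y q ?k) l"
          unfolding l(2) using l(1) o o' Z comp_closed[OF o'(7,4,5) o'(9,6)]
          by (intro comp_assoc[symmetric]) auto
        also have "\<dots> = Comp E Z X Y f (Comp E Z D X v l)"
          unfolding qk using l(1) o o' ft v Z by (intro comp_assoc) auto
        finally show "\<exists>h\<in>homs E Z X. Comp E Z X Y f h = Comp E Z Q Y q g"
          using comp_closed[OF Z o'(7) ft(1) l(1) v] by metis
      qed
      finally show ?thesis .
    qed
  qed
  then show ?thesis using k by blast
qed

text \<open>Dividing by the subfunctor generated by \<open>F(q)(y)\<close> adds the relation
  \<open>q\<close> to the relation \<open>f\<close> on \<open>y\<close>. The two together are the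
  morphism with components \<open>f\<close> and \<open>q\<close> on a biproduct.\<close>

lemma quotient_by_deflation_presented:
  assumes add: "additive_functor E F" and H: "additive_functor E H" and \<pi>: "\<pi> \<in> nat_trans E F H"
    and pr: "presented X Y f y F" and ft: "X \<in> Obj E" "Y \<in> Obj E" "f \<in> homs E X Y"
    and q: "deflation E Q Y q"
    and \<pi>_surj: "\<And>Z. Z \<in> Obj E \<Longrightarrow> \<pi> Z ` carrier (FObj F Z) = carrier (FObj H Z)"
    and \<pi>_ker: "\<And>Z z. \<lbrakk>Z \<in> Obj E; z \<in> carrier (FObj F Z)\<rbrakk> \<Longrightarrow>
      \<pi> Z z = \<one>\<^bsub>FObj H Z\<^esub> \<longleftrightarrow> z \<in> (\<lambda>g. FMor F Z Q g (FMor F Q Y q y)) ` homs E Z Q"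
  shows "\<exists>B d. deflation E B Y d \<and> presented B Y d (\<pi> Y y) H"
proof -
  note y = presented_elim[OF pr] and qt = deflation_typed[OF q]
  let ?t = "FMor F Q Y q y"
  have Ft: "FMor F Z Q g ?t = FMor F Z Y (Comp E Z Q Y q g) y" if "Z \<in> Obj E" "g \<in> homs E Z Q" for Z g
    using functor_comp[OF add that(1) qt(1,2) that(2) qt(3) y(1)] by simp
  obtain B i j a b where B: "is_biproduct E X Q B i j a b" using ex_biproduct[OF ft(1) qt(1)] by blast
  have Bt: "B \<in> Obj E" "a \<in> homs E B X" "b \<in> homs E B Q" using B unfolding is_biproduct_def by auto
  let ?d = "Comp E B X Y f a \<otimes>\<^bsub>Hom E B Y\<^esub> Comp E B Q Y q b"
  \<comment> \<open>\<open>deflation_copair\<close> with \<open>s = 0\<close>.\<close>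
  have d: "deflation E B Y ?d"
    using deflation_copair[OF q ft(1) ft(3) zero_closed[OF qt(1) ft(1)] B] qt ft by simp
  have \<pi>_app: "FMor H Z Y g (\<pi> Y y) = \<pi> Z (FMor F Z Y g y)" if "Z \<in> Obj E" "g \<in> homs E Z Y" for Z g
    using nat_trans_natural[OF \<pi> that(1) ft(2) that(2) y(1)] by simp
  have "presented B Y ?d (\<pi> Y y) H"
    unfolding presented_def
  proof (intro conjI ballI)
    show "\<pi> Y y \<in> carrier (FObj H Y)" by (rule nat_trans_closed[OF \<pi> ft(2) y(1)])
    fix Z assume Z: "Z \<in> Obj E"
    show "\<exists>g\<in>homs E Z Y. FMor H Z Y g (\<pi> Y y) = z" if z: "z \<in> carrier (FObj H Z)" for z
    proof -
      have "z \<in> \<pi> Z ` carrier (FObj F Z)" using \<pi>_surj[OF Z] z by simp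
      then obtain z' where z': "z' \<in> carrier (FObj F Z)" "z = \<pi> Z z'" by (rule imageE)
      obtain g where "g \<in> homs E Z Y" "FMor F Z Y g y = z'" using y(2)[OF Z z'(1)] by (rule bexE)
      then show ?thesis using \<pi>_app[OF Z] z'(2) by (intro bexI[of _ g]) simp_all
    qed
    show "FMor H Z Y g (\<pi> Y y) = \<one>\<^bsub>FObj H Z\<^esub> \<longleftrightarrow> (\<exists>l\<in>homs E Z B. Comp E Z B Y ?d l = g)"
      if g: "g \<in> homs E Z Y" for g
    proof -
      interpret FZ: group "FObj F Z" using add Z by simp
      interpret HZY: group "Hom E Z Y" using Z ft by simp
      have gy: "FMor F Z Y g y \<in> carrier (FObj F Z)" using add Z ft g y(1) by simp
      have d_app: "Comp E Z B Y ?d l = Comp E Z X Y f (Comp E Z B X a l) \<otimes>\<^bsub>Hom E Z Y\<^esub>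
          Comp E Z Q Y q (Comp E Z B Q b l)" if "l \<in> homs E Z B" for l
        using that Z Bt qt ft by (simp add: comp_add_left comp_assoc)
      have "FMor H Z Y g (\<pi> Y y) = \<one>\<^bsub>FObj H Z\<^esub> \<longleftrightarrow> (\<exists>c\<in>homs E Z Q. FMor F Z Y g y = FMor F Z Q c ?t)"
        using \<pi>_app[OF Z g] \<pi>_ker[OF Z gy] by auto
      also have "\<dots> \<longleftrightarrow> (\<exists>l\<in>homs E Z B. Comp E Z B Y ?d l = g)"
      proof
        assume "\<exists>c\<in>homs E Z Q. FMor F Z Y g y = FMor F Z Q c ?t"
        then obtain c where c: "c \<in> homs E Z Q" "FMor F Z Y g y = FMor F Z Q c ?t" by blast
        let ?qc = "Comp E Z Q Y q c"
        have qc: "?qc \<in> homs E Z Y" using Z qt c by simp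
        \<comment> \<open>The difference \<open>g - q c\<close> kills \<open>y\<close> in
          \<open>F\<close>, hence has the form \<open>f h\<close>, and
          \<open>g = f h + q c\<close>.\<close>
        have "FMor F Z Y (g \<otimes>\<^bsub>Hom E Z Y\<^esub> inv\<^bsub>Hom E Z Y\<^esub> ?qc) y = \<one>\<^bsub>FObj F Z\<^esub>"
          using c(2) Ft[OF Z c(1)] gy g qc Z ft(2) y(1)
          by (simp add: functor_add[OF add] functor_neg[OF add])
        then obtain h where h: "h \<in> homs E Z X" "Comp E Z X Y f h = g \<otimes>\<^bsub>Hom E Z Y\<^esub> inv\<^bsub>Hom E Z Y\<^esub> ?qc"
          using y(3)[OF Z, of "g \<otimes>\<^bsub>Hom E Z Y\<^esub> inv\<^bsub>Hom E Z Y\<^esub> ?qc"] g qc by auto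
        obtain l where l: "l \<in> homs E Z B" "Comp E Z B X a l = h" "Comp E Z B Q b l = c"
          by (rule biproduct_pair[OF B ft(1) qt(1) Z h(1) c(1)])
        have "Comp E Z B Y ?d l = g" unfolding d_app[OF l(1)] l(2,3) h(2) using Z ft g qc by simp
        then show "\<exists>l\<in>homs E Z B. Comp E Z B Y ?d l = g" using l(1) by blast
      next
        assume "\<exists>l\<in>homs E Z B. Comp E Z B Y ?d l = g"
        then obtain l where l: "l \<in> homs E Z B" "Comp E Z B Y ?d l = g" by blast
        let ?h = "Comp E Z B X a l" and ?c = "Comp E Z B Q b l"
        have hc: "?h \<in> homs E Z X" "?c \<in> homs E Z Q" using Z l(1) Bt qt ft by simp_all
        have fh: "Comp E Z X Y f ?h \<in> homs E Z Y" "Comp E Z Q Y q ?c \<in> homs E Z Y" using hc Z qt ft by simp_all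
        have "FMor F Z Y (Comp E Z X Y f ?h) y = \<one>\<^bsub>FObj F Z\<^esub>"
          using y(3)[OF Z fh(1)] hc by blast
        then have "FMor F Z Y g y = FMor F Z Q ?c ?t"
          using functor_add[OF add Z ft(2) fh y(1)] Ft[OF Z hc(2)] add Z ft(2) fh y(1)
          unfolding l(2)[symmetric] d_app[OF l(1)] by simp
        then show "\<exists>c\<in>homs E Z Q. FMor F Z Y g y = FMor F Z Q c ?t" using hc by blast
      qed
      finally show ?thesis .
    qed
  qed
  then show ?thesis using d by blast
qed

text \<open>The torsion part is generated by the single element \<open>F(q)(y)\<close> over
  \<open>Q\<close>, so it is a quotient of a copy of \<Upsilon>(Q). The deflation \<open>q\<close>
  becomes a relation in the quotient, which makes that functor effaceable.\<close>

lemma ex_torsion_sequence: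
  fixes \<iota> :: "'m \<Rightarrow> 'g" and F :: "('o, 'm, 'g) cfunctor"
  assumes ep: "enough_projectives E" and \<iota>: "inj \<iota>" and F: "F \<in> mod_adm E"
  shows "\<exists>T\<in>gen (mod_adm_category E)
        (Proj (mod_adm_category E) \<inter> left_perp (mod_adm_category E) (eff E :: ('o, 'm, 'g) cfunctor set)).
      \<exists>H\<in>eff E. \<exists>\<alpha> \<beta>. Conf (mod_adm_category E) T \<alpha> F \<beta> H"
proof -
  obtain X Y f y where f: "admissible E X Y f" and add: "additive_functor E F" and pr: "presented X Y f y F"
    using F unfolding mod_adm_iff by blast
  note y = presented_elim[OF pr] and ft = admissible_typed[OF f]
  obtain Q q where Q: "Q \<in> Proj E" and q: "deflation E Q Y q"
    using ep ft unfolding enough_projectives_def by blast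
  note o = deflation_typed[OF q]
  let ?t = "FMor F Q Y q y"
  let ?S = "\<lambda>Z. (\<lambda>g. FMor F Z Q g ?t) ` homs E Z Q"
  let ?T = "subfunctor_of F ?S"
  have t: "?t \<in> carrier (FObj F Q)" using add o y(1) by simp
  have S: "subfunctor F ?S" by (rule generated_subfunctor[OF add o(1) t])
  have T: "additive_functor E ?T" by (rule subfunctor_of_additive[OF add S])
  obtain D k where k: "admissible E D Q k" and T_pr: "presented D Q k ?t ?T"
    using generated_by_deflation_presented[OF add pr f q] by blast
  have T_adm: "?T \<in> mod_adm E" unfolding mod_adm_iff using T T_pr k by blast
  obtain R :: "('o, 'm, 'g) cfunctor" and x where R: "additive_functor E R" "presented Q Q (zero_mor E Q Q) x R"
    by (rule ex_represented[OF o(1) \<iota>])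
  note x = presented_elim[OF R(2)] and t' = presented_elim(1)[OF T_pr]
  obtain \<tau> where \<tau>: "\<tau> \<in> nat_trans E R ?T"
    "\<And>Z g. \<lbrakk>Z \<in> Obj E; g \<in> homs E Z Q\<rbrakk> \<Longrightarrow> \<tau> Z (FMor R Z Q g x) = FMor ?T Z Q g ?t"
    by (rule presented_nat_trans[OF R(1) T o(1) o(1) zero_closed[OF o(1) o(1)] R(2) t'])
      (use T o t' in \<open>simp_all del: subfunctor_of_simps\<close>)
  have "\<tau> Q x = ?t" using \<tau>(2)[OF o(1), of "Ident E Q"] R(1) add o x(1) t by simp
  from presentation_deflation[OF T T_pr k R \<tau>(1) this] have "deflation (mod_adm_category E) R ?T \<tau>" .
  moreover have "R \<in> Proj (mod_adm_category E)" by (rule represented_projective[OF R o(1)])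
  moreover have "R \<in> left_perp (mod_adm_category E) (eff E :: ('o, 'm, 'g) cfunctor set)"
    by (rule represented_left_perp[OF Q R])
  ultimately have T_gen: "?T \<in> gen (mod_adm_category E)
      (Proj (mod_adm_category E) \<inter> left_perp (mod_adm_category E) (eff E :: ('o, 'm, 'g) cfunctor set))"
    using T_adm unfolding gen_def mod_adm_category_simps by blast
  obtain H :: "('o, 'm, 'g) cfunctor" and \<pi> where H: "additive_functor E H" and \<pi>: "\<pi> \<in> nat_trans E F H"
    and \<pi>_surj: "\<And>Z. Z \<in> Obj E \<Longrightarrow> \<pi> Z ` carrier (FObj F Z) = carrier (FObj H Z)"
    and \<pi>_ker: "\<And>Z z. \<lbrakk>Z \<in> Obj E; z \<in> carrier (FObj F Z)\<rbrakk> \<Longrightarrow> \<pi> Z z = \<one>\<^bsub>FObj H Z\<^esub> \<longleftrightarrow> z \<in> ?S Z"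
    by (rule ex_quotient_functor[OF add S inj_on_id]) (rule that; assumption)
  obtain B d where d: "deflation E B Y d" "presented B Y d (\<pi> Y y) H"
    using quotient_by_deflation_presented[OF add H \<pi> pr ft q \<pi>_surj \<pi>_ker] by blast
  have H_eff: "H \<in> eff E" unfolding eff_iff using H d by blast
  have "short_exact E ?T (restrict_components ?T (\<lambda>X x. x)) F \<pi> H"
    by (rule short_exact_subfunctor[OF add H S \<pi> \<pi>_surj \<pi>_ker])
  then have "Conf (mod_adm_category E) ?T (restrict_components ?T (\<lambda>X x. x)) F \<pi> H"
    using T_adm F H_eff eff_subset_mod_adm by auto
  then show ?thesis using T_gen H_eff by blast
qed

text \<open>
  If \<open>F\<close> is projective and presented by \<open>f\<close>, then \<open>\<Upsilon>(Y) \<rightarrow> F\<close> splits, whence \<open>f = f u f\<close> for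
  some \<open>u\<close>; as \<open>f\<close> is admissible, the idempotent \<open>1 - f u\<close> splits and \<open>F\<close> is representable even
  though idempotents of \<open>E\<close> need not split.
\<close>

lemma projective_represented:
  fixes \<iota> :: "'m \<Rightarrow> 'g" and F :: "('o, 'm, 'g) cfunctor"
  assumes P: "F \<in> Proj (mod_adm_category E)" and \<iota>: "inj \<iota>"
  shows "\<exists>C\<in>Obj E. \<exists>x. presented C C (zero_mor E C C) x F"
proof -
  have "F \<in> mod_adm E" using P unfolding Proj_def by simp
  then obtain X Y f y where f: "admissible E X Y f" and F: "additive_functor E F" and pr: "presented X Y f y F"
    unfolding mod_adm_iff by blast
  note y = presented_elim[OF pr] and o = admissible_typed[OF f]
  have e1: "FMor F Y Y (Ident E Y) y = y" using F o y(1) by simp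
  have fy: "FMor F X Y f y = \<one>\<^bsub>FObj F X\<^esub>"
    using y(3)[OF o(1,3)] o by (auto intro: bexI[of _ "Ident E X"])
  obtain R :: "('o, 'm, 'g) cfunctor" and x where R: "additive_functor E R" "presented Y Y (zero_mor E Y Y) x R"
    by (rule ex_presented[OF o(2,2) zero_closed[OF o(2,2)] \<iota>])
  note x = presented_elim[OF R(2)]
  obtain \<tau> where \<tau>: "\<tau> \<in> nat_trans E R F"
    "\<And>Z g. \<lbrakk>Z \<in> Obj E; g \<in> homs E Z Y\<rbrakk> \<Longrightarrow> \<tau> Z (FMor R Z Y g x) = FMor F Z Y g y"
    by (rule presented_nat_trans[OF R(1) F o(2,2) zero_closed[OF o(2,2)] R(2) y(1)]) (use F o y(1) in simp_all)
  have \<tau>x: "\<tau> Y x = y" using \<tau>(2)[OF o(2) ident_closed[OF o(2)]] R(1) F o x(1) y(1) by simp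
  have d: "deflation (mod_adm_category E) R F \<tau>" by (rule presentation_deflation[OF F pr f R \<tau>(1) \<tau>x])
  have id: "restrict_components F (\<lambda>X x. x) \<in> nat_trans E F F"
    by (rule restrict_components_nat_trans) (simp_all add: F functor_mult_closed[OF F])
  \<comment> \<open>Lift the identity of the projective \<open>F\<close> along the deflation
    \<tau>.\<close>
  have "\<exists>s\<in>nat_trans E F R. restrict_components F (\<lambda>X x. \<tau> X (s X x)) = restrict_components F (\<lambda>X x. x)"
    using P d id unfolding Proj_def mod_adm_category_simps by blast
  then obtain s where s: "s \<in> nat_trans E F R"
    and "restrict_components F (\<lambda>X x. \<tau> X (s X x)) = restrict_components F (\<lambda>X x. x)" by blast
  from fun_cong[OF fun_cong[OF this(2)], of Y y] have \<tau>s: "\<tau> Y (s Y y) = y" using o y(1) by simp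
  \<comment> \<open>\<open>e\<close> is the endomorphism of \<open>Y\<close> that corresponds to
    \<open>s\<close> after \<tau>. It fixes the generator \<open>y\<close>, so \<open>1 - e\<close>
    is a relation on \<open>y\<close> and factors through \<open>f\<close> as
    \<open>f u\<close>.\<close>
  obtain e where e: "e \<in> homs E Y Y" "FMor R Y Y e x = s Y y"
    using x(2)[OF o(2) nat_trans_closed[OF s o(2) y(1)]] by blast
  have ey: "FMor F Y Y e y = y" using \<tau>(2)[OF o(2) e(1)] e(2) \<tau>s by simp
  let ?d = "Ident E Y \<otimes>\<^bsub>Hom E Y Y\<^esub> inv\<^bsub>Hom E Y Y\<^esub> e"
  have dt: "?d \<in> homs E Y Y" using o e by simp
  interpret FY: group "FObj F Y" using F o by simp
  have "FMor F Y Y ?d y = \<one>\<^bsub>FObj F Y\<^esub>"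
    using o e(1) y(1) e1 ey by (simp add: functor_add[OF F] functor_neg[OF F])
  then obtain u where u: "u \<in> homs E Y X" "Comp E Y X Y f u = ?d" using y(3)[OF o(2) dt] by blast
  \<comment> \<open>\<open>e f\<close> represents the image under \<open>s\<close> of
    \<open>F(f)(y) = 0\<close>. With \<open>e f = 0\<close> the equation \<open>1 - e = f u\<close>
    gives \<open>f = f u f\<close>.\<close>
  have "FMor R X Y (Comp E X Y Y e f) x = FMor R X Y f (s Y y)"
    using functor_comp[OF R(1) o(1,2,2,3) e(1) x(1)] e(2) by simp
  also have "\<dots> = s X (FMor F X Y f y)" by (rule nat_trans_natural[OF s o y(1), symmetric])
  also have "\<dots> = \<one>\<^bsub>FObj R X\<^esub>"
    unfolding fy by (rule group_hom.hom_one[OF nat_trans_group_hom[OF s F R(1) o(1)]])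
  finally have ef: "Comp E X Y Y e f = zero_mor E X Y"
    using represented_zero_iff[OF R(2) o(2,1)] o e(1) by simp
  have "f = Comp E X Y Y (?d \<otimes>\<^bsub>Hom E Y Y\<^esub> e) f" using o e(1) by simp
  also have "\<dots> = Comp E X Y Y ?d f"
    using comp_add_left[OF o(1,2,2,3) dt e(1)] o ef comp_closed[OF o(1,2,2,3) dt] by simp
  finally have "Comp E X Y Y (Comp E Y X Y f u) f = f" unfolding u(2) by (rule sym)
  then obtain C n c where C: "C \<in> Obj E" "n \<in> homs E C Y" "c \<in> homs E Y C" and cn: "Comp E C Y C c n = Ident E C"
    and nc: "Comp E Y C Y n c \<otimes>\<^bsub>Hom E Y Y\<^esub> Comp E Y X Y f u = Ident E Y"
    and cf: "Comp E X Y C c f = zero_mor E X C"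
    by (rule admissible_regular_splits[OF f u(1)])
  \<comment> \<open>As \<open>f u\<close> kills \<open>y\<close> and \<open>n c + f u = 1\<close>,
    the morphism \<open>n c\<close> fixes \<open>y\<close>; hence \<open>F(c)\<close> maps
    \<open>?x\<close> to \<open>y\<close> and \<open>?x\<close> generates \<open>F\<close>. It has
    only the zero relation: if \<open>n g = f h\<close>, then
    \<open>g = c n g = c f h = 0\<close>.\<close>
  let ?x = "FMor F C Y n y"
  have xt: "?x \<in> carrier (FObj F C)" using F C o y(1) by simp
  have nct: "Comp E Y C Y n c \<in> homs E Y Y" using C o by simp
  have "FMor F Y Y ?d y = \<one>\<^bsub>FObj F Y\<^esub>" using y(3)[OF o(2) dt] u by blast
  then have "y = FMor F Y Y (Comp E Y C Y n c) y \<otimes>\<^bsub>FObj F Y\<^esub> \<one>\<^bsub>FObj F Y\<^esub>"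
    using functor_add[OF F o(2,2) nct dt y(1)] nc e1 unfolding u(2) by simp
  then have ncy: "FMor F Y Y (Comp E Y C Y n c) y = y" using functor_closed[OF F o(2,2) nct y(1)] by simp
  have cx: "FMor F Y C c ?x = y" using ncy functor_comp[OF F o(2) C(1) o(2) C(3,2) y(1)] by simp
  have "presented C C (zero_mor E C C) ?x F"
    unfolding presented_def
  proof (intro conjI ballI)
    show "?x \<in> carrier (FObj F C)" by (rule xt)
    fix Z assume Z: "Z \<in> Obj E"
    show "\<exists>g\<in>homs E Z C. FMor F Z C g ?x = z" if z: "z \<in> carrier (FObj F Z)" for z
    proof -
      obtain g where g: "g \<in> homs E Z Y" "FMor F Z Y g y = z" using y(2)[OF Z z] by blast
      have "FMor F Z C (Comp E Z Y C c g) ?x = z"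
        using functor_comp[OF F Z o(2) C(1) g(1) C(3) xt] cx g(2) by simp
      then show ?thesis using comp_closed[OF Z o(2) C(1) g(1) C(3)] by blast
    qed
    show "FMor F Z C g ?x = \<one>\<^bsub>FObj F Z\<^esub> \<longleftrightarrow> (\<exists>h\<in>homs E Z C. Comp E Z C C (zero_mor E C C) h = g)"
      if g: "g \<in> homs E Z C" for g
    proof
      assume "FMor F Z C g ?x = \<one>\<^bsub>FObj F Z\<^esub>"
      then have "FMor F Z Y (Comp E Z C Y n g) y = \<one>\<^bsub>FObj F Z\<^esub>"
        using functor_comp[OF F Z C(1) o(2) g C(2) y(1)] by simp
      then obtain h where h: "h \<in> homs E Z X" "Comp E Z X Y f h = Comp E Z C Y n g"
        using y(3)[OF Z comp_closed[OF Z C(1) o(2) g C(2)]] by blast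
      have "g = Comp E Z C C (Comp E C Y C c n) g" unfolding cn using Z C g by simp
      also have "\<dots> = Comp E Z Y C c (Comp E Z C Y n g)" by (rule comp_assoc[OF Z C(1) o(2) C(1) g C(2,3)])
      also have "\<dots> = Comp E Z X C (Comp E X Y C c f) h"
        unfolding h(2)[symmetric] by (rule comp_assoc[OF Z o(1,2) C(1) h(1) o(3) C(3), symmetric])
      also have "\<dots> = zero_mor E Z C" unfolding cf using Z o C h(1) by simp
      finally show "\<exists>h\<in>homs E Z C. Comp E Z C C (zero_mor E C C) h = g"
        using Z C by (intro bexI[of _ "zero_mor E Z C"]) simp_all
    next
      assume "\<exists>h\<in>homs E Z C. Comp E Z C C (zero_mor E C C) h = g"
      then have "g = zero_mor E Z C" using Z C by auto
      then show "FMor F Z C g ?x = \<one>\<^bsub>FObj F Z\<^esub>" using F Z C xt by simp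
    qed
  qed
  then show ?thesis using C(1) by blast
qed

text \<open>To lift \<open>h : C -> B\<close> along a deflation \<open>d : A -> B\<close>, test
  against the cokernel of \<Upsilon>(d), which is effaceable. The class of \<open>h\<close> there
  defines a map from \<open>R\<close>; it vanishes by orthogonality, so \<open>h\<close> factors
  through \<open>d\<close>.\<close>

lemma represented_left_perp_projective:
  fixes \<iota> :: "'m \<Rightarrow> 'g" and R :: "('o, 'm, 'g) cfunctor"
  assumes R: "additive_functor E R" "presented C C (zero_mor E C C) x R" and C: "C \<in> Obj E"
    and perp: "R \<in> left_perp (mod_adm_category E) (eff E)" and \<iota>: "inj \<iota>"
  shows "C \<in> Proj E"
proof -
  note x = presented_elim[OF R(2)]
  have "\<exists>h'\<in>homs E C A. Comp E C A B d h' = h" if d: "deflation E A B d" and h: "h \<in> homs E C B" for A B d h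
  proof -
    note o = deflation_typed[OF d]
    obtain N :: "('o, 'm, 'g) cfunctor" and w where N: "additive_functor E N" "presented A B d w N"
      by (rule ex_presented[OF o \<iota>])
    note w = presented_elim[OF N(2)]
    have "N \<in> eff E" unfolding eff_iff using N d by blast
    then have "homs (mod_adm_category E) R N = {zero_mor (mod_adm_category E) R N}"
      using perp unfolding left_perp_def by blast
    then have z: "\<alpha> X z = \<one>\<^bsub>FObj N X\<^esub>"
      if "\<alpha> \<in> nat_trans E R N" "X \<in> Obj E" "z \<in> carrier (FObj R X)" for \<alpha> X z
      unfolding homs_eq_zero_iff[OF R(1) N(1)] using that by blast
    have ht: "FMor N C B h w \<in> carrier (FObj N C)" using N C o h w(1) by simp
    obtain \<tau> where \<tau>: "\<tau> \<in> nat_trans E R N"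
      "\<And>Z g. \<lbrakk>Z \<in> Obj E; g \<in> homs E Z C\<rbrakk> \<Longrightarrow> \<tau> Z (FMor R Z C g x) = FMor N Z C g (FMor N C B h w)"
      by (rule presented_nat_trans[OF R(1) N(1) C C zero_closed[OF C C] R(2) ht]) (use N(1) C ht in simp_all)
    have "\<tau> C x = FMor N C B h w" using \<tau>(2)[OF C ident_closed[OF C]] R(1) N(1) C x(1) ht by simp
    then have "FMor N C B h w = \<one>\<^bsub>FObj N C\<^esub>" using z[OF \<tau>(1) C x(1)] by simp
    then show ?thesis using w(3)[OF C h] by blast
  qed
  then show ?thesis using C unfolding Proj_def by blast
qed

text \<open>
  The cokernel \<open>H\<close> of \<open>F \<rightarrow> \<Upsilon>(X)\<close> is effaceable, so some deflation \<open>q\<close> onto \<open>X\<close> factors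
  through the map \<open>b : C \<rightarrow> X\<close> given by \<open>\<Upsilon>(C) \<rightarrow> F \<rightarrow> \<Upsilon>(X)\<close>. The kernel of \<open>\<Upsilon>(b)\<close> lies in
  \<open>mod_adm\<close>, which makes it representable; hence \<open>b\<close> has a kernel and is itself a deflation.
\<close>

lemma ex_projective_deflation:
  fixes \<iota> :: "'m \<Rightarrow> 'g" and R :: "('o, 'm, 'g) cfunctor"
  assumes \<iota>: "inj \<iota>" and X: "X \<in> Obj E"
    and R: "additive_functor E R" "presented X X (zero_mor E X X) x R"
    and conf: "Conf (mod_adm_category E) F \<alpha> R \<beta> H" and H: "H \<in> eff E"
    and F: "F \<in> gen (mod_adm_category E) (Proj (mod_adm_category E) \<inter> left_perp (mod_adm_category E) (eff E))"
  shows "\<exists>P\<in>Proj E. \<exists>p. deflation E P X p"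
proof -
  note x = presented_elim[OF R(2)]
  have \<alpha>: "\<alpha> \<in> nat_trans E F R" and \<beta>: "\<beta> \<in> nat_trans E R H" and F_add: "additive_functor E F"
    and \<alpha>_inj: "\<And>Z. Z \<in> Obj E \<Longrightarrow> inj_on (\<alpha> Z) (carrier (FObj F Z))"
    and \<alpha>_im: "\<And>Z. Z \<in> Obj E \<Longrightarrow> \<alpha> Z ` carrier (FObj F Z) = kernel (FObj R Z) (FObj H Z) (\<beta> Z)"
    using conf by (simp_all add: short_exact_def)
  obtain A B d w where d: "deflation E A B d" and H_add: "additive_functor E H" and Hw: "presented A B d w H"
    using H unfolding eff_iff by blast
  note w = presented_elim[OF Hw] and dt = deflation_typed[OF d]
  obtain G L \<kappa> \<gamma> where G: "G \<in> Proj (mod_adm_category E)" "G \<in> left_perp (mod_adm_category E) (eff E)"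
    and L_conf: "Conf (mod_adm_category E) L \<kappa> G \<gamma> F"
    using F unfolding gen_def deflation_def by blast
  have \<kappa>: "\<kappa> \<in> nat_trans E L G" and \<gamma>: "\<gamma> \<in> nat_trans E G F" and G_add: "additive_functor E G"
    and L: "L \<in> mod_adm E"
    and \<kappa>_inj: "\<And>Z. Z \<in> Obj E \<Longrightarrow> inj_on (\<kappa> Z) (carrier (FObj L Z))"
    and \<kappa>_im: "\<And>Z. Z \<in> Obj E \<Longrightarrow> \<kappa> Z ` carrier (FObj L Z) = kernel (FObj G Z) (FObj F Z) (\<gamma> Z)"
    and \<gamma>_surj: "\<And>Z. Z \<in> Obj E \<Longrightarrow> \<gamma> Z ` carrier (FObj G Z) = carrier (FObj F Z)"
    using L_conf by (simp_all add: short_exact_def)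
  obtain C c where C: "C \<in> Obj E" and Gc: "presented C C (zero_mor E C C) c G"
    using projective_represented[OF G(1) \<iota>] by blast
  note c = presented_elim[OF Gc]
  have C_proj: "C \<in> Proj E" by (rule represented_left_perp_projective[OF G_add Gc C G(2) \<iota>])
  have \<gamma>c: "\<gamma> C c \<in> carrier (FObj F C)" by (rule nat_trans_closed[OF \<gamma> C c(1)])
  obtain b where b: "b \<in> homs E C X" "FMor R C X b x = \<alpha> C (\<gamma> C c)"
    using x(2)[OF C nat_trans_closed[OF \<alpha> C \<gamma>c]] by blast
  have b_app: "\<alpha> Z (\<gamma> Z (FMor G Z C g c)) = FMor R Z X (Comp E Z C X b g) x"
    if Z: "Z \<in> Obj E" and g: "g \<in> homs E Z C" for Z g
    using nat_trans_natural[OF \<gamma> Z C g c(1)] nat_trans_natural[OF \<alpha> Z C g \<gamma>c]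
      functor_comp[OF R(1) Z C X g b(1) x(1)] b(2) by simp
  obtain a where a: "a \<in> homs E X B" "FMor H X B a w = \<beta> X x"
    using w(2)[OF X nat_trans_closed[OF \<beta> X x(1)]] by blast
  \<comment> \<open>The class of \<open>x\<close> in \<open>H(X)\<close> is represented by
    \<open>a\<close>. Pulling \<open>d\<close> back along \<open>a\<close> makes \<open>a q\<close>
    factor through \<open>d\<close>, so this class dies when restricted along \<open>q\<close>; by
    exactness \<open>q\<close> then comes from \<open>F\<close> and, \<gamma> being surjective, from
    a morphism \<open>t : W -> C\<close>.\<close>
  obtain W a' q where pb: "is_pullback E W a' A q X d a B" and q: "deflation E W X q"
    using deflation_pullback[OF d X a(1)] by blast
  note qt = deflation_typed[OF q]
  have a': "a' \<in> homs E W A" and sq: "Comp E W A B d a' = Comp E W X B a q"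
    using pb unfolding is_pullback_def by auto
  have "\<beta> W (FMor R W X q x) = FMor H W B (Comp E W X B a q) w"
    using nat_trans_natural[OF \<beta> qt(1,2,3) x(1)] functor_comp[OF H_add qt(1,2) dt(2) qt(3) a(1) w(1)] a(2) by simp
  also have "\<dots> = \<one>\<^bsub>FObj H W\<^esub>"
    using w(3)[OF qt(1) comp_closed[OF qt(1,2) dt(2) qt(3) a(1)]] sq a' by blast
  finally have "FMor R W X q x \<in> \<alpha> W ` carrier (FObj F W)"
    unfolding \<alpha>_im[OF qt(1)] kernel_def using functor_closed[OF R(1) qt x(1)] by simp
  then obtain v where v: "v \<in> carrier (FObj F W)" "FMor R W X q x = \<alpha> W v" by (elim imageE)
  then have "v \<in> \<gamma> W ` carrier (FObj G W)" using \<gamma>_surj[OF qt(1)] by simp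
  then obtain v' where v': "v' \<in> carrier (FObj G W)" "v = \<gamma> W v'" by (elim imageE)
  obtain t where t: "t \<in> homs E W C" "FMor G W C t c = v'" using c(2)[OF qt(1) v'(1)] by blast
  have "FMor R W X q x = FMor R W X (Comp E W C X b t) x" using v(2) v'(2) t b_app[OF qt(1) t(1)] by simp
  then have qbt: "q = Comp E W C X b t"
    using represented_eq_iff[OF R X qt(1,3) comp_closed[OF qt(1) C X t(1) b(1)]] by blast
  \<comment> \<open>\<open>L\<close> is the kernel of \<gamma> and, since \<alpha> is injective,
    also that of the map \<Upsilon>(C) -> \<Upsilon>(X) given by \<open>b\<close>. Its presentation
    extends this map to the four-term exact sequence that \<open>ex_kernel_of_presentation\<close>
    takes as input; \<open>z\<close> represents the generator of \<open>L\<close> inside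
    \<open>G\<close>.\<close>
  obtain A' B' f l where f: "admissible E A' B' f" and L_add: "additive_functor E L" and Ll: "presented A' B' f l L"
    using L unfolding mod_adm_iff by blast
  note l = presented_elim[OF Ll] and ft = admissible_typed[OF f]
  obtain z where z: "z \<in> homs E B' C" "FMor G B' C z c = \<kappa> B' l"
    using c(2)[OF ft(2) nat_trans_closed[OF \<kappa> ft(2) l(1)]] by blast
  have z_app: "\<kappa> Z (FMor L Z B' g l) = FMor G Z C (Comp E Z B' C z g) c"
    if Z: "Z \<in> Obj E" and g: "g \<in> homs E Z B'" for Z g
    using nat_trans_natural[OF \<kappa> Z ft(2) g l(1)] functor_comp[OF G_add Z ft(2) C g z(1) c(1)] z(2) by simp
  have "\<exists>D k. is_kernel E D k C b X"
  proof (rule ex_kernel_of_presentation[OF f C X z(1) b(1)])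
    fix Z g assume Z: "Z \<in> Obj E" and g: "g \<in> homs E Z B'"
    interpret \<kappa>Z: group_hom "FObj L Z" "FObj G Z" "\<kappa> Z" by (rule nat_trans_group_hom[OF \<kappa> L_add G_add Z])
    have gl: "FMor L Z B' g l \<in> carrier (FObj L Z)" by (rule functor_closed[OF L_add Z ft(2) g l(1)])
    have "Comp E Z B' C z g = zero_mor E Z C \<longleftrightarrow> \<kappa> Z (FMor L Z B' g l) = \<one>\<^bsub>FObj G Z\<^esub>"
      using represented_zero_iff[OF Gc C Z comp_closed[OF Z ft(2) C g z(1)]] z_app[OF Z g] by simp
    also have "\<dots> \<longleftrightarrow> FMor L Z B' g l = \<one>\<^bsub>FObj L Z\<^esub>"
      using inj_on_eq_iff[OF \<kappa>_inj[OF Z] gl \<kappa>Z.G.one_closed] by simp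
    finally show "Comp E Z B' C z g = zero_mor E Z C \<longleftrightarrow> (\<exists>h\<in>homs E Z A'. Comp E Z A' B' f h = g)"
      using l(3)[OF Z g] by simp
  next
    fix Z g assume Z: "Z \<in> Obj E" and g: "g \<in> homs E Z C"
    interpret \<alpha>Z: group_hom "FObj F Z" "FObj R Z" "\<alpha> Z" by (rule nat_trans_group_hom[OF \<alpha> F_add R(1) Z])
    have gc: "FMor G Z C g c \<in> carrier (FObj G Z)" by (rule functor_closed[OF G_add Z C g c(1)])
    have "Comp E Z C X b g = zero_mor E Z X \<longleftrightarrow> \<alpha> Z (\<gamma> Z (FMor G Z C g c)) = \<one>\<^bsub>FObj R Z\<^esub>"
      using represented_zero_iff[OF R(2) X Z comp_closed[OF Z C X g b(1)]] b_app[OF Z g] by simp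
    also have "\<dots> \<longleftrightarrow> \<gamma> Z (FMor G Z C g c) = \<one>\<^bsub>FObj F Z\<^esub>"
      using inj_on_eq_iff[OF \<alpha>_inj[OF Z] nat_trans_closed[OF \<gamma> Z gc] \<alpha>Z.G.one_closed] by simp
    also have "\<dots> \<longleftrightarrow> FMor G Z C g c \<in> \<kappa> Z ` carrier (FObj L Z)"
      unfolding \<kappa>_im[OF Z] kernel_def using gc by simp
    also have "\<dots> \<longleftrightarrow> (\<exists>h\<in>homs E Z B'. Comp E Z B' C z h = g)"
    proof
      assume "FMor G Z C g c \<in> \<kappa> Z ` carrier (FObj L Z)"
      then obtain m where m: "m \<in> carrier (FObj L Z)" "FMor G Z C g c = \<kappa> Z m" by (elim imageE)
      obtain h where h: "h \<in> homs E Z B'" "FMor L Z B' h l = m" using l(2)[OF Z m(1)] by blast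
      have "FMor G Z C (Comp E Z B' C z h) c = FMor G Z C g c" using z_app[OF Z h(1)] h(2) m(2) by simp
      then show "\<exists>h\<in>homs E Z B'. Comp E Z B' C z h = g"
        using represented_eq_iff[OF G_add Gc C Z comp_closed[OF Z ft(2) C h(1) z(1)] g] h(1) by blast
    next
      assume "\<exists>h\<in>homs E Z B'. Comp E Z B' C z h = g"
      then obtain h where h: "h \<in> homs E Z B'" "Comp E Z B' C z h = g" by blast
      then show "FMor G Z C g c \<in> \<kappa> Z ` carrier (FObj L Z)"
        using z_app[OF Z h(1)] functor_closed[OF L_add Z ft(2) h(1) l(1)] by (intro image_eqI) simp_all
    qed
    finally show "Comp E Z C X b g = zero_mor E Z X \<longleftrightarrow> (\<exists>h\<in>homs E Z B'. Comp E Z B' C z h = g)" .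
  qed
  then obtain D k where K: "is_kernel E D k C b X" by blast
  have "deflation E C X b"
    by (rule deflation_of_factor[OF _ K qt(1) t(1)]) (use q qbt in simp)
  then show ?thesis using C_proj by blast
qed

end

theorem proposition4p26:
  fixes E :: "('o, 'm) exact_structure"
    and \<iota> :: "'m \<Rightarrow> 'g"
    and M :: "(('o, 'm, 'g) cfunctor, 'o \<Rightarrow> 'g \<Rightarrow> 'g) exact_structure"
    and \<Q> \<T> :: "('o, 'm, 'g) cfunctor set"
  assumes "exact_category E"
    and "inj \<iota>"
  defines "M \<equiv> mod_adm_category E"
    and "\<Q> \<equiv> Proj M"
    and "\<T> \<equiv> gen M (\<Q> \<inter> left_perp M (eff E))"
  shows "(enough_projectives E \<longleftrightarrow> torsion_pair M \<T> (eff E)) \<and>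
         (enough_projectives E \<longleftrightarrow>
            (\<forall>P\<in>\<Q>. \<exists>F' \<alpha> \<beta> F''. Conf M F' \<alpha> P \<beta> F'' \<and> F' \<in> \<T> \<and> F'' \<in> eff E))"
proof -
  interpret exact_category E by (rule assms(1))
  have T_sub: "\<T> \<subseteq> Obj M" unfolding \<T>_def gen_def by blast
  have eff_sub: "eff E \<subseteq> Obj M" using eff_subset_mod_adm unfolding M_def by simp
  \<comment> \<open>A deflation \<open>P -> T\<close> is pointwise surjective, so a map from
    \<open>T\<close> vanishes once its composite with it does; the composite vanishes because
    \<open>P\<close> is left orthogonal.\<close>
  have hom_zero: "homs M T F = {zero_mor M T F}" if T: "T \<in> \<T>" and F: "F \<in> eff E" for T F
  proof -
    obtain P \<beta> where P: "P \<in> left_perp M (eff E)" and d: "deflation M P T \<beta>"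
      using T unfolding \<T>_def gen_def by blast
    note \<beta> = deflation_mod_admD[OF d[unfolded M_def]]
    have add: "additive_functor E P" "additive_functor E T" "additive_functor E F"
      using \<beta>(1,2) F eff_subset_mod_adm mod_adm_additive by blast+
    have "homs M P F = {zero_mor M P F}" using P F unfolding left_perp_def by blast
    then have z: "\<forall>\<alpha>\<in>nat_trans E P F. \<forall>X\<in>Obj E. \<forall>x\<in>carrier (FObj P X). \<alpha> X x = \<one>\<^bsub>FObj F X\<^esub>"
      unfolding M_def homs_eq_zero_iff[OF add(1,3)] .
    show ?thesis
      unfolding M_def homs_eq_zero_iff[OF add(2,3)]
    proof (intro ballI)
      fix \<alpha> X x assume \<alpha>: "\<alpha> \<in> nat_trans E T F" and X: "X \<in> Obj E" and x: "x \<in> carrier (FObj T X)"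
      have "x \<in> \<beta> X ` carrier (FObj P X)" using \<beta>(4)[OF X] x by simp
      then obtain p where p: "p \<in> carrier (FObj P X)" "x = \<beta> X p" by (elim imageE)
      show "\<alpha> X x = \<one>\<^bsub>FObj F X\<^esub>"
        using bspec[OF bspec[OF bspec[OF z comp_nat_trans[OF add(1) \<beta>(3) \<alpha>]] X] p(1)] X p by simp
    qed
  qed
  have 12: "torsion_pair M \<T> (eff E)" if ep: "enough_projectives E"
  proof -
    have "\<exists>T\<in>\<T>. \<exists>H\<in>eff E. \<exists>\<alpha> \<beta>. Conf M T \<alpha> F \<beta> H" if "F \<in> Obj M" for F
      using ex_torsion_sequence[OF ep assms(2), of F] that
      unfolding \<T>_def \<Q>_def M_def by (simp only: mod_adm_category_simps(1))
    moreover have "iso_closed M \<T>" "iso_closed M (eff E)"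
      unfolding \<T>_def M_def by (rule gen_iso_closed, rule eff_iso_closed)
    ultimately show ?thesis
      unfolding torsion_pair_def using T_sub eff_sub hom_zero by blast
  qed
  have 23: "\<forall>P\<in>\<Q>. \<exists>F' \<alpha> \<beta> F''. Conf M F' \<alpha> P \<beta> F'' \<and> F' \<in> \<T> \<and> F'' \<in> eff E"
    if "torsion_pair M \<T> (eff E)"
  proof
    fix P assume "P \<in> \<Q>"
    then have "P \<in> Obj M" unfolding \<Q>_def Proj_def by blast
    then show "\<exists>F' \<alpha> \<beta> F''. Conf M F' \<alpha> P \<beta> F'' \<and> F' \<in> \<T> \<and> F'' \<in> eff E"
      using that unfolding torsion_pair_def by blast
  qed
  have 31: "enough_projectives E"
    if 3: "\<forall>P\<in>\<Q>. \<exists>F' \<alpha> \<beta> F''. Conf M F' \<alpha> P \<beta> F'' \<and> F' \<in> \<T> \<and> F'' \<in> eff E"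
    unfolding enough_projectives_def
  proof
    fix X assume X: "X \<in> Obj E"
    \<comment> \<open>Condition (3) is applied to the copy of \<Upsilon>(X), which belongs to
      \<Q>.\<close>
    obtain R :: "('o, 'm, 'g) cfunctor" and x where R: "additive_functor E R" "presented X X (zero_mor E X X) x R"
      by (rule ex_represented[OF X assms(2)])
    have "R \<in> \<Q>" unfolding \<Q>_def M_def by (rule represented_projective[OF R X])
    then obtain F' \<alpha> \<beta> F'' where c: "Conf M F' \<alpha> R \<beta> F''" and F': "F' \<in> \<T>" and F'': "F'' \<in> eff E"
      using 3 by blast
    show "\<exists>P\<in>Proj E. \<exists>p. deflation E P X p"
      by (rule ex_projective_deflation[OF assms(2) X R c[unfolded M_def] F'' F'[unfolded \<T>_def \<Q>_def M_def]])
  qed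
  show ?thesis using 12 23 31 by blast
qed

end
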